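(* Consider a homogeneous sensor network, i.e. there are probability density functions $g,f$ on $\mathbb R$ such that $g_\ell=g$ and $f_\ell=f$ for all $\ell\in[L]$. Let $\gamma>1$ and let $\boldsymbol\lambda_U=\left[\binom Lm^{-1},\dots,\binom Lm^{-1}\right]^\top\in\mathcal A$ be the uniform weight vector. If the threshold $b$ is chosen such that $\mathbb E_\infty[\tau_W(\boldsymbol\lambda_U,b)]=\gamma$, then the M-CUSUM test $\tau_W(\boldsymbol\lambda_U,b)$ is exactly optimal for the problem of minimizing $\mathrm{WADD}(\tau)$ over $\tau\in\mathcal C_\gamma$, i.e. $$\mathrm{WADD}(\tau_W(\boldsymbol\lambda_U,b))=\inf_{\tau\in\mathcal C_\gamma}\mathrm{WADD}(\tau).$$
   Context: Network and data. Let $L\ge1$, $[L]=\{1,\dots,L\}$ be the set of sensors, and $1\le m\le L$ a fixed known integer. For each $\ell\in[L]$, $g_\ell$ and $f_\ell$ are (known) probability density functions on $\mathbb R$ (non-anomalous and anomalous) defining different distributions. The observation at time $k\ge1$ is $\mathbf X[k]=(X_1[k],\dots,X_L[k])\in\mathbb R^L$. Let $\mathscr F_k=\sigma(\mathbf X[1],\dots,\mathbf X[k])$ ($\mathscr F_0$ trivial). Let $\mathcal E$ be the set of all $m$-element subsets of $[L]$ (equivalently, ordered vectors of $m$ distinct indices), so $|\mathcal E|=\binom Lm$. Let $\mathbf g(\mathbf x)=\prod_{\ell=1}^L g_\ell(x_\ell)$ and, for $E\in\mathcal E$, $p_E(\mathbf x)=\prod_{\ell\in E}f_\ell(x_\ell)\prod_{\ell\notin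 E}g_\ell(x_\ell)$. Moving anomaly model. An anomaly path is a deterministic sequence $\mathbf S=\{\mathbf S[k]\}_{k\ge1}$ with $\mathbf S[k]\in\mathcal E$. For a changepoint $\nu\ge0$ (an integer) and path $\mathbf S$, under $\mathbb P_\nu^{\mathbf S}$ (expectation $\mathbb E_\nu^{\mathbf S}$) the $\mathbf X[k]$ are independent over $k$, with density $\mathbf g$ for $1\le k\le\nu$ and $p_{\mathbf S[k]}$ for $k>\nu$. Under $\mathbb P_\infty$ (expectation $\mathbb E_\infty$) all $\mathbf X[k]$ are i.i.d. with density $\mathbf g$. Mixtures. $\mathcal A$ is the simplex of probability vectors $\boldsymbol\alpha=\{\alpha_E:E\in\mathcal E\}$, and $\overline p_{\boldsymbol\alpha}(\mathbf x)=\sum_{E\in\mathcal E}\alpha_E p_E(\mathbf x)$. Stopping times and metrics. A stopping time $\tau$ is a positive random variable with $\{\tau\le k\}\in\mathscr F_k$ for all $k\ge1$. Define $$\mathrm{WADD}(\tau)=\sup_{\mathbf S}\sup_{\nu\ge0}\operatorname{ess\,sup}\,\mathbb E_\nu^{\mathbf S}[\tau-\nu\mid\tau>\nu,\mathscr F_\nu],$$ where the conditional expectation is set equal to $1$ when $\mathbb P_\nu^{\mathbf S}(\tau>\nu)=0$. For $\gamma>1$, $\mathcal C_\gamma=\{\tau:\mathbb E_\infty[\tau]\ge\gamma\}$ (stopping times adapted to $\{\mathscr F_k\}$). M-CUSUM test. For $\boldsymbol\lambda\in\mathcal A$ let $\mathcal L_{\boldsymbol\lambda}(k,\nu)=\prod_{j=\nu+1}^k\frac{\overline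 p_{\boldsymbol\lambda}(\mathbf X[j])}{\mathbf g(\mathbf X[j])}$, $W_{\boldsymbol\lambda}[k]=\max_{1\le i\le k}\mathcal L_{\boldsymbol\lambda}(k,i-1)$ for $k\ge1$ and $W_{\boldsymbol\lambda}[0]=0$, and for $b>0$ let $\tau_W(\boldsymbol\lambda,b)=\inf\{k\ge1:W_{\boldsymbol\lambda}[k]\ge e^b\}$. *)

theory Defs
  imports "HOL-Probability.Probability"
begin

definition pdf_on_reals :: "(real \<Rightarrow> real) \<Rightarrow> bool" where
  "pdf_on_reals h \<longleftrightarrow>
     h \<in> borel_measurable borel \<and> (\<forall>x. 0 \<le> h x) \<and> (\<integral>\<^sup>+ x. ennreal (h x) \<partial>lborel) = 1"

text \<open>
  Sensors are the numbers \<open>1, \<dots>, L\<close>; an observation is an extensional function on \<open>{1..L}\<close>,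
  and densities of observations are taken with respect to the product Lebesgue measure.
\<close>

definition obs_space :: "nat \<Rightarrow> (nat \<Rightarrow> real) measure" where
  "obs_space L = (\<Pi>\<^sub>M l\<in>{1..L}. lborel)"

definition anomaly_sets :: "nat \<Rightarrow> nat \<Rightarrow> nat set set" where
  "anomaly_sets L m = {E. E \<subseteq> {1..L} \<and> card E = m}"

definition dens_pre :: "nat \<Rightarrow> (nat \<Rightarrow> real \<Rightarrow> real) \<Rightarrow> (nat \<Rightarrow> real) \<Rightarrow> real" where
  "dens_pre L gs x = (\<Prod>l\<in>{1..L}. gs l (x l))"

definition dens_post ::
  "nat \<Rightarrow> (nat \<Rightarrow> real \<Rightarrow> real) \<Rightarrow> (nat \<Rightarrow> real \<Rightarrow> real) \<Rightarrow> nat set \<Rightarrow> (nat \<Rightarrow> real) \<Rightarrow> real" where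
  "dens_post L gs fs E x = (\<Prod>l\<in>E. fs l (x l)) * (\<Prod>l\<in>{1..L} - E. gs l (x l))"


subsection \<open>Moving anomaly model\<close>

text \<open>Only the values \<open>S k\<close> with \<open>k \<ge> 1\<close> are meaningful.\<close>

definition anomaly_paths :: "nat \<Rightarrow> nat \<Rightarrow> (nat \<Rightarrow> nat set) set" where
  "anomaly_paths L m = {S. \<forall>k\<ge>1. S k \<in> anomaly_sets L m}"

text \<open>
  \<open>Q\<close> is a probability measure on the measurable space underlying \<open>M\<close> (only the
  \<open>\<sigma>\<close>-algebra of \<open>M\<close> matters) under which the observations \<open>X 1, X 2, \<dots>\<close> are
  independent and \<open>X k\<close> has density \<open>d k\<close>.
\<close>

definition independent_obs ::
  "nat \<Rightarrow> 'w measure \<Rightarrow> (nat \<Rightarrow> 'w \<Rightarrow> nat \<Rightarrow> real) \<Rightarrow> 'w measure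
     \<Rightarrow> (nat \<Rightarrow> (nat \<Rightarrow> real) \<Rightarrow> real) \<Rightarrow> bool" where
  "independent_obs L M X Q d \<longleftrightarrow>
     prob_space Q \<and> space Q = space M \<and> sets Q = sets M \<and>
     prob_space.indep_vars Q (\<lambda>k. obs_space L) X {1..} \<and>
     (\<forall>k\<ge>1. distributed Q (obs_space L) (X k) (\<lambda>x. ennreal (d k x)))"

text \<open>
  \<open>P \<nu> S\<close> is the law with changepoint \<open>\<nu>\<close> and anomaly path \<open>S\<close>; \<open>Pinf\<close> is the law without change.
\<close>

definition moving_anomaly_model ::
  "nat \<Rightarrow> nat \<Rightarrow> (nat \<Rightarrow> real \<Rightarrow> real) \<Rightarrow> (nat \<Rightarrow> real \<Rightarrow> real)
     \<Rightarrow> 'w measure \<Rightarrow> (nat \<Rightarrow> 'w \<Rightarrow> nat \<Rightarrow> real)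
     \<Rightarrow> (nat \<Rightarrow> (nat \<Rightarrow> nat set) \<Rightarrow> 'w measure) \<Rightarrow> 'w measure \<Rightarrow> bool" where
  "moving_anomaly_model L m gs fs M X P Pinf \<longleftrightarrow>
     independent_obs L M X Pinf (\<lambda>k. dens_pre L gs) \<and>
     (\<forall>\<nu>. \<forall>S\<in>anomaly_paths L m.
        independent_obs L M X (P \<nu> S)
          (\<lambda>k. if k \<le> \<nu> then dens_pre L gs else dens_post L gs fs (S k)))"

definition obs_filtration ::
  "nat \<Rightarrow> 'w measure \<Rightarrow> (nat \<Rightarrow> 'w \<Rightarrow> nat \<Rightarrow> real) \<Rightarrow> nat \<Rightarrow> 'w measure" where
  "obs_filtration L M X k =
     sigma (space M) {X j -` A \<inter> space M | j A. 1 \<le> j \<and> j \<le> k \<and> A \<in> sets (obs_space L)}"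


subsection \<open>Stopping times and detection delay\<close>

text \<open>
  Stopping times take values in \<open>{1, 2, \<dots>} \<union> {\<infinity>}\<close>. The library constant
  \<^const>\<open>stopping_time\<close> forces the time index of the filtration to be the value type of the
  stopping time, so the adaptedness condition is spelled out.
\<close>

definition obs_stopping_times ::
  "nat \<Rightarrow> 'w measure \<Rightarrow> (nat \<Rightarrow> 'w \<Rightarrow> nat \<Rightarrow> real) \<Rightarrow> ('w \<Rightarrow> enat) set" where
  "obs_stopping_times L M X =
     {\<tau>. (\<forall>\<omega>\<in>space M. 1 \<le> \<tau> \<omega>) \<and>
         (\<forall>k\<ge>1. {\<omega>\<in>space M. \<tau> \<omega> \<le> enat k} \<in> sets (obs_filtration L M X k))}"

definition mean_time :: "'w measure \<Rightarrow> ('w \<Rightarrow> enat) \<Rightarrow> ennreal" where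
  "mean_time Q \<tau> = (\<integral>\<^sup>+ \<omega>. ennreal_of_enat (\<tau> \<omega>) \<partial>Q)"

definition admissible_tests ::
  "nat \<Rightarrow> 'w measure \<Rightarrow> (nat \<Rightarrow> 'w \<Rightarrow> nat \<Rightarrow> real) \<Rightarrow> 'w measure \<Rightarrow> real \<Rightarrow> ('w \<Rightarrow> enat) set" where
  "admissible_tests L M X Pinf \<gamma> =
     {\<tau> \<in> obs_stopping_times L M X. ennreal \<gamma> \<le> mean_time Pinf \<tau>}"

text \<open>
  Essential supremum of \<open>E[\<tau> - \<nu> | \<tau> > \<nu>, G]\<close> under \<open>Q\<close>: one first conditions \<open>Q\<close> on the event
  \<open>\<tau> > \<nu>\<close> and then takes the conditional expectation given the \<open>\<sigma>\<close>-algebra \<open>G\<close>.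
  By convention the conditional expectation is 1 if the event has probability 0.
\<close>

definition worst_cond_delay :: "'w measure \<Rightarrow> 'w measure \<Rightarrow> nat \<Rightarrow> ('w \<Rightarrow> enat) \<Rightarrow> ennreal" where
  "worst_cond_delay Q G \<nu> \<tau> =
     (let B = {\<omega>\<in>space Q. enat \<nu> < \<tau> \<omega>}; QB = uniform_measure Q B in
      if emeasure Q B = 0 then 1
      else esssup QB (nn_cond_exp QB G (\<lambda>\<omega>. ennreal_of_enat (\<tau> \<omega> - enat \<nu>))))"

definition WADD ::
  "nat \<Rightarrow> nat \<Rightarrow> 'w measure \<Rightarrow> (nat \<Rightarrow> 'w \<Rightarrow> nat \<Rightarrow> real)
     \<Rightarrow> (nat \<Rightarrow> (nat \<Rightarrow> nat set) \<Rightarrow> 'w measure) \<Rightarrow> ('w \<Rightarrow> enat) \<Rightarrow> ennreal" where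
  "WADD L m M X P \<tau> =
     (SUP S\<in>anomaly_paths L m. SUP \<nu>. worst_cond_delay (P \<nu> S) (obs_filtration L M X \<nu>) \<nu> \<tau>)"


subsection \<open>The M-CUSUM test\<close>

definition weight_simplex :: "nat \<Rightarrow> nat \<Rightarrow> (nat set \<Rightarrow> real) set" where
  "weight_simplex L m =
     {\<alpha>. (\<forall>E\<in>anomaly_sets L m. 0 \<le> \<alpha> E) \<and> (\<Sum>E\<in>anomaly_sets L m. \<alpha> E) = 1}"

definition mixture_dens ::
  "nat \<Rightarrow> nat \<Rightarrow> (nat \<Rightarrow> real \<Rightarrow> real) \<Rightarrow> (nat \<Rightarrow> real \<Rightarrow> real) \<Rightarrow> (nat set \<Rightarrow> real)
     \<Rightarrow> (nat \<Rightarrow> real) \<Rightarrow> real" where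
  "mixture_dens L m gs fs \<alpha> x = (\<Sum>E\<in>anomaly_sets L m. \<alpha> E * dens_post L gs fs E x)"

text \<open>
  The densities are not assumed to be mutually absolutely continuous, so the likelihood ratio is
  computed in \<^typ>\<open>ennreal\<close>, where \<open>c / 0 = \<infinity>\<close> for \<open>c > 0\<close> (and \<open>0 / 0 = 0\<close>, which
  occurs with probability 0 under each of the laws considered). In the field of real numbers
  \<open>c / 0\<close> would be 0, i.e. an observation impossible before the change would count as evidence
  against a change. The value \<open>0 * \<infinity> = 0\<close> in products does not affect the test, which has
  already stopped at the first infinite factor: the window \<open>i = k\<close> in \<open>mcusum_stat\<close> contains only
  that factor.
\<close>

definition lik_ratio ::
  "nat \<Rightarrow> nat \<Rightarrow> (nat \<Rightarrow> real \<Rightarrow> real) \<Rightarrow> (nat \<Rightarrow> real \<Rightarrow> real) \<Rightarrow> (nat set \<Rightarrow> real)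
     \<Rightarrow> (nat \<Rightarrow> 'w \<Rightarrow> nat \<Rightarrow> real) \<Rightarrow> nat \<Rightarrow> nat \<Rightarrow> 'w \<Rightarrow> ennreal" where
  "lik_ratio L m gs fs \<alpha> X k \<nu> \<omega> =
     (\<Prod>j\<in>{\<nu>+1..k}. ennreal (mixture_dens L m gs fs \<alpha> (X j \<omega>)) / ennreal (dens_pre L gs (X j \<omega>)))"

definition mcusum_stat ::
  "nat \<Rightarrow> nat \<Rightarrow> (nat \<Rightarrow> real \<Rightarrow> real) \<Rightarrow> (nat \<Rightarrow> real \<Rightarrow> real) \<Rightarrow> (nat set \<Rightarrow> real)
     \<Rightarrow> (nat \<Rightarrow> 'w \<Rightarrow> nat \<Rightarrow> real) \<Rightarrow> nat \<Rightarrow> 'w \<Rightarrow> ennreal" where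
  "mcusum_stat L m gs fs \<alpha> X k \<omega> =
     (if k = 0 then 0 else Max ((\<lambda>i. lik_ratio L m gs fs \<alpha> X k (i - 1) \<omega>) ` {1..k}))"

definition mcusum_test ::
  "nat \<Rightarrow> nat \<Rightarrow> (nat \<Rightarrow> real \<Rightarrow> real) \<Rightarrow> (nat \<Rightarrow> real \<Rightarrow> real) \<Rightarrow> (nat \<Rightarrow> 'w \<Rightarrow> nat \<Rightarrow> real)
     \<Rightarrow> (nat set \<Rightarrow> real) \<Rightarrow> real \<Rightarrow> 'w \<Rightarrow> enat" where
  "mcusum_test L m gs fs X \<alpha> b \<omega> =
     Inf {enat k | k. 1 \<le> k \<and> ennreal (exp b) \<le> mcusum_stat L m gs fs \<alpha> X k \<omega>}"

definition uniform_weights :: "nat \<Rightarrow> nat \<Rightarrow> nat set \<Rightarrow> real" where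
  "uniform_weights L m = (\<lambda>E. inverse (real (L choose m)))"

lemma uniform_weights_in_simplex:
  assumes "m \<le> L"
  shows "uniform_weights L m \<in> weight_simplex L m"
proof -
  have "card (anomaly_sets L m) = L choose m"
    unfolding anomaly_sets_def using n_subsets[of "{1..L}" m] by simp
  moreover have "L choose m \<noteq> 0"
    using assms by simp
  ultimately show ?thesis
    by (simp add: weight_simplex_def uniform_weights_def)
qed

end

theory Submission
  imports Defs
begin

text \<open>
  By symmetry, the likelihood ratio of the uniform mixture has the same law under every anomaly set,
  so the delay of the M-CUSUM test does not depend on the anomaly path; as the CUSUM statistic \<open>W\<close>
  is monotone in its starting value, the delay is largest when \<open>W \<le> 1\<close> at the change, and there it
  equals a constant \<open>D\<close>. For any other test, averaging over all paths reduces the problem to the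
  single change from \<open>\<^bold>g\<close> to the mixture density, where Moustakides' argument applies: weighting the
  changepoint \<open>\<nu>\<close> with \<open>(1 - W \<nu>)\<^sup>+\<close> gives
  \<open>E\<^sub>\<infinity> (\<Sum>k<\<tau>. max 1 (W k)) \<le> WADD \<tau> * E\<^sub>\<infinity> (\<Sum>k<\<tau>. (1 - W k)\<^sup>+)\<close>, with equality and constant \<open>D\<close> for the
  CUSUM test. It remains to minimise \<open>E\<^sub>\<infinity> (\<Sum>k<\<tau>. max 1 (W k) - D * (1 - W k)\<^sup>+)\<close> for a given mean
  duration. The summand is increasing in \<open>W\<close>, so for a suitable price \<open>c\<close> per step the optimal
  stopping rule is the first passage of \<open>W\<close> over the given threshold. All integrals are taken under
  \<open>P\<^sub>\<infinity>\<close>, which handles singular parts of the anomalous law: the test stops as soon as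
  the pre-change density vanishes.
\<close>

subsection \<open>Optimal stopping of the CUSUM chain\<close>

text \<open>The criterion is a ratio of two sums, to which optimal stopping does not apply directly.
  Subtracting \<open>D\<close> times the denominator makes it additive, and \<open>D\<close> is the
  multiplier for which the CUSUM rule has total cost 0. A rule with a delay bound
  \<open>d < D\<close> would have cost at most \<open>d - D\<close>, because the changepoint 0 alone
  contributes weight 1. Such a negative cost can only be bought by a shorter mean duration; a price
  and a value function certify this by telescoping along any rule. The threshold is prescribed, so
  the price is adjusted to it and not conversely. A competitor may have infinite mean duration and
  may let \<open>W\<close> grow beyond every bound, hence its sums are taken up to finite horizons
  only. Likelihood ratios relative to \<open>Pinf\<close> miss the singular mass of the anomalous
  laws: for the CUSUM rule nothing is lost, and for a competitor the loss only lowers the side that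
  is bounded from above.\<close>

locale cusum_kernel = prob_space \<mu> for \<mu> :: "'x measure" +
  fixes r :: "'x \<Rightarrow> real" and B :: real
  assumes r_measurable [measurable]: "r \<in> borel_measurable \<mu>"
    and r_nonneg: "\<And>x. 0 \<le> r x"
    and B_gt_1: "1 < B"
begin

text \<open>The CUSUM recursion: the best window ending at the next observation either extends the
  best window so far or consists of that observation alone, hence \<open>max 1 w\<close>.\<close>

definition nxt :: "real \<Rightarrow> 'x \<Rightarrow> real" where
  "nxt w x = max 1 w * r x"

lemma nxt_measurable [measurable]:
  "(\<lambda>p. nxt (fst p) (snd p)) \<in> borel_measurable (borel \<Otimes>\<^sub>M \<mu>)"
  unfolding nxt_def by measurable

lemma nxt_measurable' [measurable]: "nxt w \<in> borel_measurable \<mu>"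
  unfolding nxt_def by measurable

lemma nxt_nonneg: "0 \<le> nxt w x"
  by (simp add: nxt_def r_nonneg)

lemma nxt_mono: "v \<le> w \<Longrightarrow> nxt v x \<le> nxt w x"
  unfolding nxt_def by (intro mult_right_mono r_nonneg) auto

lemma nxt_restart: "w \<le> 1 \<Longrightarrow> nxt w = nxt 0"
  by (auto simp: nxt_def fun_eq_iff)

definition step_mean :: "(real \<Rightarrow> real) \<Rightarrow> real \<Rightarrow> real" where
  "step_mean u w = (\<integral>x. u (nxt w x) \<partial>\<mu>)"

lemma step_mean_measurable [measurable]:
  assumes [measurable]: "u \<in> borel_measurable borel"
  shows "step_mean u \<in> borel_measurable borel"
proof -
  have "(\<lambda>p. u (nxt (fst p) (snd p))) \<in> borel_measurable (borel \<Otimes>\<^sub>M \<mu>)"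
    by measurable
  then have "(\<lambda>w. \<integral>x. u (nxt w x) \<partial>\<mu>) \<in> borel_measurable borel"
    by (intro borel_measurable_lebesgue_integral) (simp add: split_def)
  then show ?thesis unfolding step_mean_def .
qed

lemma integrable_step:
  assumes [measurable]: "u \<in> borel_measurable borel" and "\<And>w. 0 \<le> u w" "\<And>w. u w \<le> (K::real)"
  shows "integrable \<mu> (\<lambda>x. u (nxt w x))"
  by (rule integrable_const_bound[where B = K]) (use assms in auto)

lemma step_mean_bounds:
  assumes [measurable]: "u \<in> borel_measurable borel" and "\<And>w. 0 \<le> u w" "\<And>w. u w \<le> (K::real)"
  shows "0 \<le> step_mean u w" "step_mean u w \<le> K"
proof -
  show "0 \<le> step_mean u w"
    unfolding step_mean_def using assms by (intro integral_nonneg_AE) auto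
  have "step_mean u w \<le> (\<integral>x. K \<partial>\<mu>)"
    unfolding step_mean_def by (intro integral_mono integrable_step[where K=K] integrable_const) (use assms in auto)
  then show "step_mean u w \<le> K" by (simp add: prob_space)
qed

lemma step_mean_mono:
  assumes "u \<in> borel_measurable borel" "\<And>w. 0 \<le> u w" "\<And>w. u w \<le> (K::real)"
    and "v \<in> borel_measurable borel" "\<And>w. 0 \<le> v w" "\<And>w. v w \<le> (K'::real)"
    and "\<And>w. u w \<le> v w"
  shows "step_mean u w \<le> step_mean v w"
  unfolding step_mean_def
  by (intro integral_mono integrable_step[where K=K] integrable_step[where K=K']) (use assms in auto)

lemma step_mean_antimono:
  assumes u: "u \<in> borel_measurable borel" "\<And>w. 0 \<le> u w" "\<And>w. u w \<le> (K::real)" "antimono u"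
  shows "antimono (step_mean u)"
proof (rule antimonoI)
  fix v w :: real assume "v \<le> w"
  then show "step_mean u w \<le> step_mean u v"
    unfolding step_mean_def using u
    by (intro integral_mono integrable_step[where K=K]) (auto dest: antimonoD intro: antimonoD nxt_mono)
qed

text \<open>
  \<open>pay c h n w\<close> is the largest gain obtainable from at most \<open>n\<close> further steps when each step
  taken at level \<open>w\<close> pays \<open>c - h w\<close> and the process is stopped at \<open>B\<close> at the latest.
\<close>

primrec pay :: "real \<Rightarrow> (real \<Rightarrow> real) \<Rightarrow> nat \<Rightarrow> real \<Rightarrow> real" where
  "pay c h 0 = (\<lambda>w. 0)"
| "pay c h (Suc n) = (\<lambda>w. if w < B then max 0 (c - h w + step_mean (pay c h n) w) else 0)"

lemma pay_nonneg: "0 \<le> pay c h n w"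
  by (cases n) auto

lemma pay_measurable [measurable]:
  assumes [measurable]: "h \<in> borel_measurable borel"
  shows "pay c h n \<in> borel_measurable borel"
  by (induction n) (simp_all, measurable)

text \<open>\<open>N\<close> stands for the mean number of steps before the chain passes
  \<open>B\<close>; its supersolution inequality and its uniform bound keep the values below bounded
  independently of the horizon. \<open>h_min\<close> also covers negative levels, which monotonicity
  compares with 0 in the wrong direction.\<close>

context
  fixes h N :: "real \<Rightarrow> real" and Nmax :: real
  assumes h_measurable [measurable]: "h \<in> borel_measurable borel"
    and h_mono: "mono h" and h_min: "\<And>w. h 0 \<le> h w"
    and N_measurable [measurable]: "N \<in> borel_measurable borel"
    and N_nonneg: "\<And>w. 0 \<le> N w" and N_le: "\<And>w. N w \<le> Nmax"
    and N_step: "\<And>w. 1 + step_mean (\<lambda>v. indicator {..<B} v * N v) w \<le> N w"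
begin

abbreviation N\<^sub>B :: "real \<Rightarrow> real" where
  "N\<^sub>B \<equiv> (\<lambda>v. indicator {..<B} v * N v)"

lemma NB_bounds: "0 \<le> N\<^sub>B w" "N\<^sub>B w \<le> Nmax" "0 \<le> Nmax"
  using N_nonneg[of w] N_le[of w] by (auto simp: indicator_def)

lemma scaled_step: "0 \<le> a \<Longrightarrow> a + step_mean (\<lambda>v. a * N\<^sub>B v) w \<le> a * N w"
  using mult_left_mono[OF N_step[of w], of a]
  by (simp add: step_mean_def algebra_simps)

text \<open>Each step pays at most \<open>c - h 0\<close>, and \<open>N\<close> bounds the mean
  number of steps; \<open>N_step\<close> carries the bound through one step of the recursion. The
  indicator in \<open>N\<^sub>B\<close> accounts for the forced stop at \<open>B\<close>.\<close>

lemma pay_le: "h 0 \<le> c \<Longrightarrow> pay c h n w \<le> (c - h 0) * N\<^sub>B w"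
proof (induction n arbitrary: w)
  case (Suc n)
  have bd: "(c - h 0) * N\<^sub>B v \<le> (c - h 0) * Nmax" for v
    using Suc.prems NB_bounds by (intro mult_left_mono) auto
  have "pay c h n v \<le> (c - h 0) * Nmax" for v
    using Suc.IH[OF Suc.prems, of v] bd[of v] by linarith
  then have "step_mean (pay c h n) w \<le> step_mean (\<lambda>v. (c - h 0) * N\<^sub>B v) w"
    using Suc bd NB_bounds
    by (intro step_mean_mono[where K = "(c - h 0) * Nmax" and K' = "(c - h 0) * Nmax"])
       (auto intro: pay_nonneg mult_nonneg_nonneg)
  moreover have "c - h 0 + step_mean (\<lambda>v. (c - h 0) * N\<^sub>B v) w \<le> (c - h 0) * N w"
    using Suc.prems by (intro scaled_step) simp
  ultimately have "w < B \<Longrightarrow> c - h w + step_mean (pay c h n) w \<le> (c - h 0) * N\<^sub>B w"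
    using h_min[of w] by simp
  then show ?case
    using Suc.prems N_nonneg[of w] by (auto simp: indicator_def)
qed (simp add: NB_bounds)

lemma pay_bound: "h 0 \<le> c \<Longrightarrow> pay c h n w \<le> (c - h 0) * Nmax"
  using pay_le[of c n w] mult_left_mono[OF NB_bounds(2)[of w], of "c - h 0"] by linarith

text \<open>A higher level costs more now and, \<open>nxt\<close> being monotone, leads to higher
  levels later; the forced stop at \<open>B\<close> replaces a nonnegative value by 0.\<close>

lemma pay_antimono: "h 0 \<le> c \<Longrightarrow> antimono (pay c h n)"
proof (induction n)
  case (Suc n)
  have am: "antimono (step_mean (pay c h n))"
    using Suc by (intro step_mean_antimono[where K = "(c - h 0) * Nmax"] pay_bound pay_nonneg) auto
  show ?case
  proof (rule antimonoI)
    fix v w :: real assume "v \<le> w"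
    with am h_mono have "step_mean (pay c h n) w \<le> step_mean (pay c h n) v" "h v \<le> h w"
      by (auto dest: antimonoD monoD)
    with \<open>v \<le> w\<close> show "pay c h (Suc n) w \<le> pay c h (Suc n) v"
      by auto
  qed
qed (simp add: antimono_def)

lemma pay_Suc_ge: "h 0 \<le> c \<Longrightarrow> pay c h n w \<le> pay c h (Suc n) w"
proof (induction n arbitrary: w)
  case (Suc n)
  have "step_mean (pay c h n) w \<le> step_mean (pay c h (Suc n)) w"
    by (intro step_mean_mono[where K = "(c - h 0) * Nmax" and K' = "(c - h 0) * Nmax"]
          pay_bound pay_nonneg Suc pay_measurable h_measurable)
  then show ?case by auto
qed auto

text \<open>A price increase of \<open>c' - c\<close> is collected once per step, so it raises the
  gain by at most \<open>c' - c\<close> times the mean number of steps. The bound does not depend on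
  the horizon and survives the limit, where it gives continuity in the price.\<close>

lemma pay_lipschitz:
  assumes "h 0 \<le> c" "c \<le> c'"
  shows "pay c h n w \<le> pay c' h n w" "pay c' h n w \<le> pay c h n w + (c' - c) * N\<^sub>B w"
proof (induction n arbitrary: w)
  case (Suc n)
  let ?K = "(c - h 0) * Nmax" and ?K' = "(c' - h 0) * Nmax"
  have bd: "pay c h n v \<le> ?K" "pay c' h n v \<le> ?K'" for v
    using assms by (auto intro: pay_bound)
  { case 1
    have "step_mean (pay c h n) w \<le> step_mean (pay c' h n) w"
      by (intro step_mean_mono[where K = ?K and K' = ?K'] bd pay_nonneg Suc) auto
    then show ?case using assms by auto
  next
    case 2
    have bd': "pay c h n v + (c' - c) * N\<^sub>B v \<le> ?K + (c' - c) * Nmax" for v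
      using bd(1)[of v] assms NB_bounds by (intro add_mono mult_left_mono) auto
    have "step_mean (pay c' h n) w \<le> step_mean (\<lambda>v. pay c h n v + (c' - c) * N\<^sub>B v) w"
      using assms NB_bounds
      by (intro step_mean_mono[where K = ?K' and K' = "?K + (c' - c) * Nmax"] bd bd' Suc pay_nonneg)
         (auto intro!: add_nonneg_nonneg mult_nonneg_nonneg pay_nonneg N_nonneg)
    also have "\<dots> = step_mean (pay c h n) w + step_mean (\<lambda>v. (c' - c) * N\<^sub>B v) w"
      unfolding step_mean_def
    proof (rule Bochner_Integration.integral_add)
      show "integrable \<mu> (\<lambda>x. pay c h n (nxt w x))"
        by (intro integrable_step[where K = ?K] bd pay_nonneg) auto
      show "integrable \<mu> (\<lambda>x. (c' - c) * N\<^sub>B (nxt w x))"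
        using NB_bounds by (intro integrable_mult_right integrable_step[where K = Nmax and u = "N\<^sub>B"]) auto
    qed
    finally have "c' - h w + step_mean (pay c' h n) w
        \<le> c - h w + step_mean (pay c h n) w + ((c' - c) + step_mean (\<lambda>v. (c' - c) * N\<^sub>B v) w)"
      by simp
    also have "\<dots> \<le> c - h w + step_mean (pay c h n) w + (c' - c) * N w"
      using assms scaled_step[of "c' - c" w] by simp
    finally show ?case
      using assms N_nonneg[of w] by (auto simp: max_def) }
qed (use assms NB_bounds in auto)

section \<open>Infinite-horizon value and its dependence on the price\<close>

definition pay_lim :: "real \<Rightarrow> real \<Rightarrow> real" where
  "pay_lim c w = lim (\<lambda>n. pay c h n w)"

lemma pay_LIMSEQ: "h 0 \<le> c \<Longrightarrow> (\<lambda>n. pay c h n w) \<longlonglongrightarrow> pay_lim c w"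
proof -
  assume c: "h 0 \<le> c"
  then have "incseq (\<lambda>n. pay c h n w)"
    by (intro incseq_SucI pay_Suc_ge)
  then obtain l where "(\<lambda>n. pay c h n w) \<longlonglongrightarrow> l"
    by (rule incseq_convergent[where B = "(c - h 0) * Nmax"]) (use c pay_bound in auto)
  then show ?thesis
    unfolding pay_lim_def by (simp add: limI)
qed

lemma pay_lim_measurable: "h 0 \<le> c \<Longrightarrow> pay_lim c \<in> borel_measurable borel"
  by (rule borel_measurable_LIMSEQ_real[OF pay_LIMSEQ]) auto

lemma pay_lim_bounds:
  assumes "h 0 \<le> c"
  shows "0 \<le> pay_lim c w" "pay_lim c w \<le> (c - h 0) * Nmax"
  using LIMSEQ_le_const[OF pay_LIMSEQ[OF assms, of w], of 0]
    LIMSEQ_le_const2[OF pay_LIMSEQ[OF assms, of w], of "(c - h 0) * Nmax"]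
    pay_nonneg pay_bound[OF assms] by auto

lemma pay_lim_antimono: "h 0 \<le> c \<Longrightarrow> antimono (pay_lim c)"
  by (intro antimonoI LIMSEQ_le[OF pay_LIMSEQ pay_LIMSEQ]) (auto intro: antimonoD[OF pay_antimono])

lemma pay_lim_lipschitz:
  assumes "h 0 \<le> c" "c \<le> c'"
  shows "pay_lim c w \<le> pay_lim c' w" "pay_lim c' w \<le> pay_lim c w + (c' - c) * Nmax"
proof -
  have c': "h 0 \<le> c'" using assms by simp
  show "pay_lim c w \<le> pay_lim c' w"
    by (rule LIMSEQ_le[OF pay_LIMSEQ[OF assms(1)] pay_LIMSEQ[OF c']]) (use assms pay_lipschitz in auto)
  have "pay c' h n w \<le> pay c h n w + (c' - c) * Nmax" for n
    using pay_lipschitz(2)[OF assms, of n w] mult_left_mono[OF NB_bounds(2)[of w], of "c' - c"] assms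
    by linarith
  then show "pay_lim c' w \<le> pay_lim c w + (c' - c) * Nmax"
    by (intro LIMSEQ_le[OF pay_LIMSEQ[OF c'] tendsto_add[OF pay_LIMSEQ[OF assms(1)] tendsto_const]]) auto
qed

lemma step_mean_pay_LIMSEQ:
  assumes c: "h 0 \<le> c"
  shows "(\<lambda>n. step_mean (pay c h n) w) \<longlonglongrightarrow> step_mean (pay_lim c) w"
  unfolding step_mean_def
proof (rule integral_dominated_convergence[where w = "\<lambda>_. (c - h 0) * Nmax"])
  show "(\<lambda>x. pay_lim c (nxt w x)) \<in> borel_measurable \<mu>"
    using pay_lim_measurable[OF c] by measurable
  show "AE x in \<mu>. (\<lambda>n. pay c h n (nxt w x)) \<longlonglongrightarrow> pay_lim c (nxt w x)"
    using pay_LIMSEQ[OF c] by simp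
  show "AE x in \<mu>. norm (pay c h n (nxt w x)) \<le> (c - h 0) * Nmax" for n
    using pay_bound[OF c] pay_nonneg by simp
qed auto

text \<open>The Bellman equation, as the limit of the recursion; dominated convergence under
  \<open>step_mean\<close> rests on the bound that is uniform in the horizon.\<close>

lemma pay_lim_eq:
  assumes c: "h 0 \<le> c"
  shows "pay_lim c w = (if w < B then max 0 (c - h w + step_mean (pay_lim c) w) else 0)"
proof (rule LIMSEQ_unique)
  show "(\<lambda>n. pay c h (Suc n) w) \<longlonglongrightarrow> pay_lim c w"
    using pay_LIMSEQ[OF c] by (rule LIMSEQ_Suc)
  show "(\<lambda>n. pay c h (Suc n) w) \<longlonglongrightarrow> (if w < B then max 0 (c - h w + step_mean (pay_lim c) w) else 0)"
    using step_mean_pay_LIMSEQ[OF c] by (auto intro!: tendsto_intros)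
qed

text \<open>
  The step price \<open>c\<close> is tuned so that at level \<open>B\<close> going on is worth exactly as much as stopping;
  by monotonicity the rule that stops at the first level \<open>\<ge> B\<close> is then optimal.
\<close>

lemma threshold_stopping_certificate:
  obtains c y ymax where
    "y \<in> borel_measurable borel" "\<And>w. 0 \<le> y w" "\<And>w. y w \<le> (ymax::real)" "\<And>w. B \<le> w \<Longrightarrow> y w = 0"
    "\<And>w. c + step_mean y w \<le> h w + y w" "\<And>w. w < B \<Longrightarrow> c + step_mean y w = h w + y w"
proof -
  \<comment> \<open>\<open>G c\<close> is the gain from one enforced step at level \<open>B\<close>
    followed by optimal play; a zero of \<open>G\<close> is a price at which the threshold is
    indifferent.\<close>
  define G where "G c = c - h B + step_mean (pay_lim c) B" for c
  have step_lip: "step_mean (pay_lim c) w \<le> step_mean (pay_lim c') w"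
    "step_mean (pay_lim c') w \<le> step_mean (pay_lim c) w + (c' - c) * Nmax"
    if "h 0 \<le> c" "c \<le> c'" for c c' w
  proof -
    have c': "h 0 \<le> c'" using that by simp
    note m = pay_lim_measurable[OF that(1)] pay_lim_measurable[OF c']
      and bd = pay_lim_bounds[OF that(1)] pay_lim_bounds[OF c']
    show "step_mean (pay_lim c) w \<le> step_mean (pay_lim c') w"
      by (rule step_mean_mono[OF m(1) bd(1,2) m(2) bd(3,4)]) (rule pay_lim_lipschitz(1)[OF that])
    have "step_mean (pay_lim c') w \<le> (\<integral>x. pay_lim c (nxt w x) + (c' - c) * Nmax \<partial>\<mu>)"
      unfolding step_mean_def
      by (intro integral_mono Bochner_Integration.integrable_add integrable_const
            integrable_step[OF m(1) bd(1,2)] integrable_step[OF m(2) bd(3,4)] pay_lim_lipschitz(2)[OF that])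
    also have "\<dots> = step_mean (pay_lim c) w + (c' - c) * Nmax"
      unfolding step_mean_def
      by (subst Bochner_Integration.integral_add) (auto simp: prob_space intro: integrable_step[OF m(1) bd(1,2)])
    finally show "step_mean (pay_lim c') w \<le> step_mean (pay_lim c) w + (c' - c) * Nmax" .
  qed
  have "(1 + Nmax)-lipschitz_on {h 0..h B} G"
  proof (rule lipschitz_on_leI)
    fix c c' assume "c \<in> {h 0..h B}" "c' \<in> {h 0..h B}" "c \<le> c'"
    with step_lip[of c c' B] show "dist (G c) (G c') \<le> (1 + Nmax) * dist c c'"
      by (auto simp: G_def dist_real_def algebra_simps)
  qed (use NB_bounds in auto)
  then have "continuous_on {h 0..h B} G"
    by (rule lipschitz_on_continuous_on)
  \<comment> \<open>At the price \<open>h 0\<close> no step has a positive payoff, so the value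
    vanishes; at the price \<open>h B\<close> the enforced step is free. These are the end points
    for the intermediate value theorem.\<close>
  moreover have "pay_lim (h 0) w = 0" for w
    using pay_lim_bounds[of "h 0" w] by simp
  then have "G (h 0) \<le> 0"
    using h_min[of B] by (simp add: G_def step_mean_def)
  moreover have "0 \<le> G (h B)"
    using h_min[of B] step_mean_bounds(1)[OF pay_lim_measurable pay_lim_bounds, of "h B" B]
    by (simp add: G_def)
  ultimately obtain c where c: "h 0 \<le> c" and Gc: "G c = 0"
    using IVT'[of G "h 0" 0 "h B"] h_min[of B] by auto
  let ?y = "pay_lim c"
  have am: "antimono (step_mean ?y)"
    by (intro step_mean_antimono[where K = "(c - h 0) * Nmax"]
          pay_lim_measurable pay_lim_bounds pay_lim_antimono c)
  \<comment> \<open>Going on is worth 0 at \<open>B\<close> and at least as much below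
    \<open>B\<close>, so the maximum in the Bellman equation is attained by going on.\<close>
  have below: "c + step_mean ?y w = h w + ?y w" if "w < B" for w
  proof -
    have "h w \<le> h B" "step_mean ?y B \<le> step_mean ?y w"
      using that am h_mono by (auto intro: antimonoD monoD)
    with Gc have "0 \<le> c - h w + step_mean ?y w"
      by (simp add: G_def)
    then show ?thesis
      using that pay_lim_eq[OF c, of w] by simp
  qed
  have above: "c + step_mean ?y w \<le> h w" if "B \<le> w" for w
  proof -
    have "h B \<le> h w" "step_mean ?y w \<le> step_mean ?y B"
      using that am h_mono by (auto intro: antimonoD monoD)
    with Gc show ?thesis by (simp add: G_def)
  qed
  show thesis
  proof (rule that[of ?y "(c - h 0) * Nmax" c])
    show zero: "?y w = 0" if "B \<le> w" for w
      using that pay_lim_eq[OF c, of w] by simp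
    show "c + step_mean ?y w \<le> h w + ?y w" for w
      using below[of w] above[of w] zero[of w] by (cases "w < B") auto
  qed (use below pay_lim_measurable[OF c] pay_lim_bounds[OF c] in auto)
qed

end

end

text \<open>Tonelli for counting measures exchanges the two sums. The extended values matter,
  because the mean delay to which this is applied is shown to be finite only afterwards, as a
  consequence.\<close>

lemma ennreal_Cauchy_product:
  fixes a s :: "nat \<Rightarrow> ennreal"
  shows "(\<Sum>k. \<Sum>i\<le>k. a i * s (k - i)) = (\<Sum>i. a i) * (\<Sum>j. s j)"
proof -
  define f where "f i k = (if i \<le> k then a i * s (k - i) else 0)" for i k
  have shift: "(\<lambda>k. f i k) sums (a i * (\<Sum>j. s j))" for i
  proof -
    have "(\<lambda>k. if n \<le> k then s (k - n) else 0) sums (\<Sum>j. s j)" for n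
    proof (induction n)
      case (Suc n)
      then have "(\<lambda>k. if Suc n \<le> Suc k then s (Suc k - Suc n) else 0) sums (\<Sum>j. s j)"
        by (simp only: Suc_le_mono diff_Suc_Suc)
      from sums_Suc[OF this] show ?case by simp
    qed (simp add: summable_sums)
    then have eq: "(\<Sum>k. if i \<le> k then s (k - i) else 0) = (\<Sum>j. s j)"
      by (rule sums_unique[symmetric])
    have "(\<Sum>k. f i k) = a i * (\<Sum>k. if i \<le> k then s (k - i) else 0)"
      unfolding ennreal_suminf_cmult[symmetric] by (intro arg_cong[of _ _ suminf]) (auto simp: f_def)
    with eq show ?thesis
      using summable_sums[OF summableI, of "f i"] by simp
  qed
  have "(\<Sum>k. \<Sum>i\<le>k. a i * s (k - i)) = (\<Sum>k. \<Sum>i. f i k)"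
  proof (intro suminf_cong)
    fix k
    have "(\<Sum>i. f i k) = (\<Sum>i\<le>k. f i k)"
      by (intro suminf_finite) (auto simp: f_def)
    then show "(\<Sum>i\<le>k. a i * s (k - i)) = (\<Sum>i. f i k)"
      by (simp add: f_def)
  qed
  also have "\<dots> = (\<Sum>k. \<integral>\<^sup>+i. f i k \<partial>count_space UNIV)"
    by (simp add: nn_integral_count_space_nat)
  also have "\<dots> = (\<integral>\<^sup>+i. (\<Sum>k. f i k) \<partial>count_space UNIV)"
    by (intro nn_integral_suminf[symmetric]) auto
  also have "\<dots> = (\<Sum>i. a i * (\<Sum>j. s j))"
    by (simp add: nn_integral_count_space_nat sums_unique[OF shift, symmetric])
  finally show ?thesis
    by (simp add: mult.commute)
qed

section \<open>Survival of the CUSUM chain below the threshold\<close>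

context cusum_kernel
begin

text \<open>The transition operator of the chain killed at levels \<open>\<ge> B\<close>, with the
  step law reweighted by \<open>\<rho>\<close>. The choice \<open>\<rho> = 1\<close> gives the chain
  without change, and \<open>\<rho> = r\<close> the chain after a change to the density
  \<open>r\<close>.\<close>

definition kill :: "('x \<Rightarrow> ennreal) \<Rightarrow> (real \<Rightarrow> ennreal) \<Rightarrow> real \<Rightarrow> ennreal" where
  "kill \<rho> u w = (\<integral>\<^sup>+x. \<rho> x * (indicator {..<B} (nxt w x) * u (nxt w x)) \<partial>\<mu>)"

definition surv :: "('x \<Rightarrow> ennreal) \<Rightarrow> nat \<Rightarrow> real \<Rightarrow> ennreal" where
  "surv \<rho> j = (kill \<rho> ^^ j) (\<lambda>_. 1)"

lemma surv_0: "surv \<rho> 0 = (\<lambda>_. 1)" and surv_Suc: "surv \<rho> (Suc j) = kill \<rho> (surv \<rho> j)"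
  by (simp_all add: surv_def)

lemma kill_measurable [measurable]:
  assumes [measurable]: "\<rho> \<in> borel_measurable \<mu>" "u \<in> borel_measurable borel"
  shows "kill \<rho> u \<in> borel_measurable borel"
proof -
  have "(\<lambda>p. \<rho> (snd p) * (indicator {..<B} (nxt (fst p) (snd p)) * u (nxt (fst p) (snd p))))
      \<in> borel_measurable (borel \<Otimes>\<^sub>M \<mu>)"
    by measurable
  then show ?thesis
    unfolding kill_def by (intro borel_measurable_nn_integral) (simp add: split_def)
qed

lemma surv_measurable [measurable]:
  "\<rho> \<in> borel_measurable \<mu> \<Longrightarrow> surv \<rho> j \<in> borel_measurable borel"
  by (induction j) (simp_all add: surv_0 surv_Suc)

lemma kill_antimono: "antimono u \<Longrightarrow> antimono (kill \<rho> u)"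
  unfolding kill_def
proof (intro antimonoI nn_integral_mono mult_left_mono mult_mono)
  fix v w :: real and x assume u: "antimono u" and "v \<le> w"
  then have le: "nxt v x \<le> nxt w x" by (intro nxt_mono)
  then show "u (nxt w x) \<le> u (nxt v x)" by (rule antimonoD[OF u])
  show "indicator {..<B} (nxt w x) \<le> (indicator {..<B} (nxt v x) :: ennreal)"
    using le by (auto simp: indicator_def)
qed simp_all

lemma surv_antimono: "antimono (surv \<rho> j)"
proof (induction j)
  case (Suc j)
  then show ?case unfolding surv_Suc by (rule kill_antimono)
qed (simp add: surv_0 antimono_def)

lemma surv_restart: "w \<le> 1 \<Longrightarrow> surv \<rho> j w = surv \<rho> j 0"
  by (cases j) (simp_all add: surv_0 surv_Suc kill_def nxt_restart[of w])

text \<open>Monotonicity settles \<open>w > 1\<close>, and levels up to 1 are forgotten by the next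
  step; so 0 is a worst start on the whole real line.\<close>

lemma surv_le: "surv \<rho> j w \<le> surv \<rho> j 0"
  using surv_restart[of w \<rho> j] antimonoD[OF surv_antimono, of 0 w \<rho> j] by (cases "w \<le> 1") simp_all

text \<open>The constant \<open>D\<close> of the overview: the tail sum of the passage time over
  \<open>B\<close> from a fresh start. When \<open>r\<close> is a likelihood ratio, a step into the
  singular part of the anomalous law counts as passage, since its mass is missing from
  \<open>kill\<close>.\<close>

definition mean_delay :: ennreal where
  "mean_delay = (\<Sum>j. surv (\<lambda>x. ennreal (r x)) j 0)"

end

subsection \<open>The CUSUM process without change\<close>

locale cusum_process = cusum_kernel \<mu> r B + P: prob_space P
  for \<mu> :: "'x measure" and r B and P :: "'w measure" +
  fixes F :: "nat \<Rightarrow> 'w measure" and X :: "nat \<Rightarrow> 'w \<Rightarrow> 'x"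
  assumes subalg: "\<And>k. subalgebra P (F k)"
    and F_mono: "\<And>j k. j \<le> k \<Longrightarrow> sets (F j) \<subseteq> sets (F k)"
    and X_adapted [measurable]: "\<And>k. X (Suc k) \<in> F (Suc k) \<rightarrow>\<^sub>M \<mu>"
    and X_law: "\<And>k. distr P \<mu> (X (Suc k)) = \<mu>"
    and X_indep: "\<And>k. P.indep_set (sets (F k)) {X (Suc k) -` A \<inter> space P | A. A \<in> sets \<mu>}"
begin

lemma space_F: "space (F k) = space P"
  using subalg[of k] by (simp add: subalgebra_def)

lemma measurable_F_mono: "f \<in> F j \<rightarrow>\<^sub>M N \<Longrightarrow> j \<le> k \<Longrightarrow> f \<in> F k \<rightarrow>\<^sub>M N"
  using F_mono[of j k] by (auto simp: measurable_def space_F)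

lemma measurable_F_P: "f \<in> F k \<rightarrow>\<^sub>M N \<Longrightarrow> f \<in> P \<rightarrow>\<^sub>M N"
  by (rule measurable_from_subalg[OF subalg])

lemma sets_F_P: "A \<in> sets (F k) \<Longrightarrow> A \<in> sets P"
  using subalg[of k] by (auto simp: subalgebra_def)

lemma X_measurable: "0 < k \<Longrightarrow> k \<le> n \<Longrightarrow> X k \<in> F n \<rightarrow>\<^sub>M \<mu>"
  using measurable_F_mono[OF X_adapted[of "k - 1"], of n] by simp

text \<open>Fubini for the past \<open>(\<phi>, Z)\<close> and the next observation, whose joint law
  is a product by independence. With \<open>Z\<close> the current level this is the Markov property
  with an arbitrary weight on the past.\<close>

lemma one_step:
  assumes phi [measurable]: "\<phi> \<in> borel_measurable (F k)" and Z [measurable]: "Z \<in> borel_measurable (F k)"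
    and psi [measurable]: "\<psi> \<in> borel_measurable (borel \<Otimes>\<^sub>M \<mu>)"
  shows "(\<integral>\<^sup>+\<omega>. \<phi> \<omega> * \<psi> (Z \<omega> :: real, X (Suc k) \<omega>) \<partial>P) =
         (\<integral>\<^sup>+\<omega>. (\<phi> \<omega> :: ennreal) * (\<integral>\<^sup>+x. \<psi> (Z \<omega>, x) \<partial>\<mu>) \<partial>P)"
proof -
  let ?N = "borel \<Otimes>\<^sub>M borel :: (ennreal \<times> real) measure"
  let ?Y = "\<lambda>\<omega>. (\<phi> \<omega>, Z \<omega>)" and ?X = "X (Suc k)"
  have YF: "?Y \<in> F k \<rightarrow>\<^sub>M ?N" by measurable
  note [measurable] = measurable_F_P[OF phi] measurable_F_P[OF Z]
  have XP [measurable]: "?X \<in> P \<rightarrow>\<^sub>M \<mu>" by (rule measurable_F_P[OF X_adapted])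
  have joint: "distr P ?N ?Y \<Otimes>\<^sub>M \<mu> = distr P (?N \<Otimes>\<^sub>M \<mu>) (\<lambda>\<omega>. (?Y \<omega>, ?X \<omega>))"
  proof (rule pair_measure_eqI)
    show "sigma_finite_measure (distr P ?N ?Y)"
      by (intro prob_space_imp_sigma_finite P.prob_space_distr measurable_F_P[OF YF])
    fix A C assume "A \<in> sets (distr P ?N ?Y)" and C [measurable]: "C \<in> sets \<mu>"
    then have A [measurable]: "A \<in> sets ?N" by simp
    let ?a = "?Y -` A \<inter> space P" and ?c = "?X -` C \<inter> space P"
    have "?a \<in> sets (F k)"
      using measurable_sets[OF YF A] unfolding space_F .
    moreover have "?c \<in> {?X -` C \<inter> space P | C. C \<in> sets \<mu>}"
      using C by blast
    ultimately have "P.prob (?a \<inter> ?c) = P.prob ?a * P.prob ?c"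
      by (rule P.indep_setD[OF X_indep])
    moreover have "(\<lambda>\<omega>. (?Y \<omega>, ?X \<omega>)) -` (A \<times> C) \<inter> space P = ?a \<inter> ?c"
      by auto
    ultimately have "emeasure P ?a * emeasure P ?c = emeasure (distr P (?N \<Otimes>\<^sub>M \<mu>) (\<lambda>\<omega>. (?Y \<omega>, ?X \<omega>))) (A \<times> C)"
      by (subst emeasure_distr) (auto simp: P.emeasure_eq_measure ennreal_mult)
    moreover have "emeasure P ?c = emeasure \<mu> C"
      by (subst X_law[of k, symmetric], subst emeasure_distr) auto
    ultimately show "emeasure (distr P ?N ?Y) A * emeasure \<mu> C
        = emeasure (distr P (?N \<Otimes>\<^sub>M \<mu>) (\<lambda>\<omega>. (?Y \<omega>, ?X \<omega>))) (A \<times> C)"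
      by (subst emeasure_distr) auto
  qed (auto intro: prob_space_imp_sigma_finite prob_space_axioms)
  define G where "G p = fst (fst p) * \<psi> (snd (fst p), snd p)" for p :: "(ennreal \<times> real) \<times> 'x"
  have [measurable]: "G \<in> borel_measurable (?N \<Otimes>\<^sub>M \<mu>)"
    unfolding G_def by measurable
  have "(\<integral>\<^sup>+\<omega>. \<phi> \<omega> * \<psi> (Z \<omega>, ?X \<omega>) \<partial>P) = (\<integral>\<^sup>+p. G p \<partial>(distr P ?N ?Y \<Otimes>\<^sub>M \<mu>))"
    unfolding joint by (subst nn_integral_distr) (auto simp: G_def)
  also have "\<dots> = (\<integral>\<^sup>+q. \<integral>\<^sup>+x. G (q, x) \<partial>\<mu> \<partial>distr P ?N ?Y)"
    by (rule nn_integral_fst[symmetric]) measurable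
  also have "\<dots> = (\<integral>\<^sup>+\<omega>. \<integral>\<^sup>+x. G (?Y \<omega>, x) \<partial>\<mu> \<partial>P)"
    by (rule nn_integral_distr) measurable
  also have "\<dots> = (\<integral>\<^sup>+\<omega>. \<phi> \<omega> * (\<integral>\<^sup>+x. \<psi> (Z \<omega>, x) \<partial>\<mu>) \<partial>P)"
    by (intro nn_integral_cong) (simp add: G_def nn_integral_cmult)
  finally show ?thesis .
qed

primrec W :: "nat \<Rightarrow> 'w \<Rightarrow> real" where
  "W 0 = (\<lambda>\<omega>. 0)"
| "W (Suc k) = (\<lambda>\<omega>. nxt (W k \<omega>) (X (Suc k) \<omega>))"

lemma W_nonneg: "0 \<le> W k \<omega>"
  by (cases k) (simp_all add: nxt_nonneg)

lemma W_measurable [measurable]: "W k \<in> borel_measurable (F k)"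
proof (induction k)
  case (Suc k)
  have [measurable]: "W k \<in> borel_measurable (F (Suc k))"
    using Suc by (rule measurable_F_mono) simp
  show ?case by (simp add: nxt_def)
qed simp

definition alive :: "nat \<Rightarrow> 'w set" where
  "alive k = {\<omega> \<in> space P. \<forall>j\<in>{1..k}. W j \<omega> < B}"

lemma alive_sets: "alive k \<in> sets (F k)"
proof -
  have [measurable]: "W j \<in> borel_measurable (F k)" if "j \<in> {1..k}" for j
    using that by (intro measurable_F_mono[OF W_measurable]) simp
  have "{\<omega> \<in> space (F k). \<forall>j\<in>{1..k}. W j \<omega> < B} \<in> sets (F k)"
    by measurable
  then show ?thesis unfolding alive_def space_F .
qed

lemma alive_0: "alive 0 = space P"
  by (simp add: alive_def)

lemma indicator_alive_Suc:
  "\<omega> \<in> space P \<Longrightarrow>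
    indicator (alive (Suc k)) \<omega> = (indicator (alive k) \<omega> * indicator {..<B} (W (Suc k) \<omega>) :: 'a :: semiring_1)"
  by (auto simp: alive_def indicator_def atLeastAtMostSuc_conv)

lemma alive_W_less: "\<omega> \<in> alive k \<Longrightarrow> W k \<omega> < B"
  using B_gt_1 by (cases "k = 0") (auto simp: alive_def)

text \<open>Iterated Markov property: the last observation is integrated out and leaves one killed
  operator behind. The weights may vary with time as long as their operators agree with that of
  \<open>\<rho>0\<close>; this is the situation along a moving anomaly path.\<close>

lemma alive_weighted:
  fixes \<rho>0 :: "'x \<Rightarrow> ennreal"
  assumes phi [measurable]: "\<phi> \<in> borel_measurable (F \<nu>)"
    and rho: "\<And>i. \<nu> < i \<Longrightarrow> \<rho> i \<in> borel_measurable \<mu>"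
    and eq: "\<And>i v. \<nu> < i \<Longrightarrow> v \<in> borel_measurable borel \<Longrightarrow> kill (\<rho> i) v = kill \<rho>0 v"
    and u [measurable]: "u \<in> borel_measurable borel"
  shows "(\<integral>\<^sup>+\<omega>. \<phi> \<omega> * indicator (alive (\<nu> + j)) \<omega> * (\<Prod>i\<in>{\<nu>+1..\<nu>+j}. \<rho> i (X i \<omega>)) * u (W (\<nu> + j) \<omega>) \<partial>P)
       = (\<integral>\<^sup>+\<omega>. \<phi> \<omega> * indicator (alive \<nu>) \<omega> * (kill \<rho>0 ^^ j) u (W \<nu> \<omega>) \<partial>P)"
  using u
proof (induction j arbitrary: u)
  case (Suc j)
  note [measurable] = Suc.prems
  let ?k = "\<nu> + j"
  have [measurable]: "alive ?k \<in> sets (F ?k)" by (rule alive_sets)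
  have [measurable]: "\<phi> \<in> borel_measurable (F ?k)"
    using phi by (rule measurable_F_mono) simp
  have [measurable]: "X i \<in> F ?k \<rightarrow>\<^sub>M \<mu>" "\<rho> i \<in> borel_measurable \<mu>" if "i \<in> {\<nu>+1..?k}" for i
    using that by (auto intro!: X_measurable rho)
  have [measurable]: "\<rho> (Suc ?k) \<in> borel_measurable \<mu>"
    by (rule rho) simp
  define \<phi>' where "\<phi>' \<omega> = \<phi> \<omega> * indicator (alive ?k) \<omega> * (\<Prod>i\<in>{\<nu>+1..?k}. \<rho> i (X i \<omega>))" for \<omega>
  define \<psi> where "\<psi> p = \<rho> (Suc ?k) (snd p) * (indicator {..<B} (nxt (fst p) (snd p)) * u (nxt (fst p) (snd p)))" for p
  have [measurable]: "\<phi>' \<in> borel_measurable (F ?k)"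
    unfolding \<phi>'_def by measurable
  have [measurable]: "\<psi> \<in> borel_measurable (borel \<Otimes>\<^sub>M \<mu>)"
    unfolding \<psi>_def by measurable
  have "(\<integral>\<^sup>+\<omega>. \<phi> \<omega> * indicator (alive (\<nu> + Suc j)) \<omega> * (\<Prod>i\<in>{\<nu>+1..\<nu>+Suc j}. \<rho> i (X i \<omega>)) * u (W (\<nu> + Suc j) \<omega>) \<partial>P)
      = (\<integral>\<^sup>+\<omega>. \<phi>' \<omega> * \<psi> (W ?k \<omega>, X (Suc ?k) \<omega>) \<partial>P)"
    by (intro nn_integral_cong)
       (simp add: indicator_alive_Suc \<phi>'_def \<psi>_def prod.nat_ivl_Suc' ac_simps)
  also have "\<dots> = (\<integral>\<^sup>+\<omega>. \<phi>' \<omega> * (\<integral>\<^sup>+x. \<psi> (W ?k \<omega>, x) \<partial>\<mu>) \<partial>P)"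
    by (rule one_step) measurable
  also have "\<dots> = (\<integral>\<^sup>+\<omega>. \<phi>' \<omega> * kill \<rho>0 u (W ?k \<omega>) \<partial>P)"
    by (simp add: eq[of "Suc ?k" u, symmetric, OF _ Suc.prems] kill_def \<psi>_def)
  also have "\<dots> = (\<integral>\<^sup>+\<omega>. \<phi> \<omega> * indicator (alive \<nu>) \<omega> * (kill \<rho>0 ^^ j) (kill \<rho>0 u) (W \<nu> \<omega>) \<partial>P)"
    unfolding \<phi>'_def
  proof (rule Suc.IH)
    show "kill \<rho>0 u \<in> borel_measurable borel"
      using kill_measurable[OF rho[of "Suc \<nu>"], of u] eq[of "Suc \<nu>" u] by simp
  qed
  finally show ?case
    by (simp only: funpow_Suc_right o_apply)
qed simp

text \<open>
  The weights \<open>(1 - W \<nu>)\<^sup>+\<close> turn the likelihood ratios of all changepoints \<open>\<nu> \<le> k\<close> into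
  \<open>max 1 (W k)\<close>; they play the role of a least favourable prior on the changepoint.
\<close>

lemma max_W_eq_sum:
  "max 1 (W k \<omega>) = (\<Sum>\<nu>\<le>k. max 0 (1 - W \<nu> \<omega>) * (\<Prod>i\<in>{\<nu>+1..k}. r (X i \<omega>)))"
proof (induction k)
  case (Suc k)
  have "(\<Sum>\<nu>\<le>Suc k. max 0 (1 - W \<nu> \<omega>) * (\<Prod>i\<in>{\<nu>+1..Suc k}. r (X i \<omega>)))
      = (\<Sum>\<nu>\<le>k. max 0 (1 - W \<nu> \<omega>) * (\<Prod>i\<in>{\<nu>+1..Suc k}. r (X i \<omega>))) + max 0 (1 - W (Suc k) \<omega>)"
    by simp
  also have "(\<Sum>\<nu>\<le>k. max 0 (1 - W \<nu> \<omega>) * (\<Prod>i\<in>{\<nu>+1..Suc k}. r (X i \<omega>)))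
      = max 1 (W k \<omega>) * r (X (Suc k) \<omega>)"
    unfolding Suc sum_distrib_right by (intro sum.cong) (auto simp: prod.nat_ivl_Suc' ac_simps)
  finally show ?case by (simp add: nxt_def)
qed simp

section \<open>Expected delay of the CUSUM rule\<close>

lemma ennreal_max_W_eq_sum:
  "ennreal (max 1 (W k \<omega>)) = (\<Sum>\<nu>\<le>k. ennreal (max 0 (1 - W \<nu> \<omega>)) * (\<Prod>i\<in>{\<nu>+1..k}. ennreal (r (X i \<omega>))))"
  unfolding max_W_eq_sum
  by (subst sum_ennreal[symmetric])
     (auto simp: ennreal_mult prod_ennreal r_nonneg prod_nonneg intro!: mult_nonneg_nonneg sum.cong)

lemma alive_likelihood:
  assumes "\<phi> \<in> borel_measurable (F \<nu>)" and "\<nu> \<le> k"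
  shows "(\<integral>\<^sup>+\<omega>. \<phi> \<omega> * indicator (alive k) \<omega> * (\<Prod>i\<in>{\<nu>+1..k}. ennreal (r (X i \<omega>))) \<partial>P)
       = (\<integral>\<^sup>+\<omega>. \<phi> \<omega> * indicator (alive \<nu>) \<omega> * surv (\<lambda>x. ennreal (r x)) (k - \<nu>) (W \<nu> \<omega>) \<partial>P)"
  using alive_weighted[of \<phi> \<nu> "\<lambda>_ x. ennreal (r x)" "\<lambda>x. ennreal (r x)" "\<lambda>_. 1" "k - \<nu>"] assms
  by (simp add: surv_def)

lemma emeasure_alive: "emeasure P (alive k) = surv (\<lambda>_. 1) k 0"
proof -
  have [measurable]: "alive k \<in> sets P"
    by (rule sets_F_P[OF alive_sets])
  have "(\<integral>\<^sup>+\<omega>. 1 * indicator (alive (0 + k)) \<omega> * (\<Prod>i\<in>{0+1..0+k}. 1) * 1 \<partial>P)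
      = (\<integral>\<^sup>+\<omega>. 1 * indicator (alive 0) \<omega> * (kill (\<lambda>_. 1) ^^ k) (\<lambda>_. 1) (W 0 \<omega>) \<partial>P)"
    by (rule alive_weighted) auto
  then show ?thesis
    by (simp add: alive_0 surv_def[symmetric] nn_integral_multc P.emeasure_space_1)
qed

text \<open>Expanding \<open>max 1 (W k)\<close> over the changepoints makes the left side a
  convolution of the weights at \<open>\<nu>\<close> with the survival after \<open>\<nu>\<close>.
  The factors separate because a changepoint has positive weight only where
  \<open>W \<nu> < 1\<close>, and survival from there is that of a start at 0.\<close>

lemma delay_identity:
  "(\<Sum>k. \<integral>\<^sup>+\<omega>. indicator (alive k) \<omega> * ennreal (max 1 (W k \<omega>)) \<partial>P)
   = (\<Sum>\<nu>. \<integral>\<^sup>+\<omega>. indicator (alive \<nu>) \<omega> * ennreal (max 0 (1 - W \<nu> \<omega>)) \<partial>P) * mean_delay"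
proof -
  let ?a = "\<lambda>\<nu>. \<integral>\<^sup>+\<omega>. indicator (alive \<nu>) \<omega> * ennreal (max 0 (1 - W \<nu> \<omega>)) \<partial>P"
  let ?s = "\<lambda>j. surv (\<lambda>x. ennreal (r x)) j 0"
  have "(\<integral>\<^sup>+\<omega>. indicator (alive k) \<omega> * ennreal (max 1 (W k \<omega>)) \<partial>P) = (\<Sum>\<nu>\<le>k. ?a \<nu> * ?s (k - \<nu>))" for k
  proof -
    have [measurable]: "alive \<nu> \<in> sets P" for \<nu>
      by (rule sets_F_P[OF alive_sets])
    have [measurable]: "X i \<in> P \<rightarrow>\<^sub>M \<mu>" if "i \<in> {\<nu>+1..k}" for i \<nu>
      using that by (intro measurable_F_P[OF X_measurable[of i i]]) auto
    have [measurable]: "W \<nu> \<in> borel_measurable P" for \<nu>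
      by (rule measurable_F_P[OF W_measurable])
    have "(\<integral>\<^sup>+\<omega>. indicator (alive k) \<omega> * ennreal (max 1 (W k \<omega>)) \<partial>P)
        = (\<integral>\<^sup>+\<omega>. (\<Sum>\<nu>\<le>k. ennreal (max 0 (1 - W \<nu> \<omega>)) * indicator (alive k) \<omega> * (\<Prod>i\<in>{\<nu>+1..k}. ennreal (r (X i \<omega>)))) \<partial>P)"
      unfolding ennreal_max_W_eq_sum sum_distrib_left by (intro nn_integral_cong sum.cong) (auto simp: ac_simps)
    also have "\<dots> = (\<Sum>\<nu>\<le>k. \<integral>\<^sup>+\<omega>. ennreal (max 0 (1 - W \<nu> \<omega>)) * indicator (alive k) \<omega> * (\<Prod>i\<in>{\<nu>+1..k}. ennreal (r (X i \<omega>))) \<partial>P)"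
      by (rule nn_integral_sum) measurable
    also have "\<dots> = (\<Sum>\<nu>\<le>k. \<integral>\<^sup>+\<omega>. ennreal (max 0 (1 - W \<nu> \<omega>)) * indicator (alive \<nu>) \<omega> * surv (\<lambda>x. ennreal (r x)) (k - \<nu>) (W \<nu> \<omega>) \<partial>P)"
      by (intro sum.cong refl alive_likelihood) auto
    also have "\<dots> = (\<Sum>\<nu>\<le>k. \<integral>\<^sup>+\<omega>. indicator (alive \<nu>) \<omega> * ennreal (max 0 (1 - W \<nu> \<omega>)) * ?s (k - \<nu>) \<partial>P)"
    proof (intro sum.cong nn_integral_cong refl)
      fix \<nu> \<omega>
      show "ennreal (max 0 (1 - W \<nu> \<omega>)) * indicator (alive \<nu>) \<omega> * surv (\<lambda>x. ennreal (r x)) (k - \<nu>) (W \<nu> \<omega>)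
          = indicator (alive \<nu>) \<omega> * ennreal (max 0 (1 - W \<nu> \<omega>)) * ?s (k - \<nu>)"
        using surv_restart[of "W \<nu> \<omega>" "\<lambda>x. ennreal (r x)" "k - \<nu>"]
        by (cases "W \<nu> \<omega> \<le> 1") (simp_all add: mult.commute)
    qed
    also have "\<dots> = (\<Sum>\<nu>\<le>k. ?a \<nu> * ?s (k - \<nu>))"
      by (intro sum.cong refl nn_integral_multc) measurable
    finally show ?thesis .
  qed
  then show ?thesis
    unfolding mean_delay_def ennreal_Cauchy_product[symmetric] by simp
qed

text \<open>On \<open>alive k\<close> the statistic is below \<open>B\<close>, so the left side of
  \<open>delay_identity\<close> is at most \<open>B\<close> times the mean duration, while the
  changepoint 0 alone gives the factor of \<open>mean_delay\<close> the value 1.\<close>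

lemma mean_delay_finite:
  assumes "(\<Sum>k. emeasure P (alive k)) < \<infinity>"
  shows "mean_delay < \<infinity>"
proof -
  let ?a = "\<lambda>\<nu>. \<integral>\<^sup>+\<omega>. indicator (alive \<nu>) \<omega> * ennreal (max 0 (1 - W \<nu> \<omega>)) \<partial>P"
  have [measurable]: "alive k \<in> sets P" for k
    by (rule sets_F_P[OF alive_sets])
  have "?a 0 = 1"
    by (simp add: alive_0 P.emeasure_space_1)
  then have "1 \<le> (\<Sum>\<nu>. ?a \<nu>)"
    using sum_le_suminf[of ?a "{0}"] by simp
  then have "1 * mean_delay \<le> (\<Sum>\<nu>. ?a \<nu>) * mean_delay"
    by (intro mult_right_mono) auto
  also have "\<dots> = (\<Sum>k. \<integral>\<^sup>+\<omega>. indicator (alive k) \<omega> * ennreal (max 1 (W k \<omega>)) \<partial>P)"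
    by (rule delay_identity[symmetric])
  also have "\<dots> \<le> (\<Sum>k. \<integral>\<^sup>+\<omega>. ennreal B * indicator (alive k) \<omega> \<partial>P)"
  proof (intro suminf_le nn_integral_mono summableI)
    fix k \<omega>
    show "indicator (alive k) \<omega> * ennreal (max 1 (W k \<omega>)) \<le> ennreal B * indicator (alive k) \<omega>"
      using alive_W_less[of \<omega> k] B_gt_1 by (auto simp: indicator_def intro!: ennreal_leI)
  qed
  also have "\<dots> = ennreal B * (\<Sum>k. emeasure P (alive k))"
    by (simp add: nn_integral_cmult)
  also have "\<dots> < \<infinity>"
    using assms by (simp add: ennreal_mult_less_top)
  finally show ?thesis by simp
qed

section \<open>Comparison with an arbitrary stopping rule\<close>

lemma one_step_real:
  assumes E: "E \<in> sets (F k)" and y [measurable]: "y \<in> borel_measurable borel"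
    and y_nonneg: "\<And>w. 0 \<le> y w" and y_le: "\<And>w. y w \<le> (ymax :: real)"
  shows "(\<integral>\<omega>. indicator E \<omega> * y (W (Suc k) \<omega>) \<partial>P) = (\<integral>\<omega>. indicator E \<omega> * step_mean y (W k \<omega>) \<partial>P)"
proof -
  have EF [measurable]: "E \<in> sets (F k)" by fact
  have [measurable]: "E \<in> sets P" by (rule sets_F_P[OF E])
  have [measurable]: "W j \<in> borel_measurable P" for j
    by (rule measurable_F_P[OF W_measurable])
  have step: "(\<integral>\<^sup>+x. ennreal (y (nxt w x)) \<partial>\<mu>) = ennreal (step_mean y w)" for w
    unfolding step_mean_def
    by (intro nn_integral_eq_integral integrable_step[OF y y_nonneg y_le]) (simp add: y_nonneg)
  have "(\<integral>\<^sup>+\<omega>. indicator E \<omega> * ennreal (y (W (Suc k) \<omega>)) \<partial>P)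
      = (\<integral>\<^sup>+\<omega>. indicator E \<omega> * ennreal (step_mean y (W k \<omega>)) \<partial>P)"
    using one_step[of "indicator E" k "W k" "\<lambda>p. ennreal (y (nxt (fst p) (snd p)))"]
    by (simp add: step)
  then have "(\<integral>\<^sup>+\<omega>. ennreal (indicator E \<omega> * y (W (Suc k) \<omega>)) \<partial>P)
      = (\<integral>\<^sup>+\<omega>. ennreal (indicator E \<omega> * step_mean y (W k \<omega>)) \<partial>P)"
    by (simp add: ennreal_mult' ennreal_indicator)
  then show ?thesis
    using y_nonneg step_mean_bounds(1)[OF y y_nonneg y_le]
    by (subst (1 2) integral_eq_nn_integral) (auto simp del: W.simps)
qed

lemma mean_alive_bound:
  "(\<Sum>j. surv (\<lambda>_. 1) j w) \<le> (\<Sum>k. emeasure P (alive k))"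
  unfolding emeasure_alive by (intro suminf_le surv_le summableI)

text \<open>First-step analysis: the term \<open>j = 0\<close> counts the current step and the
  killed operator the later ones. This provides the function \<open>N\<close> for the stopping
  problem.\<close>

lemma mean_alive_step:
  "(\<Sum>j. surv (\<lambda>_. 1) j w) = 1 + kill (\<lambda>_. 1) (\<lambda>v. \<Sum>j. surv (\<lambda>_. 1) j v) w"
proof -
  have "kill (\<lambda>_. 1) (\<lambda>v. \<Sum>j. surv (\<lambda>_. 1) j v) w = (\<Sum>j. surv (\<lambda>_. 1) (Suc j) w)"
    unfolding kill_def surv_Suc
    by (simp add: ennreal_suminf_cmult[symmetric] del: ennreal_suminf_cmult)
       (intro nn_integral_suminf, measurable)
  moreover have "(\<lambda>j. surv (\<lambda>_. 1) (Suc j) w) sums (\<Sum>j. surv (\<lambda>_. 1) (Suc j) w)"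
    by (simp add: summable_sums)
  from sums_Suc[OF this] have "(\<Sum>j. surv (\<lambda>_. 1) j w) = (\<Sum>j. surv (\<lambda>_. 1) (Suc j) w) + 1"
    by (simp add: sums_iff surv_0)
  ultimately show ?thesis by (simp add: add.commute)
qed

text \<open>
  \<open>E k\<close> is the event that the competing rule has not stopped by time \<open>k\<close>. The hypothesis on \<open>d\<close> is
  the bound \<open>d\<close> on the conditional delays, averaged over the changepoint with the weights
  \<open>(1 - W k)\<^sup>+\<close>.
\<close>

theorem mean_delay_le:
  assumes finite: "(\<Sum>k. emeasure P (alive k)) < \<infinity>"
    and E: "\<And>k. E k \<in> sets (F k)" "\<And>k. E (Suc k) \<subseteq> E k" "E 0 = space P"
    and longer: "(\<Sum>k. emeasure P (alive k)) \<le> (\<Sum>k. emeasure P (E k))"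
    and delay: "\<And>n. (\<Sum>k<n. \<integral>\<^sup>+\<omega>. indicator (E k) \<omega> * ennreal (max 1 (W k \<omega>)) \<partial>P)
        \<le> d * (\<Sum>k<n. \<integral>\<^sup>+\<omega>. indicator (E k) \<omega> * ennreal (max 0 (1 - W k \<omega>)) \<partial>P)"
  shows "mean_delay \<le> d"
proof (rule ccontr)
  assume "\<not> mean_delay \<le> d"
  \<comment> \<open>Everything is finite from here on: \<open>mean_delay\<close> because the mean
    duration is, and \<open>d\<close> because it lies below. The argument can go on in the
    reals.\<close>
  define D where "D = enn2real mean_delay"
  define d' where "d' = enn2real d"
  have D: "mean_delay = ennreal D" "0 \<le> D"
    using mean_delay_finite[OF finite] by (auto simp: D_def less_top)
  with \<open>\<not> mean_delay \<le> d\<close> have "d < ennreal D" by simp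
  then have d': "d = ennreal d'" "0 \<le> d'" "d' < D"
    by (cases d; auto simp: d'_def ennreal_less_iff)+
  define \<Gamma> where "\<Gamma> = enn2real (\<Sum>k. emeasure P (alive k))"
  have \<Gamma>: "(\<Sum>k. emeasure P (alive k)) = ennreal \<Gamma>" "0 \<le> \<Gamma>"
    using finite by (auto simp: \<Gamma>_def less_top)
  have alive_F: "alive k \<in> sets (F k)" for k by (rule alive_sets)
  have [measurable]: "alive k \<in> sets P" "E k \<in> sets P" for k
    using sets_F_P[OF alive_sets] sets_F_P[OF E(1)] by auto
  have [measurable]: "W j \<in> borel_measurable P" for j
    by (rule measurable_F_P[OF W_measurable])

  \<comment> \<open>The cost with multiplier \<open>D\<close>. The inner \<open>max 0 w\<close>
    makes \<open>h\<close> constant on negative levels, so that 0 is a minimum on the whole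
    line.\<close>
  define h where "h w = max 1 w - D * max 0 (1 - max 0 w)" for w :: real
  have h_mono: "mono h"
    unfolding h_def using D by (intro monoI diff_mono mult_left_mono) auto
  have h_min: "h 0 \<le> h w" for w
    unfolding h_def using D by (intro diff_mono mult_left_mono) auto
  have h_meas [measurable]: "h \<in> borel_measurable borel"
    unfolding h_def by measurable

  define N where "N w = enn2real (\<Sum>j. surv (\<lambda>_. 1) j w)" for w
  have N: "(\<Sum>j. surv (\<lambda>_. 1) j w) = ennreal (N w)" "0 \<le> N w" "N w \<le> \<Gamma>" for w
  proof -
    have "(\<Sum>j. surv (\<lambda>_. 1) j w) \<le> ennreal \<Gamma>"
      using mean_alive_bound[of w] \<Gamma> by simp
    then show "(\<Sum>j. surv (\<lambda>_. 1) j w) = ennreal (N w)" "0 \<le> N w" "N w \<le> \<Gamma>"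
      using \<Gamma> unfolding N_def by (cases "\<Sum>j. surv (\<lambda>_. 1) j w"; auto simp: top_unique)+
  qed
  have N_meas [measurable]: "N \<in> borel_measurable borel"
    unfolding N_def by measurable
  have N_step: "1 + step_mean (\<lambda>v. indicator {..<B} v * N v) w \<le> N w" for w
  proof -
    have "step_mean (\<lambda>v. indicator {..<B} v * N v) w
        = enn2real (\<integral>\<^sup>+x. ennreal (indicator {..<B} (nxt w x) * N (nxt w x)) \<partial>\<mu>)"
      unfolding step_mean_def by (intro integral_eq_nn_integral) (auto simp: N)
    also have "\<dots> = enn2real (kill (\<lambda>_. 1) (\<lambda>v. \<Sum>j. surv (\<lambda>_. 1) j v) w)"
      unfolding kill_def N(1) by (simp add: ennreal_mult' N ennreal_indicator)
    finally have *: "step_mean (\<lambda>v. indicator {..<B} v * N v) w = enn2real (kill (\<lambda>_. 1) (\<lambda>v. \<Sum>j. surv (\<lambda>_. 1) j v) w)" .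
    show ?thesis
      using mean_alive_step[of w] N(1,2)[of w] unfolding *
      by (cases "kill (\<lambda>_. 1) (\<lambda>v. \<Sum>j. surv (\<lambda>_. 1) j v) w")
         (auto simp flip: ennreal_1 ennreal_plus)
  qed

  obtain c y ymax where y [measurable]: "y \<in> borel_measurable borel"
    and y_nonneg: "\<And>w. 0 \<le> y w" and y_le: "\<And>w. y w \<le> (ymax::real)"
    and y_above: "\<And>w. B \<le> w \<Longrightarrow> y w = 0"
    and sub: "\<And>w. c + step_mean y w \<le> h w + y w"
    and eq: "\<And>w. w < B \<Longrightarrow> c + step_mean y w = h w + y w"
    by (rule threshold_stopping_certificate[OF h_meas h_mono h_min N_meas N(2,3) N_step]) (rule that)

  \<comment> \<open>For a rule that is still running on \<open>A k\<close>: \<open>\<beta>\<close>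
    and \<open>\<alpha>\<close> are the two parts of the cost, \<open>\<eta>\<close> is the mean of
    the value function at time \<open>k\<close>, and \<open>\<kappa>\<close> its one-step
    prediction.\<close>
  define \<beta> where "\<beta> A k = (\<integral>\<omega>. indicator (A k) \<omega> * max 1 (W k \<omega>) \<partial>P)" for A :: "nat \<Rightarrow> 'w set" and k
  define \<alpha> where "\<alpha> A k = (\<integral>\<omega>. indicator (A k) \<omega> * max 0 (1 - W k \<omega>) \<partial>P)" for A :: "nat \<Rightarrow> 'w set" and k
  define \<eta> where "\<eta> A k = (\<integral>\<omega>. indicator (A k) \<omega> * y (W k \<omega>) \<partial>P)" for A :: "nat \<Rightarrow> 'w set" and k
  define \<kappa> where "\<kappa> A k = (\<integral>\<omega>. indicator (A k) \<omega> * step_mean y (W k \<omega>) \<partial>P)" for A :: "nat \<Rightarrow> 'w set" and k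
  note y_step = step_mean_bounds[OF y y_nonneg y_le]
  have ymax: "0 \<le> ymax" using y_nonneg[of 0] y_le[of 0] by linarith
  have int_\<alpha>: "integrable P (\<lambda>\<omega>. indicator A \<omega> * max 0 (1 - W k \<omega>))" if [measurable]: "A \<in> sets P" for A k
    by (rule P.integrable_const_bound[where B = 1])
       (auto simp: indicator_def W_nonneg simp del: W.simps)
  have int_y: "integrable P (\<lambda>\<omega>. indicator A \<omega> * y (W k \<omega>))" if [measurable]: "A \<in> sets P" for A k
    by (rule P.integrable_const_bound[where B = ymax])
       (auto simp: indicator_def y_nonneg y_le ymax simp del: W.simps)
  have int_Ky: "integrable P (\<lambda>\<omega>. indicator A \<omega> * step_mean y (W k \<omega>))" if [measurable]: "A \<in> sets P" for A k
    by (rule P.integrable_const_bound[where B = ymax])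
       (auto simp: indicator_def y_step ymax simp del: W.simps)
  have int_c: "integrable P (\<lambda>\<omega>. indicator A \<omega> * c)" if "A \<in> sets P" for A
    using that by (intro integrable_mult_left) (auto simp: P.emeasure_eq_measure)
  have split: "(\<integral>\<omega>. indicator (A k) \<omega> * c + indicator (A k) \<omega> * step_mean y (W k \<omega>) - indicator (A k) \<omega> * y (W k \<omega>) \<partial>P)
      = c * P.prob (A k) + \<kappa> A k - \<eta> A k" if "A k \<in> sets P" for A :: "nat \<Rightarrow> 'w set" and k
    using that
    unfolding \<kappa>_def \<eta>_def
      Bochner_Integration.integral_diff[OF Bochner_Integration.integrable_add[OF int_c[OF that] int_Ky[OF that]] int_y[OF that]]
      Bochner_Integration.integral_add[OF int_c[OF that] int_Ky[OF that]]
    by simp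
  have h_W: "h (W k \<omega>) = max 1 (W k \<omega>) - D * max 0 (1 - W k \<omega>)" for k \<omega>
    using W_nonneg[of k \<omega>] by (simp add: h_def max_def)

  have cost: "integrable P (\<lambda>\<omega>. indicator (A k) \<omega> * h (W k \<omega>))"
    "(\<integral>\<omega>. indicator (A k) \<omega> * h (W k \<omega>) \<partial>P) = \<beta> A k - D * \<alpha> A k"
    if [measurable]: "A k \<in> sets P" and int: "integrable P (\<lambda>\<omega>. indicator (A k) \<omega> * max 1 (W k \<omega>))"
    for A :: "nat \<Rightarrow> 'w set" and k
  proof -
    have eq: "indicator (A k) \<omega> * h (W k \<omega>)
        = indicator (A k) \<omega> * max 1 (W k \<omega>) - D * (indicator (A k) \<omega> * max 0 (1 - W k \<omega>))" for \<omega>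
      by (simp add: h_W algebra_simps)
    show "integrable P (\<lambda>\<omega>. indicator (A k) \<omega> * h (W k \<omega>))"
      unfolding eq by (intro Bochner_Integration.integrable_diff int integrable_mult_right int_\<alpha>) measurable
    show "(\<integral>\<omega>. indicator (A k) \<omega> * h (W k \<omega>) \<partial>P) = \<beta> A k - D * \<alpha> A k"
      unfolding eq \<beta>_def \<alpha>_def
      by (subst Bochner_Integration.integral_diff) (auto intro!: int integrable_mult_right int_\<alpha>)
  qed

  have alive_int: "integrable P (\<lambda>\<omega>. indicator (alive k) \<omega> * max 1 (W k \<omega>))" for k
  proof (rule P.integrable_const_bound[where B = B])
    show "AE \<omega> in P. norm (indicator (alive k) \<omega> * max 1 (W k \<omega>)) \<le> B"
      using alive_W_less[of _ k] B_gt_1 by (auto simp: indicator_def intro!: AE_I2 less_imp_le simp del: W.simps)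
  qed measurable
  have alive_step: "\<beta> alive k - D * \<alpha> alive k = c * P.prob (alive k) + \<kappa> alive k - \<eta> alive k" for k
  proof -
    have "(\<integral>\<omega>. indicator (alive k) \<omega> * h (W k \<omega>) \<partial>P)
        = (\<integral>\<omega>. indicator (alive k) \<omega> * c + indicator (alive k) \<omega> * step_mean y (W k \<omega>) - indicator (alive k) \<omega> * y (W k \<omega>) \<partial>P)"
    proof (intro Bochner_Integration.integral_cong refl)
      fix \<omega>
      show "indicator (alive k) \<omega> * h (W k \<omega>)
          = indicator (alive k) \<omega> * c + indicator (alive k) \<omega> * step_mean y (W k \<omega>) - indicator (alive k) \<omega> * y (W k \<omega>)"
        using eq[OF alive_W_less[of \<omega> k]] by (cases "\<omega> \<in> alive k") (auto simp: algebra_simps simp del: W.simps)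
    qed
    also have "\<dots> = c * P.prob (alive k) + \<kappa> alive k - \<eta> alive k"
      by (rule split) measurable
    finally show ?thesis
      using cost(2)[of alive k, OF _ alive_int[of k]] by simp
  qed
  \<comment> \<open>On \<open>E k\<close> the statistic may exceed \<open>B\<close>, so no pointwise
    bound is at hand; integrability comes from the delay hypothesis with \<open>d\<close>
    finite.\<close>
  have E_int: "integrable P (\<lambda>\<omega>. indicator (E k) \<omega> * max 1 (W k \<omega>))" for k
  proof (rule integrableI_nonneg)
    have "(\<integral>\<^sup>+\<omega>. indicator (E k) \<omega> * ennreal (max 1 (W k \<omega>)) \<partial>P)
        \<le> (\<Sum>k<Suc k. \<integral>\<^sup>+\<omega>. indicator (E k) \<omega> * ennreal (max 1 (W k \<omega>)) \<partial>P)"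
      by (rule member_le_sum) auto
    also have "\<dots> \<le> d * (\<Sum>k<Suc k. \<integral>\<^sup>+\<omega>. indicator (E k) \<omega> * ennreal (max 0 (1 - W k \<omega>)) \<partial>P)"
      by (rule delay)
    also have "\<dots> \<le> d * (\<Sum>k<Suc k. \<integral>\<^sup>+\<omega>. 1 \<partial>P)"
      by (intro mult_left_mono sum_mono nn_integral_mono)
         (auto simp: indicator_def W_nonneg simp del: W.simps)
    also have "\<dots> < \<infinity>"
      using d' by (simp add: P.emeasure_space_1 ennreal_mult_less_top of_nat_less_top)
    finally show "(\<integral>\<^sup>+\<omega>. ennreal (indicator (E k) \<omega> * max 1 (W k \<omega>)) \<partial>P) < \<infinity>"
      by (simp add: ennreal_mult' ennreal_indicator)
  qed auto
  have E_step: "c * P.prob (E k) + \<kappa> E k - \<eta> E k \<le> \<beta> E k - D * \<alpha> E k" for k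
  proof -
    have "c * P.prob (E k) + \<kappa> E k - \<eta> E k
       = (\<integral>\<omega>. indicator (E k) \<omega> * c + indicator (E k) \<omega> * step_mean y (W k \<omega>) - indicator (E k) \<omega> * y (W k \<omega>) \<partial>P)"
      by (rule split[symmetric]) measurable
    also have "\<dots> \<le> (\<integral>\<omega>. indicator (E k) \<omega> * h (W k \<omega>) \<partial>P)"
    proof (intro integral_mono Bochner_Integration.integrable_diff Bochner_Integration.integrable_add int_c int_y int_Ky cost(1) E_int)
      fix \<omega>
      show "indicator (E k) \<omega> * c + indicator (E k) \<omega> * step_mean y (W k \<omega>) - indicator (E k) \<omega> * y (W k \<omega>)
          \<le> indicator (E k) \<omega> * h (W k \<omega>)"
        using sub[of "W k \<omega>"] by (cases "\<omega> \<in> E k") (auto simp del: W.simps)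
    qed auto
    finally show ?thesis
      using cost(2)[of E k, OF _ E_int[of k]] by simp
  qed

  \<comment> \<open>Stopping at time \<open>k + 1\<close> discards a nonnegative amount of
    \<open>y\<close>.\<close>
  have \<eta>_mono: "\<eta> E (Suc k) \<le> \<kappa> E k" for k
  proof -
    have "\<eta> E (Suc k) \<le> (\<integral>\<omega>. indicator (E k) \<omega> * y (W (Suc k) \<omega>) \<partial>P)"
      unfolding \<eta>_def
    proof (intro integral_mono int_y mult_right_mono y_nonneg)
      show "indicator (E (Suc k)) \<omega> \<le> (indicator (E k) \<omega> :: real)" for \<omega>
        using E(2)[of k] by (auto simp: indicator_def)
    qed auto
    also have "\<dots> = \<kappa> E k"
      unfolding \<kappa>_def by (rule one_step_real[OF E(1) y y_nonneg y_le])
    finally show ?thesis .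
  qed
  \<comment> \<open>The CUSUM rule discards nothing, since it stops only at levels where
    \<open>y\<close> vanishes.\<close>
  have \<eta>_alive: "\<eta> alive (Suc k) = \<kappa> alive k" for k
  proof -
    have "\<eta> alive (Suc k) = (\<integral>\<omega>. indicator (alive k) \<omega> * y (W (Suc k) \<omega>) \<partial>P)"
      unfolding \<eta>_def
    proof (intro Bochner_Integration.integral_cong refl)
      fix \<omega> assume "\<omega> \<in> space P"
      then show "indicator (alive (Suc k)) \<omega> * y (W (Suc k) \<omega>) = indicator (alive k) \<omega> * y (W (Suc k) \<omega>)"
        using y_above[of "W (Suc k) \<omega>"] by (cases "W (Suc k) \<omega> < B") (simp_all add: indicator_alive_Suc del: W.simps)
    qed
    also have "\<dots> = \<kappa> alive k"
      unfolding \<kappa>_def by (rule one_step_real[OF alive_F y y_nonneg y_le])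
    finally show ?thesis .
  qed
  have \<eta>_0: "\<eta> E 0 = y 0" "\<eta> alive 0 = y 0"
    by (simp_all add: \<eta>_def alive_0 E(3) P.prob_space)
  have \<eta>_nonneg: "0 \<le> \<eta> A k" for A k
    unfolding \<eta>_def by (intro integral_nonneg_AE) (simp add: y_nonneg)
  \<comment> \<open>The inequalities telescope, and the boundary term \<open>\<eta> E n\<close> is
    nonnegative and dropped. The horizon stays finite because the competing rule may have infinite
    mean duration.\<close>
  have E_sum: "c * (\<Sum>k<n. P.prob (E k)) - y 0 \<le> (\<Sum>k<n. \<beta> E k - D * \<alpha> E k)" for n
  proof -
    have "c * (\<Sum>k<n. P.prob (E k)) + \<eta> E n - \<eta> E 0 \<le> (\<Sum>k<n. \<beta> E k - D * \<alpha> E k)"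
    proof (induction n)
      case (Suc n)
      then show ?case
        using E_step[of n] \<eta>_mono[of n] by (simp add: algebra_simps)
    qed simp
    then show ?thesis using \<eta>_nonneg[of E n] \<eta>_0 by simp
  qed
  have alive_sum: "(\<Sum>k<n. \<beta> alive k - D * \<alpha> alive k) = c * (\<Sum>k<n. P.prob (alive k)) + \<eta> alive n - y 0" for n
  proof (induction n)
    case (Suc n)
    then show ?case
      using alive_step[of n] \<eta>_alive[of n] by (simp add: algebra_simps)
  qed (simp add: \<eta>_0)

  have prob_sums: "(\<lambda>k. P.prob (alive k)) sums \<Gamma>"
  proof -
    have "(\<lambda>k. ennreal (P.prob (alive k))) sums ennreal \<Gamma>"
      using \<Gamma>(1) summable_sums[OF summableI, of "\<lambda>k. emeasure P (alive k)"]
      by (simp add: P.emeasure_eq_measure)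
    then show ?thesis using \<Gamma>(2) by (simp add: sums_ennreal)
  qed
  have ennreal_\<alpha>: "(\<integral>\<^sup>+\<omega>. indicator (A k) \<omega> * ennreal (max 0 (1 - W k \<omega>)) \<partial>P) = ennreal (\<alpha> A k)"
    if "A k \<in> sets P" for A :: "nat \<Rightarrow> 'w set" and k
    unfolding \<alpha>_def
    by (subst nn_integral_eq_integral[OF int_\<alpha>[OF that], symmetric])
       (auto simp: ennreal_mult' ennreal_indicator simp del: W.simps)
  have ennreal_\<beta>: "(\<integral>\<^sup>+\<omega>. indicator (A k) \<omega> * ennreal (max 1 (W k \<omega>)) \<partial>P) = ennreal (\<beta> A k)"
    if "integrable P (\<lambda>\<omega>. indicator (A k) \<omega> * max 1 (W k \<omega>))" for A :: "nat \<Rightarrow> 'w set" and k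
    unfolding \<beta>_def
    by (subst nn_integral_eq_integral[OF that, symmetric])
       (auto simp: ennreal_mult' ennreal_indicator simp del: W.simps)
  have nonneg: "0 \<le> \<alpha> A k" "0 \<le> \<beta> A k" for A k
    unfolding \<alpha>_def \<beta>_def by (intro integral_nonneg_AE; simp add: le_max_iff_disj)+
  have \<alpha>_le: "\<alpha> alive k \<le> P.prob (alive k)" for k
  proof -
    have "\<alpha> alive k \<le> (\<integral>\<omega>. indicator (alive k) \<omega> \<partial>P)"
      unfolding \<alpha>_def
    proof (intro integral_mono int_\<alpha>)
      show "indicator (alive k) \<omega> * max 0 (1 - W k \<omega>) \<le> indicator (alive k) \<omega>" for \<omega>
        using W_nonneg[of k \<omega>] by (auto simp: indicator_def simp del: W.simps)
    qed (auto simp: P.emeasure_eq_measure)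
    then show ?thesis by simp
  qed
  have \<alpha>_summable: "summable (\<alpha> alive)"
    using \<alpha>_le nonneg by (intro summable_comparison_test'[OF sums_summable[OF prob_sums], of 0]) auto
  \<comment> \<open>By the delay identity the CUSUM rule has total cost 0 with the multiplier
    \<open>D\<close>; since both series are finite, the difference may be taken in the
    reals.\<close>
  have "(\<Sum>k. ennreal (\<beta> alive k)) = (\<Sum>k. ennreal (\<alpha> alive k)) * mean_delay"
    using delay_identity
    unfolding ennreal_\<alpha>[of alive, OF sets_F_P[OF alive_F]] ennreal_\<beta>[of alive, OF alive_int] .
  also have "\<dots> = ennreal (D * suminf (\<alpha> alive))"
    using suminf_ennreal2[OF nonneg(1) \<alpha>_summable] D nonneg \<alpha>_summable
    by (simp add: ennreal_mult' suminf_nonneg mult.commute)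
  finally have "(\<lambda>k. ennreal (\<beta> alive k)) sums ennreal (D * suminf (\<alpha> alive))"
    using summable_sums[OF summableI, of "\<lambda>k. ennreal (\<beta> alive k)"] by simp
  then have "\<beta> alive sums (D * suminf (\<alpha> alive))"
    using D nonneg \<alpha>_summable by (simp add: sums_ennreal suminf_nonneg)
  then have "(\<lambda>k. \<beta> alive k - D * \<alpha> alive k) sums (D * suminf (\<alpha> alive) - D * suminf (\<alpha> alive))"
    by (intro sums_diff sums_mult summable_sums \<alpha>_summable)
  then have lim0: "(\<lambda>n. \<Sum>k<n. \<beta> alive k - D * \<alpha> alive k) \<longlonglongrightarrow> 0"
    by (simp add: sums_def)
  have "(\<lambda>n. c * (\<Sum>k<n. P.prob (alive k)) - y 0) \<longlonglongrightarrow> c * \<Gamma> - y 0"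
    using prob_sums unfolding sums_def by (intro tendsto_intros)
  moreover have "(\<lambda>n. ymax * P.prob (alive n)) \<longlonglongrightarrow> ymax * 0"
    by (intro tendsto_intros summable_LIMSEQ_zero[OF sums_summable[OF prob_sums]])
  \<comment> \<open>The boundary term vanishes in the limit, as \<open>y\<close> is bounded and the
    survival probabilities are summable. What remains is \<open>y 0 \<le> c * \<Gamma>\<close>: the
    initial value is covered by the price times the mean duration.\<close>
  moreover have "\<eta> alive n \<le> ymax * P.prob (alive n)" for n
  proof -
    have "\<eta> alive n \<le> (\<integral>\<omega>. ymax * indicator (alive n) \<omega> \<partial>P)"
      unfolding \<eta>_def
    proof (intro integral_mono int_y)
      show "integrable P (\<lambda>\<omega>. ymax * indicator (alive n) \<omega>)"
        by (auto simp: P.emeasure_eq_measure)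
      show "indicator (alive n) \<omega> * y (W n \<omega>) \<le> ymax * indicator (alive n) \<omega>" for \<omega>
        using y_le by (auto simp: indicator_def)
    qed auto
    then show ?thesis by simp
  qed
  then have "(\<Sum>k<n. \<beta> alive k - D * \<alpha> alive k) \<le> c * (\<Sum>k<n. P.prob (alive k)) - y 0 + ymax * P.prob (alive n)" for n
    using alive_sum[of n] by (simp add: algebra_simps)
  ultimately have "0 \<le> c * \<Gamma> - y 0 + ymax * 0"
    by (intro LIMSEQ_le[OF lim0 tendsto_add]) auto
  then have y0: "y 0 \<le> c * \<Gamma>" by simp
  have "P.prob (alive 0) \<le> \<Gamma>"
    using sum_le_suminf[of "\<lambda>k. P.prob (alive k)" "{0}"] prob_sums by (simp add: sums_iff)
  then have "1 \<le> \<Gamma>" by (simp add: alive_0 P.prob_space)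
  then have c: "0 \<le> c"
    using y0 y_nonneg[of 0] by (smt (verit) mult_neg_pos)

  \<comment> \<open>The delay bound makes the cost at most \<open>d' - D\<close> times the
    accumulated weight, which is at least 1 because \<open>W 0 = 0\<close>; \<open>E_sum\<close>
    bounds the same cost from below. Beating \<open>D\<close> therefore shortens the duration by a
    fixed amount.\<close>
  have E_bound: "(D - d') \<le> c * (\<Gamma> - (\<Sum>k<n. P.prob (E k)))" if "0 < n" for n
  proof -
    have "ennreal (\<Sum>k<n. \<beta> E k) \<le> ennreal (d' * (\<Sum>k<n. \<alpha> E k))"
      using delay[of n] d' nonneg
      unfolding ennreal_\<alpha>[of E, OF sets_F_P[OF E(1)]] ennreal_\<beta>[of E, OF E_int]
      by (simp add: sum_nonneg ennreal_mult')
    then have "(\<Sum>k<n. \<beta> E k) \<le> d' * (\<Sum>k<n. \<alpha> E k)"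
      using d' nonneg by (simp add: ennreal_le_iff mult_nonneg_nonneg sum_nonneg)
    then have "(\<Sum>k<n. \<beta> E k - D * \<alpha> E k) \<le> (d' - D) * (\<Sum>k<n. \<alpha> E k)"
      by (simp add: sum_subtractf sum_distrib_left[symmetric] algebra_simps)
    moreover have "\<alpha> E 0 \<le> (\<Sum>k<n. \<alpha> E k)"
      using that nonneg by (intro member_le_sum) auto
    then have "1 \<le> (\<Sum>k<n. \<alpha> E k)"
      by (simp add: \<alpha>_def E(3) P.prob_space)
    then have "(d' - D) * (\<Sum>k<n. \<alpha> E k) \<le> (d' - D) * 1"
      using d' by (intro mult_left_mono_neg) auto
    moreover have "c * (\<Sum>k<n. P.prob (E k)) - c * \<Gamma> \<le> (\<Sum>k<n. \<beta> E k - D * \<alpha> E k)"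
      using E_sum[of n] y0 by simp
    ultimately show ?thesis by (simp add: algebra_simps)
  qed
  have "c * (\<Sum>k<n. P.prob (E k)) \<le> c * \<Gamma> - (D - d')" for n
  proof (cases "n = 0")
    case True
    have "c * (\<Sum>k<1. P.prob (E k)) \<le> c * \<Gamma> - (D - d')"
      using E_bound[of 1] by (simp add: algebra_simps)
    moreover have "0 \<le> c * (\<Sum>k<1. P.prob (E k))"
      using c by (simp add: measure_nonneg)
    ultimately show ?thesis using True by simp
  qed (use E_bound[of n] in \<open>simp add: algebra_simps\<close>)
  \<comment> \<open>With \<open>c = 0\<close> the bound would read
    \<open>D - d' \<le> 0\<close>.\<close>
  moreover have "0 < c"
    using E_bound[of 1] d' c by (cases "c = 0") auto
  ultimately have le: "(\<Sum>k<n. P.prob (E k)) \<le> \<Gamma> - (D - d') / c" for n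
    by (simp add: field_simps)
  have "(\<Sum>k. emeasure P (E k)) \<le> ennreal (\<Gamma> - (D - d') / c)"
  proof (rule suminf_le_const[OF summableI])
    fix n
    show "(\<Sum>k<n. emeasure P (E k)) \<le> ennreal (\<Gamma> - (D - d') / c)"
      using le[of n] by (simp add: P.emeasure_eq_measure sum_ennreal measure_nonneg ennreal_leI)
  qed
  also have "\<dots> < ennreal \<Gamma>"
    using \<open>0 < c\<close> d' \<open>1 \<le> \<Gamma>\<close> by (intro ennreal_lessI) auto
  finally show False
    using longer \<Gamma>(1) by simp
qed
end

subsection \<open>Observations, change of measure and conditional delays\<close>

lemma space_obs_filtration [simp]: "space (obs_filtration L M X k) = space M"
  by (simp add: obs_filtration_def space_measure_of_conv)

lemma sets_obs_filtration:
  "sets (obs_filtration L M X k) =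
    sigma_sets (space M) {X j -` A \<inter> space M | j A. 1 \<le> j \<and> j \<le> k \<and> A \<in> sets (obs_space L)}"
  unfolding obs_filtration_def by (rule sets_measure_of) auto

lemma obs_filtration_mono:
  "j \<le> k \<Longrightarrow> sets (obs_filtration L M X j) \<subseteq> sets (obs_filtration L M X k)"
  unfolding sets_obs_filtration by (rule sigma_sets_mono') force

context
  fixes L :: nat and M Q :: "'w measure" and X :: "nat \<Rightarrow> 'w \<Rightarrow> nat \<Rightarrow> real"
    and d :: "nat \<Rightarrow> (nat \<Rightarrow> real) \<Rightarrow> real"
  assumes obs: "independent_obs L M X Q d"
begin

lemma independent_obs_prob_space: "prob_space Q"
  and independent_obs_space: "space Q = space M"
  and independent_obs_sets: "sets Q = sets M"
  using obs by (simp_all add: independent_obs_def)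

lemma independent_obs_measurable: "1 \<le> k \<Longrightarrow> X k \<in> Q \<rightarrow>\<^sub>M obs_space L"
  using obs by (auto simp: independent_obs_def distributed_def)

lemma independent_obs_distr: "1 \<le> k \<Longrightarrow> distr Q (obs_space L) (X k) = density (obs_space L) (\<lambda>x. ennreal (d k x))"
  using obs by (auto simp: independent_obs_def distributed_def)

lemma independent_obs_dens_measurable: "1 \<le> k \<Longrightarrow> (\<lambda>x. ennreal (d k x)) \<in> borel_measurable (obs_space L)"
  using obs by (auto simp: independent_obs_def distributed_def)

lemma independent_obs_nn_integral:
  assumes "1 \<le> k" and [measurable]: "u \<in> borel_measurable (obs_space L)"
  shows "(\<integral>\<^sup>+\<omega>. u (X k \<omega>) \<partial>Q) = (\<integral>\<^sup>+x. ennreal (d k x) * u x \<partial>obs_space L)"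
proof -
  note [measurable] = independent_obs_measurable[OF assms(1)] independent_obs_dens_measurable[OF assms(1)]
  have "(\<integral>\<^sup>+\<omega>. u (X k \<omega>) \<partial>Q) = (\<integral>\<^sup>+x. u x \<partial>distr Q (obs_space L) (X k))"
    by (rule nn_integral_distr[symmetric]) measurable
  then show ?thesis
    unfolding independent_obs_distr[OF assms(1)] by (simp add: nn_integral_density)
qed

lemma independent_obs_AE:
  assumes "1 \<le> k" and [measurable]: "Measurable.pred (obs_space L) R" and "\<And>x. 0 < d k x \<Longrightarrow> R x"
  shows "AE \<omega> in Q. R (X k \<omega>)"
proof -
  note [measurable] = independent_obs_measurable[OF assms(1)] independent_obs_dens_measurable[OF assms(1)]
  have "AE x in distr Q (obs_space L) (X k). R x"
    unfolding independent_obs_distr[OF assms(1)] using assms(3) by (subst AE_density) auto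
  then show ?thesis
    by (subst (asm) AE_distr_iff) measurable
qed

lemma subalgebra_obs_filtration: "subalgebra Q (obs_filtration L M X k)"
proof -
  have "sigma_sets (space M) {X j -` A \<inter> space M | j A. 1 \<le> j \<and> j \<le> k \<and> A \<in> sets (obs_space L)} \<subseteq> sets Q"
    unfolding independent_obs_space[symmetric]
    by (rule sets.sigma_sets_subset) (auto intro: measurable_sets[OF independent_obs_measurable])
  then show ?thesis
    by (simp add: subalgebra_def sets_obs_filtration independent_obs_space)
qed

lemma obs_measurable_filtration:
  assumes "1 \<le> j" "j \<le> k"
  shows "X j \<in> obs_filtration L M X k \<rightarrow>\<^sub>M obs_space L"
proof (rule measurableI)
  fix \<omega> assume "\<omega> \<in> space (obs_filtration L M X k)"
  then show "X j \<omega> \<in> space (obs_space L)"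
    using measurable_space[OF independent_obs_measurable[OF assms(1)]] by (simp add: independent_obs_space)
next
  fix A assume "A \<in> sets (obs_space L)"
  then show "X j -` A \<inter> space (obs_filtration L M X k) \<in> sets (obs_filtration L M X k)"
    using assms unfolding sets_obs_filtration space_obs_filtration by (intro sigma_sets.Basic) auto
qed

lemma obs_vector_measurable:
  "(\<lambda>\<omega>. \<lambda>j\<in>{1..k}. X j \<omega>) \<in> Q \<rightarrow>\<^sub>M (\<Pi>\<^sub>M j\<in>{1..k}. obs_space L)"
  by (rule measurable_restrict) (simp add: independent_obs_measurable)

text \<open>Moves independence and change of measure for the filtration to a finite product space,
  where boxes determine everything.\<close>

lemma obs_filtration_cylinder:
  assumes "A \<in> sets (obs_filtration L M X k)"
  obtains A' where "A' \<in> sets (\<Pi>\<^sub>M j\<in>{1..k}. obs_space L)" "A = (\<lambda>\<omega>. \<lambda>j\<in>{1..k}. X j \<omega>) -` A' \<inter> space Q"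
proof -
  let ?\<Pi> = "\<Pi>\<^sub>M j\<in>{1..k}. obs_space L" and ?Y = "\<lambda>\<omega>. \<lambda>j\<in>{1..k}. X j \<omega>"
  have Y: "?Y \<in> space Q \<rightarrow> space ?\<Pi>"
    using measurable_space[OF obs_vector_measurable] by blast
  let ?V = "vimage_algebra (space Q) ?Y ?\<Pi>"
  have "sigma_sets (space ?V) {X j -` A \<inter> space Q | j A. 1 \<le> j \<and> j \<le> k \<and> A \<in> sets (obs_space L)} \<subseteq> sets ?V"
  proof (rule sets.sigma_sets_subset)
    show "{X j -` A \<inter> space Q | j A. 1 \<le> j \<and> j \<le> k \<and> A \<in> sets (obs_space L)} \<subseteq> sets ?V"
    proof clarify
      fix j A assume j: "1 \<le> j" "j \<le> k" and A: "A \<in> sets (obs_space L)"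
      have "(\<lambda>x. x j) -` A \<inter> space ?\<Pi> \<in> sets ?\<Pi>"
        using j A by (intro measurable_sets[OF measurable_component_singleton]) auto
      moreover have "X j -` A \<inter> space Q = ?Y -` ((\<lambda>x. x j) -` A \<inter> space ?\<Pi>) \<inter> space Q"
        using j Y by auto
      ultimately show "X j -` A \<inter> space Q \<in> sets (vimage_algebra (space Q) ?Y ?\<Pi>)"
        unfolding sets_vimage_algebra2[OF Y] by blast
    qed
  qed
  then have "sets (obs_filtration L M X k) \<subseteq> sets ?V"
    unfolding sets_obs_filtration independent_obs_space[symmetric] space_vimage_algebra .
  then have "A \<in> {?Y -` A \<inter> space Q | A. A \<in> sets ?\<Pi>}"
    using assms unfolding sets_vimage_algebra2[OF Y] by blast
  then show thesis using that by blast
qed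

lemma obs_filtration_indep:
  "prob_space.indep_set Q (sets (obs_filtration L M X k)) {X (Suc k) -` A \<inter> space Q | A. A \<in> sets (obs_space L)}"
proof -
  interpret Q: prob_space Q by (rule independent_obs_prob_space)
  let ?\<Pi> = "\<Pi>\<^sub>M j\<in>{1..k}. obs_space L" and ?Y = "\<lambda>\<omega>. \<lambda>j\<in>{1..k}. X j \<omega>"
  let ?\<Pi>' = "\<Pi>\<^sub>M j\<in>{Suc k}. obs_space L" and ?Y' = "\<lambda>\<omega>. \<lambda>j\<in>{Suc k}. X j \<omega>"
  have ind: "Q.indep_var ?\<Pi> ?Y ?\<Pi>' ?Y'"
    by (rule Q.indep_var_restrict[where I = "{1..}"]) (use obs in \<open>auto simp: independent_obs_def\<close>)
  show ?thesis
  proof (rule Q.indep_setI)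
    show "sets (obs_filtration L M X k) \<subseteq> Q.events"
      using subalgebra_obs_filtration[of k] by (simp add: subalgebra_def)
    show "{X (Suc k) -` A \<inter> space Q | A. A \<in> sets (obs_space L)} \<subseteq> Q.events"
      using measurable_sets[OF independent_obs_measurable[of "Suc k"]] by auto
    fix a b assume "a \<in> sets (obs_filtration L M X k)" "b \<in> {X (Suc k) -` A \<inter> space Q | A. A \<in> sets (obs_space L)}"
    then obtain C where a: "a \<in> sets (obs_filtration L M X k)"
      and C: "C \<in> sets (obs_space L)" "b = X (Suc k) -` C \<inter> space Q"
      by blast
    from a obtain A' where A': "A' \<in> sets ?\<Pi>" "a = ?Y -` A' \<inter> space Q"
      by (rule obs_filtration_cylinder)
    let ?C' = "(\<lambda>x. x (Suc k)) -` C \<inter> space ?\<Pi>'"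
    have C': "?C' \<in> sets ?\<Pi>'"
      using C by (intro measurable_sets[OF measurable_component_singleton]) auto
    have "?Y' \<omega> \<in> space ?\<Pi>'" if "\<omega> \<in> space Q" for \<omega>
      using that measurable_space[OF independent_obs_measurable[of "Suc k"]] by (auto simp: space_PiM)
    then have b: "b = ?Y' -` ?C' \<inter> space Q"
      unfolding C(2) by auto
    have "a \<inter> b = (\<lambda>\<omega>. (?Y \<omega>, ?Y' \<omega>)) -` (A' \<times> ?C') \<inter> space Q"
      unfolding A'(2) b by auto
    then show "Q.prob (a \<inter> b) = Q.prob a * Q.prob b"
      using Q.indep_varD[OF ind A'(1) C'] unfolding A'(2) b by simp
  qed
qed

section \<open>Change of measure on the observation history\<close>

lemma independent_obs_nn_integral_prod:
  assumes [measurable]: "\<And>j. u j \<in> borel_measurable (obs_space L)"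
  shows "(\<integral>\<^sup>+\<omega>. (\<Prod>j\<in>{1..k}. u j (X j \<omega>)) \<partial>Q) = (\<Prod>j\<in>{1..k}. \<integral>\<^sup>+x. ennreal (d j x) * u j x \<partial>obs_space L)"
proof -
  interpret Q: prob_space Q by (rule independent_obs_prob_space)
  have "Q.indep_vars (\<lambda>_. obs_space L) X {1..k}"
    using obs Q.indep_vars_subset[of "\<lambda>_. obs_space L" X "{1..}" "{1..k}"] by (auto simp: independent_obs_def)
  then have "Q.indep_vars (\<lambda>_. borel) (\<lambda>j \<omega>. u j (X j \<omega>)) {1..k}"
    by (rule Q.indep_vars_compose2) measurable
  then have "(\<integral>\<^sup>+\<omega>. (\<Prod>j\<in>{1..k}. u j (X j \<omega>)) \<partial>Q) = (\<Prod>j\<in>{1..k}. \<integral>\<^sup>+\<omega>. u j (X j \<omega>) \<partial>Q)"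
    by (intro Q.indep_vars_nn_integral) auto
  also have "\<dots> = (\<Prod>j\<in>{1..k}. \<integral>\<^sup>+x. ennreal (d j x) * u j x \<partial>obs_space L)"
    by (intro prod.cong refl independent_obs_nn_integral) auto
  finally show ?thesis .
qed

end

text \<open>The reweighted measures give the vector of observations the same density, hence agree on
  boxes and, being finite, on the product \<sigma>-algebra. Weights stand on both sides because
  neither law need be absolutely continuous with respect to the other: \<open>u\<close> can cut away
  the part that no choice of \<open>v\<close> can reach.\<close>

lemma obs_filtration_change_of_measure:
  assumes Q: "independent_obs L M X Q d" and P: "independent_obs L M X P e"
    and u [measurable]: "\<And>j. u j \<in> borel_measurable (obs_space L)"
    and v [measurable]: "\<And>j. v j \<in> borel_measurable (obs_space L)"
    and eq: "\<And>j x. 1 \<le> j \<Longrightarrow> j \<le> k \<Longrightarrow> ennreal (d j x) * u j x = ennreal (e j x) * v j x"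
    and finite: "(\<Prod>j\<in>{1..k}. \<integral>\<^sup>+x. ennreal (d j x) * u j x \<partial>obs_space L) \<noteq> \<infinity>"
    and phi: "\<phi> \<in> borel_measurable (obs_filtration L M X k)"
  shows "(\<integral>\<^sup>+\<omega>. \<phi> \<omega> * (\<Prod>j\<in>{1..k}. u j (X j \<omega>)) \<partial>Q) = (\<integral>\<^sup>+\<omega>. \<phi> \<omega> * (\<Prod>j\<in>{1..k}. v j (X j \<omega>)) \<partial>P)"
proof -
  let ?F = "obs_filtration L M X k" and ?\<Pi> = "\<Pi>\<^sub>M j\<in>{1..k}. obs_space L"
    and ?Y = "\<lambda>\<omega>. \<lambda>j\<in>{1..k}. X j \<omega>"
  let ?U = "\<lambda>\<omega>. \<Prod>j\<in>{1..k}. u j (X j \<omega>)" and ?V = "\<lambda>\<omega>. \<Prod>j\<in>{1..k}. v j (X j \<omega>)"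
  have space_eq: "space P = space Q"
    using independent_obs_space[OF P] independent_obs_space[OF Q] by simp
  have [measurable]: "X j \<in> Q \<rightarrow>\<^sub>M obs_space L" "X j \<in> P \<rightarrow>\<^sub>M obs_space L" if "j \<in> {1..k}" for j
    using that independent_obs_measurable[OF Q] independent_obs_measurable[OF P] by auto
  have [measurable]: "?Y \<in> Q \<rightarrow>\<^sub>M ?\<Pi>" "?Y \<in> P \<rightarrow>\<^sub>M ?\<Pi>"
    by (rule obs_vector_measurable[OF Q] obs_vector_measurable[OF P])+
  have U [measurable]: "?U \<in> borel_measurable Q" and V [measurable]: "?V \<in> borel_measurable P"
    by measurable
  have box: "emeasure (distr (density N Z) ?\<Pi> ?Y) (Pi\<^sub>E {1..k} A) = (\<Prod>j\<in>{1..k}. \<integral>\<^sup>+x. ennreal (c j x) * (w j x * indicator (A j) x) \<partial>obs_space L)"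
    if N: "independent_obs L M X N c" and w [measurable]: "\<And>j. w j \<in> borel_measurable (obs_space L)"
      and Z: "Z = (\<lambda>\<omega>. \<Prod>j\<in>{1..k}. w j (X j \<omega>))" and A': "\<And>j. j \<in> {1..k} \<Longrightarrow> A j \<in> sets (obs_space L)"
    for N c w Z A
  proof -
    define A' where "A' j = (if j \<in> {1..k} then A j else {})" for j
    have [measurable]: "A' j \<in> sets (obs_space L)" for j
      using A' by (simp add: A'_def)
    have [measurable]: "X j \<in> N \<rightarrow>\<^sub>M obs_space L" if "j \<in> {1..k}" for j
      using that independent_obs_measurable[OF N] by auto
    have [measurable]: "?Y \<in> N \<rightarrow>\<^sub>M ?\<Pi>"
      by (rule obs_vector_measurable[OF N])
    have [measurable]: "Z \<in> borel_measurable N"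
      unfolding Z by measurable
    have A'': "Pi\<^sub>E {1..k} A \<in> sets ?\<Pi>"
      using A' by (intro sets_PiM_I_finite) auto
    have "emeasure (distr (density N Z) ?\<Pi> ?Y) (Pi\<^sub>E {1..k} A) = (\<integral>\<^sup>+\<omega>. Z \<omega> * indicator (?Y -` Pi\<^sub>E {1..k} A \<inter> space N) \<omega> \<partial>N)"
      using A'' by (subst emeasure_distr) (auto simp: emeasure_density)
    also have "\<dots> = (\<integral>\<^sup>+\<omega>. (\<Prod>j\<in>{1..k}. w j (X j \<omega>) * indicator (A' j) (X j \<omega>)) \<partial>N)"
    proof (rule nn_integral_cong)
      fix \<omega> assume "\<omega> \<in> space N"
      then have "indicator (?Y -` Pi\<^sub>E {1..k} A \<inter> space N) \<omega> = (\<Prod>j\<in>{1..k}. indicator (A' j) (X j \<omega>) :: ennreal)"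
        by (auto simp: indicator_def A'_def PiE_iff prod_zero_iff)
      then show "Z \<omega> * indicator (?Y -` Pi\<^sub>E {1..k} A \<inter> space N) \<omega> = (\<Prod>j\<in>{1..k}. w j (X j \<omega>) * indicator (A' j) (X j \<omega>))"
        by (simp add: Z prod.distrib)
    qed
    also have "\<dots> = (\<Prod>j\<in>{1..k}. \<integral>\<^sup>+x. ennreal (c j x) * (w j x * indicator (A' j) x) \<partial>obs_space L)"
      by (rule independent_obs_nn_integral_prod[OF N]) measurable
    finally show ?thesis by (simp add: A'_def)
  qed
  have dist_eq: "distr (density Q ?U) ?\<Pi> ?Y = distr (density P ?V) ?\<Pi> ?Y"
  proof (rule measure_eqI_PiM_finite[where A = "\<lambda>_. space ?\<Pi>"])
    show "emeasure (distr (density Q ?U) ?\<Pi> ?Y) (Pi\<^sub>E {1..k} A) = emeasure (distr (density P ?V) ?\<Pi> ?Y) (Pi\<^sub>E {1..k} A)"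
      if "\<And>j. j \<in> {1..k} \<Longrightarrow> A j \<in> sets (obs_space L)" for A
      by (rule trans[OF box[OF Q u refl that] trans[OF _ box[OF P v refl that, symmetric]]])
         (auto intro!: prod.cong nn_integral_cong simp: eq mult.assoc[symmetric])
    show "range (\<lambda>_::nat. space ?\<Pi>) \<subseteq> prod_algebra {1..k} (\<lambda>_. obs_space L)"
      unfolding space_PiM by (auto intro!: prod_algebraI_finite)
    have "emeasure (distr (density Q ?U) ?\<Pi> ?Y) (space ?\<Pi>) = (\<Prod>j\<in>{1..k}. \<integral>\<^sup>+x. ennreal (d j x) * u j x \<partial>obs_space L)"
      unfolding space_PiM by (subst box[OF Q u refl]) (auto intro!: prod.cong nn_integral_cong)
    then show "emeasure (distr (density Q ?U) ?\<Pi> ?Y) (space ?\<Pi>) \<noteq> \<infinity>"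
      using finite by simp
  qed auto
  have em: "emeasure (density Q ?U) A = emeasure (density P ?V) A" if A: "A \<in> sets ?F" for A
  proof -
    obtain A' where A': "A' \<in> sets ?\<Pi>" "A = ?Y -` A' \<inter> space Q"
      by (rule obs_filtration_cylinder[OF Q A])
    have "emeasure (density N Z) (?Y -` A' \<inter> space N) = emeasure (distr (density N Z) ?\<Pi> ?Y) A'"
      if "?Y \<in> N \<rightarrow>\<^sub>M ?\<Pi>" for N :: "'a measure" and Z
      using A'(1) that by (subst emeasure_distr) auto
    note e = this
    have "emeasure (density Q ?U) (?Y -` A' \<inter> space Q) = emeasure (distr (density Q ?U) ?\<Pi> ?Y) A'"
      by (rule e[OF obs_vector_measurable[OF Q]])
    also have "\<dots> = emeasure (distr (density P ?V) ?\<Pi> ?Y) A'"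
      by (simp only: dist_eq)
    also have "\<dots> = emeasure (density P ?V) (?Y -` A' \<inter> space P)"
      by (rule e[OF obs_vector_measurable[OF P], symmetric])
    finally show ?thesis unfolding A'(2) space_eq .
  qed
  have subQ: "subalgebra (density Q ?U) ?F" and subP: "subalgebra (density P ?V) ?F"
    using subalgebra_obs_filtration[OF Q] subalgebra_obs_filtration[OF P] by (auto simp: subalgebra_def)
  have "restr_to_subalg (density Q ?U) ?F = restr_to_subalg (density P ?V) ?F"
  proof (rule measure_eqI)
    show "sets (restr_to_subalg (density Q ?U) ?F) = sets (restr_to_subalg (density P ?V) ?F)"
      by (simp only: sets_restr_to_subalg[OF subQ] sets_restr_to_subalg[OF subP])
    fix A assume "A \<in> sets (restr_to_subalg (density Q ?U) ?F)"
    then have A: "A \<in> sets ?F" by (simp only: sets_restr_to_subalg[OF subQ])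
    show "emeasure (restr_to_subalg (density Q ?U) ?F) A = emeasure (restr_to_subalg (density P ?V) ?F) A"
      by (simp only: emeasure_restr_to_subalg[OF subQ A] emeasure_restr_to_subalg[OF subP A] em[OF A])
  qed
  then have "(\<integral>\<^sup>+\<omega>. \<phi> \<omega> \<partial>density Q ?U) = (\<integral>\<^sup>+\<omega>. \<phi> \<omega> \<partial>density P ?V)"
    using nn_integral_subalgebra2[OF subQ phi] nn_integral_subalgebra2[OF subP phi] by simp
  then show ?thesis
    using measurable_from_subalg[OF subalgebra_obs_filtration[OF Q] phi]
      measurable_from_subalg[OF subalgebra_obs_filtration[OF P] phi]
    by (simp add: nn_integral_density mult.commute)
qed

section \<open>Residual times and worst conditional delays\<close>

lemma enat_time_measurable:
  fixes \<tau> :: "'w \<Rightarrow> enat"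
  assumes "\<And>k. {\<omega> \<in> space N. enat k < \<tau> \<omega>} \<in> sets N"
  shows "\<tau> \<in> N \<rightarrow>\<^sub>M count_space UNIV"
proof (rule measurable_count_space_eq2_countable[THEN iffD2])
  have fin: "\<tau> -` {enat k} \<inter> space N \<in> sets N" for k
  proof (cases k)
    case 0
    have "\<tau> -` {enat 0} \<inter> space N = space N - {\<omega> \<in> space N. enat 0 < \<tau> \<omega>}"
      by (auto simp: zero_enat_def[symmetric])
    then show ?thesis using 0 assms[of 0] sets.compl_sets by metis
  next
    case (Suc j)
    have eq: "t = enat (Suc j) \<longleftrightarrow> enat j < t \<and> \<not> enat (Suc j) < t" for t
      by (cases t) auto
    have "\<tau> -` {enat (Suc j)} \<inter> space N = {\<omega> \<in> space N. enat j < \<tau> \<omega>} - {\<omega> \<in> space N. enat (Suc j) < \<tau> \<omega>}"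
      using eq by auto
    then show ?thesis using Suc assms by auto
  qed
  have "\<tau> -` {\<infinity>} \<inter> space N = (\<Inter>k. {\<omega> \<in> space N. enat k < \<tau> \<omega>})"
    by auto (metis enat_ord_simps(2) less_irrefl not_infinity_eq)
  then have "\<tau> -` {\<infinity>} \<inter> space N \<in> sets N"
    using assms by (auto intro!: sets.countable_INT)
  with fin show "\<tau> \<in> space N \<rightarrow> UNIV \<and> (\<forall>a\<in>UNIV. \<tau> -` {a} \<inter> space N \<in> sets N)"
    by (metis Pi_UNIV UNIV_I not_infinity_eq)
qed

text \<open>\<open>\<tau> - \<nu>\<close> counts the \<open>j\<close> with
  \<open>\<nu> + j < \<tau>\<close>, also when \<open>\<tau>\<close> is infinite. Absorbing
  \<open>\<phi>\<close> into the measure as a density reduces this to the tail formula for a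
  mean.\<close>

lemma nn_integral_residual_time:
  assumes sets: "\<And>k. {\<omega> \<in> space N. enat k < \<tau> \<omega>} \<in> sets N" and phi [measurable]: "\<phi> \<in> borel_measurable N"
  shows "(\<integral>\<^sup>+\<omega>. \<phi> \<omega> * ennreal_of_enat (\<tau> \<omega> - enat \<nu>) \<partial>N)
       = (\<Sum>j. \<integral>\<^sup>+\<omega>. \<phi> \<omega> * indicator {\<omega> \<in> space N. enat (\<nu> + j) < \<tau> \<omega>} \<omega> \<partial>N)"
proof -
  note [measurable] = enat_time_measurable[OF sets] sets
  have less: "enat j < \<tau> \<omega> - enat \<nu> \<longleftrightarrow> enat (\<nu> + j) < \<tau> \<omega>" for j \<omega>
    by (cases "\<tau> \<omega>") auto
  have sub: "(\<lambda>\<omega>. \<tau> \<omega> - enat \<nu>) \<in> density N \<phi> \<rightarrow>\<^sub>M count_space UNIV"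
    by measurable
  have "(\<integral>\<^sup>+\<omega>. \<phi> \<omega> * ennreal_of_enat (\<tau> \<omega> - enat \<nu>) \<partial>N) = (\<integral>\<^sup>+\<omega>. ennreal_of_enat (\<tau> \<omega> - enat \<nu>) \<partial>density N \<phi>)"
    by (subst nn_integral_density) auto
  also have "\<dots> = (\<Sum>j. emeasure (density N \<phi>) {\<omega> \<in> space (density N \<phi>). enat j < \<tau> \<omega> - enat \<nu>})"
    by (rule nn_integral_enat_function[OF sub, unfolded of_nat_eq_enat])
  also have "\<dots> = (\<Sum>j. \<integral>\<^sup>+\<omega>. \<phi> \<omega> * indicator {\<omega> \<in> space N. enat (\<nu> + j) < \<tau> \<omega>} \<omega> \<partial>N)"
    by (simp add: less emeasure_density)
  finally show ?thesis .
qed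

context
  fixes Q G :: "'w measure" and \<nu> :: nat and \<tau> :: "'w \<Rightarrow> enat"
  assumes prob: "prob_space Q" and sub: "subalgebra Q G"
    and \<tau>: "\<And>k. {\<omega> \<in> space Q. enat k < \<tau> \<omega>} \<in> sets Q"
begin

abbreviation (input) "alarm_after \<equiv> {\<omega> \<in> space Q. enat \<nu> < \<tau> \<omega>}"
abbreviation (input) "residual \<equiv> (\<lambda>\<omega>. ennreal_of_enat (\<tau> \<omega> - enat \<nu>))"

lemma residual_measurable: "residual \<in> borel_measurable Q"
  using enat_time_measurable[OF \<tau>] by measurable

lemma conditioned_subalgebra:
  assumes "emeasure Q alarm_after \<noteq> 0"
  shows "prob_space (uniform_measure Q alarm_after)"
    and "sigma_finite_subalgebra (uniform_measure Q alarm_after) G"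
proof -
  interpret Q: prob_space Q by (rule prob)
  show p: "prob_space (uniform_measure Q alarm_after)"
    using assms by (intro prob_space_uniform_measure) auto
  have "subalgebra (uniform_measure Q alarm_after) G"
    using sub by (simp add: subalgebra_def)
  with p show "sigma_finite_subalgebra (uniform_measure Q alarm_after) G"
    unfolding sigma_finite_subalgebra_def
    by (simp add: prob_space_imp_sigma_finite prob_space_restr_to_subalg)
qed

text \<open>The essential supremum dominates the conditional expectation almost surely; integrate
  against \<open>\<phi>\<close> and undo the normalisation by the probability of
  \<open>alarm_after\<close>. If that probability is 0, the left side vanishes.\<close>

lemma worst_cond_delay_bounds:
  assumes phi: "\<phi> \<in> borel_measurable G"
  shows "(\<integral>\<^sup>+\<omega>. \<phi> \<omega> * residual \<omega> * indicator alarm_after \<omega> \<partial>Q)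
    \<le> worst_cond_delay Q G \<nu> \<tau> * (\<integral>\<^sup>+\<omega>. \<phi> \<omega> * indicator alarm_after \<omega> \<partial>Q)"
proof (cases "emeasure Q alarm_after = 0")
  case True
  then have "AE \<omega> in Q. indicator alarm_after \<omega> = (0 :: ennreal)"
    using \<tau>[of \<nu>] by (intro AE_I'[of alarm_after]) (auto simp: null_sets_def indicator_def)
  then have "(\<integral>\<^sup>+\<omega>. \<phi> \<omega> * residual \<omega> * indicator alarm_after \<omega> \<partial>Q) = (\<integral>\<^sup>+\<omega>. 0 \<partial>Q)"
    by (intro nn_integral_cong_AE) auto
  then show ?thesis by simp
next
  case False
  interpret Q: prob_space Q by (rule prob)
  let ?U = "uniform_measure Q alarm_after"
  interpret U: sigma_finite_subalgebra ?U G by (rule conditioned_subalgebra[OF False])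
  let ?w = "worst_cond_delay Q G \<nu> \<tau>"
  note [measurable] = residual_measurable \<tau>[of \<nu>] measurable_from_subalg[OF sub phi]
  have "AE \<omega> in ?U. nn_cond_exp ?U G residual \<omega> \<le> ?w"
    using False esssup_AE[of "nn_cond_exp ?U G residual" ?U] by (simp add: worst_cond_delay_def Let_def)
  then have "AE \<omega> in ?U. \<phi> \<omega> * nn_cond_exp ?U G residual \<omega> \<le> ?w * \<phi> \<omega>"
    by eventually_elim (subst mult.commute[of ?w], rule mult_left_mono, auto)
  then have le: "(\<integral>\<^sup>+\<omega>. \<phi> \<omega> * nn_cond_exp ?U G residual \<omega> \<partial>?U) \<le> (\<integral>\<^sup>+\<omega>. ?w * \<phi> \<omega> \<partial>?U)"
    by (rule nn_integral_mono_AE)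
  have "(\<integral>\<^sup>+\<omega>. \<phi> \<omega> * nn_cond_exp ?U G residual \<omega> \<partial>?U) = (\<integral>\<^sup>+\<omega>. \<phi> \<omega> * residual \<omega> \<partial>?U)"
    using phi by (intro U.nn_cond_exp_intg) auto
  with le have "(\<integral>\<^sup>+\<omega>. \<phi> \<omega> * residual \<omega> * indicator alarm_after \<omega> \<partial>Q) / emeasure Q alarm_after
      \<le> ?w * (\<integral>\<^sup>+\<omega>. \<phi> \<omega> * indicator alarm_after \<omega> \<partial>Q) / emeasure Q alarm_after"
    by (simp add: nn_integral_uniform_measure nn_integral_cmult mult.assoc ennreal_times_divide)
  then have "emeasure Q alarm_after * ((\<integral>\<^sup>+\<omega>. \<phi> \<omega> * residual \<omega> * indicator alarm_after \<omega> \<partial>Q) / emeasure Q alarm_after)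
      \<le> emeasure Q alarm_after * (?w * (\<integral>\<^sup>+\<omega>. \<phi> \<omega> * indicator alarm_after \<omega> \<partial>Q) / emeasure Q alarm_after)"
    by (intro mult_left_mono) auto
  then show ?thesis
    using False by (simp add: ennreal_times_divide ennreal_mult_divide_eq mult.commute[of "emeasure Q alarm_after"])
qed

text \<open>Converse of the preceding bound: averages over the events of \<open>G\<close> control
  the essential supremum. \<open>1 \<le> c\<close> covers the convention for an event of probability
  0.\<close>

lemma worst_cond_delay_le:
  assumes c: "1 \<le> c"
    and le: "\<And>A. A \<in> sets G \<Longrightarrow> (\<integral>\<^sup>+\<omega>. indicator A \<omega> * residual \<omega> * indicator alarm_after \<omega> \<partial>Q) \<le> c * emeasure Q (A \<inter> alarm_after)"
  shows "worst_cond_delay Q G \<nu> \<tau> \<le> c"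
proof (cases "emeasure Q alarm_after = 0 \<or> c = \<infinity>")
  case True
  then show ?thesis using c by (auto simp: worst_cond_delay_def)
next
  case False
  then have nz: "emeasure Q alarm_after \<noteq> 0" and fin: "c < \<infinity>"
    by (auto simp: less_top)
  interpret Q: prob_space Q by (rule prob)
  let ?U = "uniform_measure Q alarm_after" and ?e = "nn_cond_exp (uniform_measure Q alarm_after) G residual"
  interpret U: sigma_finite_subalgebra ?U G by (rule conditioned_subalgebra[OF nz])
  interpret Up: prob_space ?U by (rule conditioned_subalgebra[OF nz])
  note [measurable] = residual_measurable \<tau>[of \<nu>]
  \<comment> \<open>If the conditional delay exceeded \<open>c\<close> with positive probability,
    this event would violate \<open>le\<close>; the finiteness of \<open>c\<close> makes the
    comparison of integrals strict.\<close>
  define A where "A = {\<omega> \<in> space G. c < ?e \<omega>}"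
  have AG [measurable]: "A \<in> sets G"
    unfolding A_def by measurable
  have AQ [measurable]: "A \<in> sets Q"
    using sub AG by (auto simp: subalgebra_def)
  have "(\<integral>\<^sup>+\<omega>. indicator A \<omega> * ?e \<omega> \<partial>?U) = (\<integral>\<^sup>+\<omega>. indicator A \<omega> * residual \<omega> \<partial>?U)"
    by (intro U.nn_cond_exp_intg) auto
  also have "\<dots> = (\<integral>\<^sup>+\<omega>. indicator A \<omega> * residual \<omega> * indicator alarm_after \<omega> \<partial>Q) / emeasure Q alarm_after"
    by (rule nn_integral_uniform_measure) auto
  also have "\<dots> \<le> c * emeasure Q (A \<inter> alarm_after) / emeasure Q alarm_after"
    by (intro divide_right_mono_ennreal le AG)
  also have "\<dots> = (\<integral>\<^sup>+\<omega>. c * indicator A \<omega> \<partial>?U)"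
    by (simp add: nn_integral_cmult Int_commute ennreal_times_divide)
  finally have int_le: "(\<integral>\<^sup>+\<omega>. indicator A \<omega> * ?e \<omega> \<partial>?U) \<le> (\<integral>\<^sup>+\<omega>. c * indicator A \<omega> \<partial>?U)" .
  have fin_A: "(\<integral>\<^sup>+\<omega>. c * indicator A \<omega> \<partial>?U) \<noteq> \<infinity>"
    using fin Up.emeasure_finite[of A] by (simp add: nn_integral_cmult ennreal_mult_eq_top_iff less_top)
  have ge: "AE \<omega> in ?U. c * indicator A \<omega> \<le> indicator A \<omega> * ?e \<omega>"
    by (auto simp: A_def indicator_def)
  have "AE \<omega> in ?U. indicator A \<omega> * ?e \<omega> \<le> c * indicator A \<omega>"
  proof (rule ccontr)
    assume "\<not> (AE \<omega> in ?U. indicator A \<omega> * ?e \<omega> \<le> c * indicator A \<omega>)"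
    with fin_A ge have "(\<integral>\<^sup>+\<omega>. c * indicator A \<omega> \<partial>?U) < (\<integral>\<^sup>+\<omega>. indicator A \<omega> * ?e \<omega> \<partial>?U)"
      by (intro nn_integral_less) auto
    with int_le show False by simp
  qed
  then have "AE \<omega> in ?U. ?e \<omega> \<le> c"
  proof (rule AE_mp[OF _ AE_I2], intro impI)
    fix \<omega> assume "\<omega> \<in> space ?U" "indicator A \<omega> * ?e \<omega> \<le> c * indicator A \<omega>"
    then show "?e \<omega> \<le> c"
      using sub by (cases "\<omega> \<in> A") (auto simp: A_def subalgebra_def)
  qed
  then have "esssup ?U ?e \<le> c"
    by (intro esssup_I) auto
  then show ?thesis
    using nz by (simp add: worst_cond_delay_def Let_def)
qed

end

subsection \<open>Symmetry of the homogeneous model\<close>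

lemma ex_permutes_image:
  assumes "finite S" "E \<subseteq> S" "E' \<subseteq> S" "card E = card E'"
  obtains p where "p permutes S" "p ` E = E'"
proof -
  have fin: "finite E" "finite E'"
    using assms finite_subset by auto
  then obtain h where h: "bij_betw h E E'"
    using assms finite_same_card_bij by blast
  have "card (S - E) = card (S - E')"
    using assms fin by (simp add: card_Diff_subset)
  then obtain h' where h': "bij_betw h' (S - E) (S - E')"
    using assms finite_same_card_bij[of "S - E" "S - E'"] by blast
  define p where "p x = (if x \<in> E then h x else if x \<in> S then h' x else x)" for x
  have pE: "bij_betw p E E'"
    using h by (rule bij_betw_cong[THEN iffD1, rotated]) (simp add: p_def)
  have "bij_betw p (S - E) (S - E')"
    using h' by (rule bij_betw_cong[THEN iffD1, rotated]) (simp add: p_def)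
  with pE have "bij_betw p (E \<union> (S - E)) (E' \<union> (S - E'))"
    by (rule bij_betw_combine) auto
  then have "bij_betw p S S"
    using assms by (simp add: Un_absorb1)
  then have "p permutes S"
    using assms(2) by (intro bij_imp_permutes) (auto simp: p_def)
  then show thesis
    using that pE by (auto simp: bij_betw_def)
qed

lemma component_measurable_obs [measurable]:
  assumes "l \<in> {1..L}"
  shows "(\<lambda>x. x l) \<in> borel_measurable (obs_space L)"
  using measurable_component_singleton[OF assms, of "\<lambda>_. lborel :: real measure"]
  by (simp add: obs_space_def)

definition relabel :: "nat \<Rightarrow> (nat \<Rightarrow> nat) \<Rightarrow> (nat \<Rightarrow> real) \<Rightarrow> nat \<Rightarrow> real" where
  "relabel L p x = (\<lambda>l\<in>{1..L}. x (p l))"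

lemma relabel_measurable:
  assumes "p permutes {1..L}"
  shows "relabel L p \<in> obs_space L \<rightarrow>\<^sub>M obs_space L"
proof -
  have "(\<lambda>x. \<lambda>l\<in>{1..L}. x (p l)) \<in> obs_space L \<rightarrow>\<^sub>M (\<Pi>\<^sub>M l\<in>{1..L}. lborel)"
  proof (rule measurable_restrict)
    fix l assume "l \<in> {1..L}"
    then have "p l \<in> {1..L}"
      using permutes_in_image[OF assms] by blast
    then show "(\<lambda>x. x (p l)) \<in> obs_space L \<rightarrow>\<^sub>M lborel"
      using component_measurable_obs by simp
  qed
  then show ?thesis
    by (simp add: relabel_def[abs_def] obs_space_def)
qed

text \<open>The preimage of a box is the box with its sides permuted by \<open>inv p\<close>, and
  the product of the side lengths ignores their order.\<close>

lemma distr_relabel: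
  assumes p: "p permutes {1..L}"
  shows "distr (obs_space L) (obs_space L) (relabel L p) = obs_space L"
proof -
  interpret product_sigma_finite "\<lambda>_::nat. lborel :: real measure" ..
  have "distr (obs_space L) (obs_space L) (relabel L p) = (\<Pi>\<^sub>M l\<in>{1..L}. lborel)"
  proof (rule PiM_eqI)
    fix A :: "nat \<Rightarrow> real set" assume A: "\<And>l. l \<in> {1..L} \<Longrightarrow> A l \<in> sets lborel"
    have inv: "inv p l \<in> {1..L}" if "l \<in> {1..L}" for l
      using permutes_in_image[OF permutes_inv[OF p]] that by blast
    have A': "Pi\<^sub>E {1..L} A \<in> sets (obs_space L)"
      using A by (auto simp: obs_space_def intro!: sets_PiM_I_finite)
    have "relabel L p -` Pi\<^sub>E {1..L} A \<inter> space (obs_space L) = Pi\<^sub>E {1..L} (A \<circ> inv p)"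
    proof (intro set_eqI iffI)
      fix x assume x: "x \<in> relabel L p -` Pi\<^sub>E {1..L} A \<inter> space (obs_space L)"
      have "x l \<in> A (inv p l)" if "l \<in> {1..L}" for l
      proof -
        have "relabel L p x (inv p l) \<in> A (inv p l)"
          using x inv[OF that] by (auto simp: PiE_iff)
        then show ?thesis
          using inv[OF that] permutes_inverses(1)[OF p, of l] by (simp add: relabel_def)
      qed
      then show "x \<in> Pi\<^sub>E {1..L} (A \<circ> inv p)"
        using x by (auto simp: obs_space_def space_PiM PiE_iff)
    next
      fix x assume x: "x \<in> Pi\<^sub>E {1..L} (A \<circ> inv p)"
      have "x (p l) \<in> A l" if "l \<in> {1..L}" for l
      proof -
        have "p l \<in> {1..L}"
          using permutes_in_image[OF p] that by blast
        with x have "x (p l) \<in> A (inv p (p l))"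
          by (auto simp: PiE_iff)
        then show ?thesis
          using permutes_inverses(2)[OF p, of l] by simp
      qed
      then show "x \<in> relabel L p -` Pi\<^sub>E {1..L} A \<inter> space (obs_space L)"
        using x by (auto simp: obs_space_def space_PiM PiE_iff relabel_def)
    qed
    then have "emeasure (distr (obs_space L) (obs_space L) (relabel L p)) (Pi\<^sub>E {1..L} A)
        = emeasure (\<Pi>\<^sub>M l\<in>{1..L}. lborel) (Pi\<^sub>E {1..L} (A \<circ> inv p))"
      using A' by (subst emeasure_distr[OF relabel_measurable[OF p]]) (auto simp: obs_space_def)
    also have "\<dots> = (\<Prod>l\<in>{1..L}. emeasure lborel (A (inv p l)))"
      using A inv by (subst emeasure_PiM) auto
    also have "\<dots> = (\<Prod>l\<in>{1..L}. emeasure lborel (A l))"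
      using prod.permute[OF permutes_inv[OF p], of "\<lambda>l. emeasure lborel (A l)"] by (simp add: o_def)
    finally show "emeasure (distr (obs_space L) (obs_space L) (relabel L p)) (Pi\<^sub>E {1..L} A)
        = (\<Prod>l\<in>{1..L}. emeasure lborel (A l))" .
  qed (simp_all add: obs_space_def)
  then show ?thesis by (simp add: obs_space_def)
qed

locale homogeneous_anomaly =
  fixes L m :: nat and g f :: "real \<Rightarrow> real" and gs fs :: "nat \<Rightarrow> real \<Rightarrow> real"
    and M :: "'w measure" and X :: "nat \<Rightarrow> 'w \<Rightarrow> nat \<Rightarrow> real"
    and P :: "nat \<Rightarrow> (nat \<Rightarrow> nat set) \<Rightarrow> 'w measure" and Pinf :: "'w measure" and b :: real
  assumes m_le: "m \<le> L" and pdf_g: "pdf_on_reals g" and pdf_f: "pdf_on_reals f"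
    and homogeneous: "\<forall>l\<in>{1..L}. gs l = g \<and> fs l = f"
    and model: "moving_anomaly_model L m gs fs M X P Pinf"
    and b_pos: "0 < b"
begin

abbreviation "Es \<equiv> anomaly_sets L m"
abbreviation "pre \<equiv> dens_pre L gs"
abbreviation "post \<equiv> dens_post L gs fs"
abbreviation "mix \<equiv> mixture_dens L m gs fs (uniform_weights L m)"
abbreviation "F \<equiv> obs_filtration L M X"
abbreviation "T \<equiv> mcusum_test L m gs fs X (uniform_weights L m) b"

definition law_pre :: "(nat \<Rightarrow> real) measure" where
  "law_pre = density (obs_space L) (\<lambda>x. ennreal (pre x))"

text \<open>Division in the reals, so the value is 0 where \<open>pre\<close> vanishes. Under
  \<open>Pinf\<close> this has probability 0; under the other laws the set \<open>regular\<close>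
  keeps track of it.\<close>

definition lr :: "(nat \<Rightarrow> real) \<Rightarrow> real" where
  "lr x = mix x / pre x"

lemma g_measurable [measurable]: "g \<in> borel_measurable borel" and g_nonneg: "0 \<le> g x"
  and f_measurable [measurable]: "f \<in> borel_measurable borel" and f_nonneg: "0 \<le> f x"
  using pdf_g pdf_f by (auto simp: pdf_on_reals_def)

lemma Es: "finite Es" "card Es = L choose m" "Es \<noteq> {}" "0 < L choose m"
proof -
  show fin: "finite Es"
    by (rule finite_subset[of _ "Pow {1..L}"]) (auto simp: anomaly_sets_def)
  show card: "card Es = L choose m"
    unfolding anomaly_sets_def using n_subsets[of "{1..L}" m] by simp
  show "0 < L choose m"
    using m_le by simp
  with card show "Es \<noteq> {}" by auto
qed

lemma pre_eq: "pre x = (\<Prod>l\<in>{1..L}. g (x l))"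
  unfolding dens_pre_def using homogeneous by (intro prod.cong) auto

lemma post_eq: "E \<in> Es \<Longrightarrow> post E x = (\<Prod>l\<in>E. f (x l)) * (\<Prod>l\<in>{1..L} - E. g (x l))"
  unfolding dens_post_def anomaly_sets_def using homogeneous
  by (intro arg_cong2[of _ _ _ _ "(*)"] prod.cong refl) auto

lemma mix_eq: "mix x = (\<Sum>E\<in>Es. post E x) / real (L choose m)"
  by (simp add: mixture_dens_def uniform_weights_def sum_distrib_left[symmetric] divide_inverse mult.commute)

lemma pre_nonneg: "0 \<le> pre x"
  by (simp add: pre_eq prod_nonneg g_nonneg)

lemma post_nonneg: "E \<in> Es \<Longrightarrow> 0 \<le> post E x"
  by (simp add: post_eq prod_nonneg g_nonneg f_nonneg)

lemma mix_nonneg: "0 \<le> mix x"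
  unfolding mix_eq by (intro divide_nonneg_nonneg sum_nonneg post_nonneg) auto

lemma pre_measurable [measurable]: "pre \<in> borel_measurable (obs_space L)"
  unfolding pre_eq[abs_def] by measurable

lemma post_measurable [measurable]:
  assumes "E \<in> Es"
  shows "post E \<in> borel_measurable (obs_space L)"
proof -
  have [measurable]: "(\<lambda>x. x l) \<in> borel_measurable (obs_space L)" if "l \<in> E" for l
    using assms that by (intro component_measurable_obs) (auto simp: anomaly_sets_def)
  have "(\<lambda>x. (\<Prod>l\<in>E. f (x l)) * (\<Prod>l\<in>{1..L} - E. g (x l))) \<in> borel_measurable (obs_space L)"
    by measurable
  then show ?thesis
    by (simp add: post_eq[OF assms, abs_def])
qed

lemma mix_measurable [measurable]: "mix \<in> borel_measurable (obs_space L)"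
  unfolding mix_eq[abs_def] by measurable

lemma lr_nonneg: "0 \<le> lr x"
  by (simp add: lr_def mix_nonneg pre_nonneg)

text \<open>Every anomaly set has positive weight, so whatever is possible under one of them is
  possible under the mixture. Hence the test notices each observation that was impossible before the
  change.\<close>

lemma mix_pos: "E \<in> Es \<Longrightarrow> 0 < post E x \<Longrightarrow> 0 < mix x"
  unfolding mix_eq using Es
  by (intro divide_pos_pos sum_pos2[of Es E]) (auto intro: post_nonneg)

lemma permute_pre:
  assumes p: "p permutes {1..L}"
  shows "pre (relabel L p x) = pre x"
proof -
  have "pre (relabel L p x) = (\<Prod>l\<in>{1..L}. g (x (p l)))"
    unfolding pre_eq by (intro prod.cong) (auto simp: relabel_def)
  also have "\<dots> = pre x"
    unfolding pre_eq using prod.permute[OF p, of "\<lambda>l. g (x l)"] by (simp add: o_def)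
  finally show ?thesis .
qed

lemma permute_Es: "p permutes {1..L} \<Longrightarrow> E \<in> Es \<Longrightarrow> p ` E \<in> Es"
  unfolding anomaly_sets_def
  by (auto simp: card_image[OF inj_on_subset[OF permutes_inj]] dest: permutes_in_image)

lemma permute_post:
  assumes p: "p permutes {1..L}" and E: "E \<in> Es"
  shows "post E (relabel L p x) = post (p ` E) x"
proof -
  have inj: "inj_on p A" for A
    using permutes_inj[OF p] inj_on_subset by blast
  have sub: "E \<subseteq> {1..L}"
    using E by (simp add: anomaly_sets_def)
  have "post E (relabel L p x) = (\<Prod>l\<in>E. f (x (p l))) * (\<Prod>l\<in>{1..L} - E. g (x (p l)))"
    unfolding post_eq[OF E] using sub by (intro arg_cong2[of _ _ _ _ "(*)"] prod.cong) (auto simp: relabel_def)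
  also have "\<dots> = (\<Prod>l\<in>p ` E. f (x l)) * (\<Prod>l\<in>p ` ({1..L} - E). g (x l))"
    by (simp add: prod.reindex[OF inj])
  also have "p ` ({1..L} - E) = {1..L} - p ` E"
    using permutes_image[OF p] by (simp add: image_set_diff[OF permutes_inj[OF p]])
  finally show ?thesis
    by (simp add: post_eq[OF permute_Es[OF p E]])
qed

lemma permute_mix:
  assumes p: "p permutes {1..L}"
  shows "mix (relabel L p x) = mix x"
proof -
  have bij: "bij_betw ((`) p) Es Es"
  proof (rule bij_betwI[where g = "(`) (inv p)"])
    show "(`) p \<in> Es \<rightarrow> Es" "(`) (inv p) \<in> Es \<rightarrow> Es"
      using permute_Es[OF p] permute_Es[OF permutes_inv[OF p]] by auto
  qed (auto simp: image_image permutes_inverses[OF p])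
  have "(\<Sum>E\<in>Es. post E (relabel L p x)) = (\<Sum>E\<in>Es. post (p ` E) x)"
    by (intro sum.cong refl permute_post p)
  also have "\<dots> = (\<Sum>E\<in>Es. post E x)"
    using sum.reindex_bij_betw[OF bij, of "\<lambda>E. post E x"] by simp
  finally show ?thesis by (simp add: mix_eq)
qed

text \<open>Some relabelling carries \<open>E\<close> to \<open>E'\<close>; it preserves the product
  Lebesgue measure and, by hypothesis, \<open>u\<close>.\<close>

lemma symmetric_post_integral:
  assumes "E \<in> Es" "E' \<in> Es" and u [measurable]: "u \<in> borel_measurable (obs_space L)"
    and sym: "\<And>p x. p permutes {1..L} \<Longrightarrow> u (relabel L p x) = u x"
  shows "(\<integral>\<^sup>+x. ennreal (post E x) * u x \<partial>obs_space L) = (\<integral>\<^sup>+x. ennreal (post E' x) * u x \<partial>obs_space L)"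
proof -
  obtain p where p: "p permutes {1..L}" "p ` E = E'"
    using assms(1,2) ex_permutes_image[of "{1..L}" E E'] by (auto simp: anomaly_sets_def)
  note [measurable] = relabel_measurable[OF p(1)] post_measurable[OF assms(1)]
  have "(\<integral>\<^sup>+x. ennreal (post E x) * u x \<partial>obs_space L)
      = (\<integral>\<^sup>+x. ennreal (post E x) * u x \<partial>distr (obs_space L) (obs_space L) (relabel L p))"
    by (simp add: distr_relabel[OF p(1)])
  also have "\<dots> = (\<integral>\<^sup>+x. ennreal (post E (relabel L p x)) * u (relabel L p x) \<partial>obs_space L)"
    by (rule nn_integral_distr) measurable
  also have "\<dots> = (\<integral>\<^sup>+x. ennreal (post E' x) * u x \<partial>obs_space L)"
    by (simp add: permute_post[OF p(1) assms(1)] sym[OF p(1)] p(2))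
  finally show ?thesis .
qed

section \<open>The CUSUM chain of the homogeneous model\<close>

lemma obs_Pinf: "independent_obs L M X Pinf (\<lambda>k. pre)"
  using model by (simp add: moving_anomaly_model_def)

lemma obs_P: "S \<in> anomaly_paths L m \<Longrightarrow>
    independent_obs L M X (P \<nu> S) (\<lambda>k. if k \<le> \<nu> then pre else post (S k))"
  using model by (simp add: moving_anomaly_model_def)

lemma sets_law_pre [measurable_cong]: "sets law_pre = sets (obs_space L)"
  by (simp add: law_pre_def)

lemma law_pre_eq: "1 \<le> k \<Longrightarrow> distr Pinf law_pre (X k) = law_pre"
  using independent_obs_distr[OF obs_Pinf, of k] distr_cong[OF refl sets_law_pre, of Pinf "X k" "X k"]
  by (simp add: law_pre_def)

sublocale cusum: cusum_process law_pre lr "exp b" Pinf F X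
proof -
  interpret Pinf: prob_space Pinf
    by (rule independent_obs_prob_space[OF obs_Pinf])
  have X_law: "X (Suc k) \<in> Pinf \<rightarrow>\<^sub>M law_pre" for k
    using independent_obs_measurable[OF obs_Pinf, of "Suc k"] by (simp add: measurable_cong_sets[OF refl sets_law_pre])
  interpret law: prob_space law_pre
    using Pinf.prob_space_distr[OF X_law[of 0]] law_pre_eq[of 1] by simp
  show "cusum_process law_pre lr (exp b) Pinf F X"
  proof (intro_locales, goal_cases)
    case 1
    show ?case using b_pos lr_nonneg by unfold_locales (auto simp: lr_def[abs_def])
  next
    case 2
    show ?case
    proof
      show "subalgebra Pinf (F k)" for k by (rule subalgebra_obs_filtration[OF obs_Pinf])
      show "j \<le> k \<Longrightarrow> sets (F j) \<subseteq> sets (F k)" for j k by (rule obs_filtration_mono)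
      show "X (Suc k) \<in> F (Suc k) \<rightarrow>\<^sub>M law_pre" for k
        using obs_measurable_filtration[OF obs_Pinf, of "Suc k" "Suc k"] by (simp add: measurable_cong_sets[OF refl sets_law_pre])
      show "distr Pinf law_pre (X (Suc k)) = law_pre" for k by (rule law_pre_eq) simp
      show "Pinf.indep_set (sets (F k)) {X (Suc k) -` A \<inter> space Pinf | A. A \<in> sets law_pre}" for k
        unfolding sets_law_pre by (rule obs_filtration_indep[OF obs_Pinf])
    qed
  qed
qed

text \<open>The next level depends on the observation only through \<open>lr\<close>, which is
  invariant under relabelling; hence the killed operator does not see which sensors are
  anomalous.\<close>

lemma kill_post:
  assumes E: "E \<in> Es" "E' \<in> Es" and [measurable]: "v \<in> borel_measurable borel"
  shows "cusum.kill (\<lambda>x. ennreal (post E x / pre x)) v = cusum.kill (\<lambda>x. ennreal (post E' x / pre x)) v"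
proof
  fix w
  \<comment> \<open>The indicator of \<open>0 < pre x\<close> reproduces division by zero giving 0,
    once the factor \<open>pre x\<close> has been cancelled.\<close>
  define u where "u x = indicator {0<..} (pre x) * (indicator {..<exp b} (cusum.nxt w x) * v (cusum.nxt w x))" for x
  have [measurable]: "cusum.nxt w \<in> borel_measurable (obs_space L)"
    by (rule cusum.nxt_measurable'[unfolded measurable_cong_sets[OF sets_law_pre refl]])
  have [measurable]: "u \<in> borel_measurable (obs_space L)"
    unfolding u_def by measurable
  have kill: "cusum.kill (\<lambda>x. ennreal (post E x / pre x)) v w = (\<integral>\<^sup>+x. ennreal (post E x) * u x \<partial>obs_space L)"
    if E: "E \<in> Es" for E
  proof -
    note [measurable] = post_measurable[OF E]
    have "cusum.kill (\<lambda>x. ennreal (post E x / pre x)) v w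
        = (\<integral>\<^sup>+x. ennreal (pre x) * (ennreal (post E x / pre x) *
              (indicator {..<exp b} (cusum.nxt w x) * v (cusum.nxt w x))) \<partial>obs_space L)"
      unfolding cusum.kill_def unfolding law_pre_def by (rule nn_integral_density) measurable
    also have "\<dots> = (\<integral>\<^sup>+x. ennreal (post E x) * u x \<partial>obs_space L)"
    proof (rule nn_integral_cong)
      fix x
      show "ennreal (pre x) * (ennreal (post E x / pre x) * (indicator {..<exp b} (cusum.nxt w x) * v (cusum.nxt w x)))
          = ennreal (post E x) * u x"
        using pre_nonneg[of x] post_nonneg[OF E, of x]
        by (cases "pre x = 0") (auto simp: u_def mult.assoc[symmetric] ennreal_mult[symmetric])
    qed
    finally show ?thesis .
  qed
  show "cusum.kill (\<lambda>x. ennreal (post E x / pre x)) v w = cusum.kill (\<lambda>x. ennreal (post E' x / pre x)) v w"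
    unfolding kill[OF E(1)] kill[OF E(2)]
  proof (rule symmetric_post_integral[OF E])
    show "u (relabel L p x) = u x" if "p permutes {1..L}" for p x
      using that by (simp add: u_def cusum.nxt_def lr_def permute_pre permute_mix)
  qed measurable
qed

lemma lr_eq_sum: "ennreal (lr x) = (\<Sum>E\<in>Es. ennreal (1 / real (L choose m)) * ennreal (post E x / pre x))"
proof -
  have "lr x = (\<Sum>E\<in>Es. 1 / real (L choose m) * (post E x / pre x))"
    by (simp add: lr_def mix_eq sum_divide_distrib mult.commute)
  then show ?thesis
    by (simp add: post_nonneg pre_nonneg flip: ennreal_mult sum_ennreal)
qed

text \<open>\<open>lr\<close> is the average of the ratios \<open>post E / pre\<close>, and all
  terms of the average give the same operator.\<close>

lemma kill_lr:
  assumes E: "E \<in> Es" and [measurable]: "v \<in> borel_measurable borel"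
  shows "cusum.kill (\<lambda>x. ennreal (post E x / pre x)) v = cusum.kill (\<lambda>x. ennreal (lr x)) v"
proof
  fix w
  let ?K = "\<lambda>E. cusum.kill (\<lambda>x. ennreal (post E x / pre x)) v w"
  have [measurable]: "cusum.nxt w \<in> borel_measurable law_pre" by (rule cusum.nxt_measurable')
  have "cusum.kill (\<lambda>x. ennreal (lr x)) v w
      = (\<integral>\<^sup>+x. (\<Sum>E\<in>Es. ennreal (1 / real (L choose m)) * (ennreal (post E x / pre x) *
          (indicator {..<exp b} (cusum.nxt w x) * v (cusum.nxt w x)))) \<partial>law_pre)"
    unfolding cusum.kill_def lr_eq_sum by (simp add: sum_distrib_right mult.assoc)
  also have "\<dots> = (\<Sum>E\<in>Es. ennreal (1 / real (L choose m)) * ?K E)"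
    unfolding cusum.kill_def by (subst nn_integral_sum) (auto intro!: sum.cong nn_integral_cmult)
  also have "\<dots> = (\<Sum>E'\<in>Es. ennreal (1 / real (L choose m)) * ?K E)"
    by (intro sum.cong refl arg_cong2[of _ _ _ _ "(*)"] fun_cong[OF kill_post[OF _ E]]) measurable
  also have "\<dots> = (of_nat (L choose m) * ennreal (1 / real (L choose m))) * ?K E"
    by (simp add: Es(2) mult.assoc)
  also have "of_nat (L choose m) * ennreal (1 / real (L choose m)) = 1"
    using Es(4) by (simp add: ennreal_of_nat_eq_real_of_nat ennreal_mult[symmetric])
  finally show "?K E = cusum.kill (\<lambda>x. ennreal (lr x)) v w" by simp
qed

subsection \<open>Worst-case delay of the M-CUSUM test and of its competitors\<close>

text \<open>Histories without an observation that was impossible before the change. On them the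
  extended likelihood ratios are finite and agree with the real ones; the complement carries the
  singular parts of the anomalous laws.\<close>

definition regular :: "nat \<Rightarrow> 'w set" where
  "regular k = {\<omega> \<in> space M. \<forall>j\<in>{1..k}. 0 < pre (X j \<omega>)}"

abbreviation "stat \<equiv> mcusum_stat L m gs fs (uniform_weights L m) X"

lemma space_Pinf: "space Pinf = space M" and sets_Pinf: "sets Pinf = sets M"
  using independent_obs_space[OF obs_Pinf] independent_obs_sets[OF obs_Pinf] .

lemma X_F: "1 \<le> j \<Longrightarrow> j \<le> k \<Longrightarrow> X j \<in> F k \<rightarrow>\<^sub>M obs_space L"
  by (rule obs_measurable_filtration[OF obs_Pinf])

lemma indicator_regular:
  "\<omega> \<in> space M \<Longrightarrow> indicator (regular k) \<omega> = (\<Prod>j\<in>{1..k}. indicator {x. 0 < pre x} (X j \<omega>) :: ennreal)"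
  by (auto simp: regular_def indicator_def prod_zero_iff)

text \<open>The new observation multiplies every older window by the same factor and opens a window
  consisting of that factor alone; multiplication by it commutes with the maximum.\<close>

lemma stat_Suc:
  "stat (Suc k) \<omega> = max 1 (stat k \<omega>) * (ennreal (mix (X (Suc k) \<omega>)) / ennreal (pre (X (Suc k) \<omega>)))"
proof -
  define l where "l = ennreal (mix (X (Suc k) \<omega>)) / ennreal (pre (X (Suc k) \<omega>))"
  let ?R = "lik_ratio L m gs fs (uniform_weights L m) X"
  have R: "?R (Suc k) (i - 1) \<omega> = ?R k (i - 1) \<omega> * l" if "i \<in> {1..k}" for i
    using that by (simp add: lik_ratio_def l_def prod.nat_ivl_Suc')
  have R_last: "?R (Suc k) k \<omega> = l"
    by (simp add: lik_ratio_def l_def)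
  show ?thesis
  proof (cases "k = 0")
    case True
    then show ?thesis
      using R_last by (simp add: mcusum_stat_def l_def)
  next
    case False
    have "stat (Suc k) \<omega> = Max (insert l ((\<lambda>i. ?R k (i - 1) \<omega> * l) ` {1..k}))"
      using R R_last by (simp add: mcusum_stat_def atLeastAtMostSuc_conv)
    also have "\<dots> = max l (Max ((\<lambda>a. a * l) ` ((\<lambda>i. ?R k (i - 1) \<omega>) ` {1..k})))"
      using False by (subst Max_insert) (auto simp: image_image)
    also have "Max ((\<lambda>a. a * l) ` ((\<lambda>i. ?R k (i - 1) \<omega>) ` {1..k})) = stat k \<omega> * l"
      using False by (subst mono_Max_commute[symmetric]) (auto simp: mcusum_stat_def intro!: monoI mult_right_mono)
    also have "max l (stat k \<omega> * l) = max 1 (stat k \<omega>) * l"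
      using mult_right_mono[of 1 "stat k \<omega>" l] mult_right_mono[of "stat k \<omega>" 1 l] by (auto simp: max_def)
    finally show ?thesis by (simp add: l_def)
  qed
qed

lemma stat_measurable: "stat k \<in> borel_measurable (F k)"
proof (induction k)
  case (Suc k)
  have [measurable]: "stat k \<in> borel_measurable (F (Suc k))"
    using Suc by (rule cusum.measurable_F_mono) simp
  have [measurable]: "X (Suc k) \<in> F (Suc k) \<rightarrow>\<^sub>M obs_space L"
    by (rule X_F) auto
  show ?case unfolding stat_Suc[abs_def] by measurable
qed (simp add: mcusum_stat_def)

lemma stat_regular: "\<omega> \<in> regular k \<Longrightarrow> stat k \<omega> = ennreal (cusum.W k \<omega>)"
proof (induction k)
  case (Suc k)
  then have pos: "0 < pre (X (Suc k) \<omega>)" and reg: "\<omega> \<in> regular k"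
    by (auto simp: regular_def)
  have "ennreal (mix (X (Suc k) \<omega>)) / ennreal (pre (X (Suc k) \<omega>)) = ennreal (lr (X (Suc k) \<omega>))"
    by (simp add: lr_def divide_ennreal pos mix_nonneg)
  moreover have "max 1 (ennreal (cusum.W k \<omega>)) = ennreal (max 1 (cusum.W k \<omega>))"
    by (simp add: max_def)
  ultimately show ?case
    using lr_nonneg by (simp add: stat_Suc Suc.IH[OF reg] cusum.nxt_def ennreal_mult)
qed (simp add: mcusum_stat_def)

lemma test_le_iff: "T \<omega> \<le> enat k \<longleftrightarrow> (\<exists>j\<in>{1..k}. ennreal (exp b) \<le> stat j \<omega>)"
proof
  let ?A = "{enat k | k. 1 \<le> k \<and> ennreal (exp b) \<le> stat k \<omega>}"
  assume le: "T \<omega> \<le> enat k"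
  have "?A \<noteq> {}"
  proof
    assume "?A = {}"
    then have "T \<omega> = \<infinity>"
      unfolding mcusum_test_def by (simp only: Inf_enat_def refl if_True)
    with le show False by simp
  qed
  then obtain t where "t \<in> ?A" by (meson all_not_in_conv)
  then have "T \<omega> \<in> ?A"
    unfolding mcusum_test_def by (rule wellorder_InfI)
  with le show "\<exists>j\<in>{1..k}. ennreal (exp b) \<le> stat j \<omega>"
    by auto
next
  assume "\<exists>j\<in>{1..k}. ennreal (exp b) \<le> stat j \<omega>"
  then obtain j where j: "1 \<le> j" "j \<le> k" "ennreal (exp b) \<le> stat j \<omega>" by auto
  then have "T \<omega> \<le> enat j"
    unfolding mcusum_test_def by (intro Inf_lower) auto
  with j show "T \<omega> \<le> enat k"
    by (meson enat_ord_simps(1) order_trans)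
qed

lemma test_regular:
  assumes "\<omega> \<in> regular k"
  shows "enat k < T \<omega> \<longleftrightarrow> \<omega> \<in> cusum.alive k"
proof -
  have "stat j \<omega> = ennreal (cusum.W j \<omega>)" if "j \<in> {1..k}" for j
    using assms that by (intro stat_regular) (auto simp: regular_def)
  then show ?thesis
    using assms test_le_iff[of \<omega> k] cusum.W_nonneg
    by (auto simp: cusum.alive_def space_Pinf regular_def not_le[symmetric] ennreal_le_iff)
qed

text \<open>An observation impossible under \<open>pre\<close> but possible under \<open>mix\<close>
  has an infinite ratio, and the window starting there passes any threshold. The last assumption
  excludes the undecided case 0 / 0.\<close>

lemma test_irregular:
  assumes "\<omega> \<in> space M" "\<omega> \<notin> regular k" "\<And>j. j \<in> {1..k} \<Longrightarrow> 0 < mix (X j \<omega>) \<or> 0 < pre (X j \<omega>)"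
  shows "\<not> enat k < T \<omega>"
proof -
  obtain j where j: "j \<in> {1..k}" "\<not> 0 < pre (X j \<omega>)"
    using assms(1,2) by (auto simp: regular_def)
  then have "pre (X j \<omega>) = 0" "0 < mix (X j \<omega>)"
    using pre_nonneg[of "X j \<omega>"] assms(3)[of j] by auto
  then have "ennreal (mix (X j \<omega>)) / ennreal (pre (X j \<omega>)) = \<infinity>"
    by (simp add: ennreal_divide_zero)
  then have "stat j \<omega> = \<infinity>"
    using j(1) stat_Suc[of "j - 1" \<omega>] by (auto simp: ennreal_mult_top max_def split: if_splits)
  with j(1) have "T \<omega> \<le> enat k"
    unfolding test_le_iff by (intro bexI[of _ j]) auto
  then show ?thesis by simp
qed

section \<open>The test and the likelihood ratios under the individual laws\<close>

lemma AE_Pinf_regular: "AE \<omega> in Pinf. \<omega> \<in> regular k"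
proof -
  have "AE \<omega> in Pinf. \<forall>j\<in>{1..k}. 0 < pre (X j \<omega>)"
    by (intro AE_finite_allI independent_obs_AE[OF obs_Pinf]) auto
  then show ?thesis
    using AE_space by eventually_elim (simp add: regular_def space_Pinf)
qed

lemma AE_Pinf_test: "AE \<omega> in Pinf. enat k < T \<omega> \<longleftrightarrow> \<omega> \<in> cusum.alive k"
  using AE_Pinf_regular[of k] by eventually_elim (rule test_regular)

text \<open>Outside \<open>regular k\<close> the test has stopped almost surely: each observation
  has positive density under its own law, hence under \<open>pre\<close> or \<open>mix\<close>,
  which excludes 0 / 0.\<close>

lemma AE_P_test:
  assumes S: "S \<in> anomaly_paths L m"
  shows "AE \<omega> in P \<nu> S. enat k < T \<omega> \<longleftrightarrow> \<omega> \<in> cusum.alive k \<and> \<omega> \<in> regular k"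
proof -
  note obs = obs_P[OF S, of \<nu>]
  have "AE \<omega> in P \<nu> S. 0 < mix (X j \<omega>) \<or> 0 < pre (X j \<omega>)" if "j \<in> {1..k}" for j
  proof (rule independent_obs_AE[OF obs])
    show "Measurable.pred (obs_space L) (\<lambda>x. 0 < mix x \<or> 0 < pre x)" by measurable
    have "S j \<in> Es" using S that by (auto simp: anomaly_paths_def)
    then show "0 < (if j \<le> \<nu> then pre else post (S j)) x \<Longrightarrow> 0 < mix x \<or> 0 < pre x" for x
      using mix_pos by (auto split: if_splits)
  qed (use that in auto)
  then have "AE \<omega> in P \<nu> S. \<forall>j\<in>{1..k}. 0 < mix (X j \<omega>) \<or> 0 < pre (X j \<omega>)"
    by (intro AE_finite_allI) auto
  then show ?thesis
    using AE_space
  proof eventually_elim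
    case (elim \<omega>)
    then show ?case
      using test_regular[of \<omega> k] test_irregular[of \<omega> k] independent_obs_space[OF obs]
      by (cases "\<omega> \<in> regular k") auto
  qed
qed

lemma AE_P_regular:
  assumes S: "S \<in> anomaly_paths L m" and "k \<le> \<nu>"
  shows "AE \<omega> in P \<nu> S. \<omega> \<in> regular k"
proof -
  note obs = obs_P[OF S, of \<nu>]
  have "AE \<omega> in P \<nu> S. \<forall>j\<in>{1..k}. 0 < pre (X j \<omega>)"
    using assms(2) by (intro AE_finite_allI independent_obs_AE[OF obs]) auto
  then show ?thesis
    using AE_space by eventually_elim (simp add: regular_def independent_obs_space[OF obs])
qed

text \<open>Both laws give the same density to observations up to \<open>\<nu>\<close>, so only
  later factors remain. The restriction to \<open>regular k\<close> removes the part of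
  \<open>P \<nu> S\<close> that is singular to \<open>Pinf\<close>.\<close>

lemma likelihood:
  assumes S: "S \<in> anomaly_paths L m" and k: "\<nu> \<le> k" and phi: "\<phi> \<in> borel_measurable (F k)"
  shows "(\<integral>\<^sup>+\<omega>. \<phi> \<omega> * indicator (regular k) \<omega> \<partial>P \<nu> S)
       = (\<integral>\<^sup>+\<omega>. \<phi> \<omega> * (\<Prod>j\<in>{\<nu>+1..k}. ennreal (post (S j) (X j \<omega>) / pre (X j \<omega>))) \<partial>Pinf)"
proof -
  note obs = obs_P[OF S, of \<nu>]
  define d where "d j = (if j \<le> \<nu> then pre else post (S j))" for j
  have Sj: "S j \<in> Es" if "1 \<le> j" for j
    using S that by (auto simp: anomaly_paths_def)
  have d_nonneg: "0 \<le> d j x" if "1 \<le> j" for j x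
    using Sj[OF that] by (simp add: d_def pre_nonneg post_nonneg)
  define v where "v j x = (if 1 \<le> j then ennreal (d j x / pre x) else 0)" for j x
  have v [measurable]: "v j \<in> borel_measurable (obs_space L)" for j
  proof (cases "1 \<le> j")
    case True
    then have [measurable]: "d j \<in> borel_measurable (obs_space L)"
      using Sj[OF True] post_measurable by (simp add: d_def)
    show ?thesis unfolding v_def by measurable
  qed (simp add: v_def[abs_def])
  interpret Q: prob_space "P \<nu> S" by (rule independent_obs_prob_space[OF obs])
  have "(\<integral>\<^sup>+\<omega>. \<phi> \<omega> * indicator (regular k) \<omega> \<partial>P \<nu> S)
      = (\<integral>\<^sup>+\<omega>. \<phi> \<omega> * (\<Prod>j\<in>{1..k}. indicator {x. 0 < pre x} (X j \<omega>)) \<partial>P \<nu> S)"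
    by (intro nn_integral_cong) (simp add: indicator_regular independent_obs_space[OF obs])
  also have "\<dots> = (\<integral>\<^sup>+\<omega>. \<phi> \<omega> * (\<Prod>j\<in>{1..k}. v j (X j \<omega>)) \<partial>Pinf)"
  \<comment> \<open>The weights are the indicator of \<open>0 < pre\<close> on the side of
    \<open>P \<nu> S\<close> and the density ratio on the side of \<open>Pinf\<close>; where
    \<open>pre\<close> vanishes, both weighted densities are 0.\<close>
  proof (rule obs_filtration_change_of_measure[OF obs[folded d_def] obs_Pinf _ v _ _ phi, of "\<lambda>_. indicator {x. 0 < pre x}"])
    have pos [measurable]: "{x \<in> space (obs_space L). 0 < pre x} \<in> sets (obs_space L)" by measurable
    show ind: "indicator {x. 0 < pre x} \<in> borel_measurable (obs_space L)" for j :: nat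
      by (subst measurable_cong[where g = "indicator {x \<in> space (obs_space L). 0 < pre x}"]) (auto simp: indicator_def)
    show "ennreal (d j x) * indicator {x. 0 < pre x} x = ennreal (pre x) * v j x" if "1 \<le> j" for j x
      using that pre_nonneg[of x] d_nonneg[OF that, of x]
      by (cases "pre x = 0") (auto simp: v_def ennreal_mult[symmetric])
    have "(\<Prod>j\<in>{1..k}. \<integral>\<^sup>+x. ennreal (d j x) * indicator {x. 0 < pre x} x \<partial>obs_space L)
        = (\<integral>\<^sup>+\<omega>. (\<Prod>j\<in>{1..k}. indicator {x. 0 < pre x} (X j \<omega>)) \<partial>P \<nu> S)"
      by (rule independent_obs_nn_integral_prod[OF obs[folded d_def], symmetric]) (rule ind)
    also have "\<dots> \<le> (\<integral>\<^sup>+\<omega>. 1 \<partial>P \<nu> S)"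
      by (intro nn_integral_mono prod_le_1) (auto simp: indicator_def)
    also have "\<dots> < \<infinity>" by (simp add: Q.emeasure_space_1)
    finally show "(\<Prod>j\<in>{1..k}. \<integral>\<^sup>+x. ennreal (d j x) * indicator {x. 0 < pre x} x \<partial>obs_space L) \<noteq> \<infinity>"
      by simp
  qed
  also have "\<dots> = (\<integral>\<^sup>+\<omega>. \<phi> \<omega> * (\<Prod>j\<in>{\<nu>+1..k}. ennreal (post (S j) (X j \<omega>) / pre (X j \<omega>))) \<partial>Pinf)"
  proof (rule nn_integral_cong_AE)
    show "AE \<omega> in Pinf. \<phi> \<omega> * (\<Prod>j\<in>{1..k}. v j (X j \<omega>))
        = \<phi> \<omega> * (\<Prod>j\<in>{\<nu>+1..k}. ennreal (post (S j) (X j \<omega>) / pre (X j \<omega>)))"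
      using AE_Pinf_regular[of k]
    proof eventually_elim
      case (elim \<omega>)
      have "{1..k} = {1..\<nu>} \<union> {\<nu>+1..k}" using k by auto
      then have "(\<Prod>j\<in>{1..k}. v j (X j \<omega>)) = (\<Prod>j\<in>{1..\<nu>}. v j (X j \<omega>)) * (\<Prod>j\<in>{\<nu>+1..k}. v j (X j \<omega>))"
        by (simp add: prod.union_disjoint)
      also have "(\<Prod>j\<in>{1..\<nu>}. v j (X j \<omega>)) = 1"
      proof (intro prod.neutral ballI)
        fix j assume j: "j \<in> {1..\<nu>}"
        with elim k have "0 < pre (X j \<omega>)" by (simp add: regular_def)
        with j show "v j (X j \<omega>) = 1" by (simp add: v_def d_def)
      qed
      also have "(\<Prod>j\<in>{\<nu>+1..k}. v j (X j \<omega>)) = (\<Prod>j\<in>{\<nu>+1..k}. ennreal (post (S j) (X j \<omega>) / pre (X j \<omega>)))"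
        by (intro prod.cong) (auto simp: v_def d_def)
      finally show ?case by simp
    qed
  qed
  finally show ?thesis .
qed

text \<open>Up to time \<open>\<nu>\<close> the product of ratios is empty and
  \<open>regular \<nu>\<close> has full probability.\<close>

lemma pre_change_integral:
  assumes S: "S \<in> anomaly_paths L m" and phi: "\<phi> \<in> borel_measurable (F \<nu>)"
  shows "(\<integral>\<^sup>+\<omega>. \<phi> \<omega> \<partial>P \<nu> S) = (\<integral>\<^sup>+\<omega>. \<phi> \<omega> \<partial>Pinf)"
proof -
  have "(\<integral>\<^sup>+\<omega>. \<phi> \<omega> \<partial>P \<nu> S) = (\<integral>\<^sup>+\<omega>. \<phi> \<omega> * indicator (regular \<nu>) \<omega> \<partial>P \<nu> S)"
  proof (rule nn_integral_cong_AE)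
    show "AE \<omega> in P \<nu> S. \<phi> \<omega> = \<phi> \<omega> * indicator (regular \<nu>) \<omega>"
      using AE_P_regular[OF S order_refl, of \<nu>] by eventually_elim simp
  qed
  then show ?thesis
    using likelihood[OF S order_refl phi] by simp
qed

section \<open>Stopping times and mean durations\<close>

lemma alarm_after_sets:
  assumes "\<tau> \<in> obs_stopping_times L M X"
  shows "{\<omega> \<in> space M. enat k < \<tau> \<omega>} \<in> sets (F k)"
proof (cases "k = 0")
  case True
  have "{\<omega> \<in> space M. enat k < \<tau> \<omega>} = space (F k)"
    using assms True by (auto simp: obs_stopping_times_def enat_0 one_eSuc ileI1 zero_less_iff_neq_zero)
  then show ?thesis by (metis sets.top)
next
  case False
  then have "{\<omega> \<in> space M. \<tau> \<omega> \<le> enat k} \<in> sets (F k)"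
    using assms by (auto simp: obs_stopping_times_def)
  from sets.compl_sets[OF this]
  have "space M - {\<omega> \<in> space M. \<tau> \<omega> \<le> enat k} \<in> sets (F k)" by simp
  moreover have "space M - {\<omega> \<in> space M. \<tau> \<omega> \<le> enat k} = {\<omega> \<in> space M. enat k < \<tau> \<omega>}"
    by auto
  ultimately show ?thesis by simp
qed

lemma test_stopping_time: "T \<in> obs_stopping_times L M X"
proof -
  have "1 \<le> T \<omega>" for \<omega>
    using test_le_iff[of \<omega> 0] by (auto simp: not_le enat_0 one_eSuc ileI1)
  moreover have "{\<omega> \<in> space M. T \<omega> \<le> enat k} \<in> sets (F k)" for k
  proof -
    have [measurable]: "stat j \<in> borel_measurable (F k)" if "j \<in> {1..k}" for j
      using that by (intro cusum.measurable_F_mono[OF stat_measurable]) simp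
    have "{\<omega> \<in> space (F k). \<exists>j\<in>{1..k}. ennreal (exp b) \<le> stat j \<omega>} \<in> sets (F k)"
      by measurable
    then show ?thesis
      unfolding test_le_iff space_obs_filtration .
  qed
  ultimately show ?thesis
    by (auto simp: obs_stopping_times_def)
qed

lemma mean_time_eq:
  assumes "\<tau> \<in> obs_stopping_times L M X"
  shows "mean_time Pinf \<tau> = (\<Sum>k. emeasure Pinf {\<omega> \<in> space M. enat k < \<tau> \<omega>})"
proof -
  have sets: "{\<omega> \<in> space Pinf. enat k < \<tau> \<omega>} \<in> sets Pinf" for k
    using cusum.sets_F_P[OF alarm_after_sets[OF assms]] by (simp add: space_Pinf)
  show ?thesis
    using nn_integral_residual_time[of Pinf \<tau> "\<lambda>_. 1" 0, OF sets] sets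
    by (simp add: mean_time_def enat_0 space_Pinf)
qed

lemma mean_time_test: "mean_time Pinf T = (\<Sum>k. emeasure Pinf (cusum.alive k))"
  unfolding mean_time_eq[OF test_stopping_time]
proof (intro suminf_cong emeasure_eq_AE)
  fix k
  show "AE \<omega> in Pinf. \<omega> \<in> {\<omega> \<in> space M. enat k < T \<omega>} \<longleftrightarrow> \<omega> \<in> cusum.alive k"
    using AE_Pinf_test[of k] AE_space by eventually_elim (simp add: space_Pinf)
  show "{\<omega> \<in> space M. enat k < T \<omega>} \<in> sets Pinf" "cusum.alive k \<in> sets Pinf"
    using cusum.sets_F_P alarm_after_sets[OF test_stopping_time] cusum.alive_sets by blast+
qed

text \<open>Given the history up to \<open>\<nu>\<close>, the probability of running
  \<open>j\<close> further steps is at most that of a start at level 0, whatever the path; the sum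
  over \<open>j\<close> is \<open>mean_delay\<close>.\<close>

lemma WADD_test_le: "WADD L m M X P T \<le> cusum.mean_delay"
  unfolding WADD_def
proof (intro SUP_least)
  fix S \<nu> assume S: "S \<in> anomaly_paths L m"
  let ?Q = "P \<nu> S" and ?s = "cusum.surv (\<lambda>x. ennreal (lr x))"
  let ?al = "\<lambda>k. {\<omega> \<in> space ?Q. enat k < T \<omega>}"
  note obs = obs_P[OF S, of \<nu>]
  have space: "space ?Q = space M" by (rule independent_obs_space[OF obs])
  have al_F: "?al k \<in> sets (F k)" for k
    using alarm_after_sets[OF test_stopping_time] by (simp add: space)
  have F_Q: "A \<in> sets (F k) \<Longrightarrow> A \<in> sets ?Q" for A k
    using subalgebra_obs_filtration[OF obs, of k] by (auto simp: subalgebra_def)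
  show "worst_cond_delay ?Q (F \<nu>) \<nu> T \<le> cusum.mean_delay"
  proof (rule worst_cond_delay_le)
    show "prob_space ?Q" by (rule independent_obs_prob_space[OF obs])
    show "subalgebra ?Q (F \<nu>)" by (rule subalgebra_obs_filtration[OF obs])
    show "?al k \<in> sets ?Q" for k by (rule F_Q[OF al_F])
    show "1 \<le> cusum.mean_delay"
      using sum_le_suminf[of "\<lambda>j. ?s j 0" "{0}"] by (simp add: cusum.mean_delay_def cusum.surv_0)
    fix A assume A: "A \<in> sets (F \<nu>)"
    have [measurable]: "A \<in> sets ?Q" by (rule F_Q[OF A])
    have base: "(\<integral>\<^sup>+\<omega>. indicator A \<omega> * indicator (cusum.alive \<nu>) \<omega> \<partial>Pinf) = emeasure ?Q (A \<inter> ?al \<nu>)"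
    proof -
      have "(\<integral>\<^sup>+\<omega>. indicator A \<omega> * indicator (cusum.alive \<nu>) \<omega> \<partial>Pinf)
          = (\<integral>\<^sup>+\<omega>. indicator A \<omega> * indicator (cusum.alive \<nu>) \<omega> \<partial>?Q)"
        using A cusum.alive_sets[of \<nu>] by (intro pre_change_integral[OF S, symmetric]) auto
      also have "\<dots> = (\<integral>\<^sup>+\<omega>. indicator (A \<inter> ?al \<nu>) \<omega> \<partial>?Q)"
      proof (rule nn_integral_cong_AE)
        show "AE \<omega> in ?Q. indicator A \<omega> * indicator (cusum.alive \<nu>) \<omega> = (indicator (A \<inter> ?al \<nu>) \<omega> :: ennreal)"
          using AE_P_test[OF S, of \<nu> \<nu>] AE_P_regular[OF S order_refl, of \<nu>] AE_space
          by eventually_elim (auto simp: indicator_def)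
      qed
      also have "\<dots> = emeasure ?Q (A \<inter> ?al \<nu>)"
        using A F_Q[OF al_F[of \<nu>]] by (intro nn_integral_indicator) auto
      finally show ?thesis .
    qed
    have tail: "(\<integral>\<^sup>+\<omega>. indicator A \<omega> * indicator (?al (\<nu> + j)) \<omega> \<partial>?Q) \<le> ?s j 0 * emeasure ?Q (A \<inter> ?al \<nu>)" for j
    proof -
      have AF: "A \<in> sets (F (\<nu> + j))"
        using A obs_filtration_mono[of \<nu> "\<nu> + j" L M X] by auto
      have "(\<integral>\<^sup>+\<omega>. indicator A \<omega> * indicator (?al (\<nu> + j)) \<omega> \<partial>?Q)
          = (\<integral>\<^sup>+\<omega>. indicator A \<omega> * indicator (cusum.alive (\<nu> + j)) \<omega> * indicator (regular (\<nu> + j)) \<omega> \<partial>?Q)"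
      proof (rule nn_integral_cong_AE)
        show "AE \<omega> in ?Q. indicator A \<omega> * indicator (?al (\<nu> + j)) \<omega>
            = (indicator A \<omega> * indicator (cusum.alive (\<nu> + j)) \<omega> * indicator (regular (\<nu> + j)) \<omega> :: ennreal)"
          using AE_P_test[OF S, where \<nu> = \<nu> and k = "\<nu> + j"] AE_space by eventually_elim (auto simp: indicator_def)
      qed
      also have "\<dots> = (\<integral>\<^sup>+\<omega>. indicator A \<omega> * indicator (cusum.alive (\<nu> + j)) \<omega> *
          (\<Prod>i\<in>{\<nu>+1..\<nu>+j}. ennreal (post (S i) (X i \<omega>) / pre (X i \<omega>))) \<partial>Pinf)"
        using AF cusum.alive_sets[of "\<nu> + j"] by (intro likelihood[OF S]) auto
      also have "\<dots> = (\<integral>\<^sup>+\<omega>. indicator A \<omega> * indicator (cusum.alive (\<nu> + j)) \<omega> *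
          (\<Prod>i\<in>{\<nu>+1..\<nu>+j}. ennreal (post (S i) (X i \<omega>) / pre (X i \<omega>))) * 1 \<partial>Pinf)"
        by simp
      also have "\<dots> = (\<integral>\<^sup>+\<omega>. indicator A \<omega> * indicator (cusum.alive \<nu>) \<omega> *
          (cusum.kill (\<lambda>x. ennreal (lr x)) ^^ j) (\<lambda>_. 1) (cusum.W \<nu> \<omega>) \<partial>Pinf)"
      \<comment> \<open>The ratios vary with the path, but each has the same killed operator as
        \<open>lr\<close>; uniform weights and homogeneity enter here.\<close>
      proof (rule cusum.alive_weighted)
        fix i assume "\<nu> < i"
        then have "S i \<in> Es"
          using S by (auto simp: anomaly_paths_def)
        then show "(\<lambda>x. ennreal (post (S i) x / pre x)) \<in> borel_measurable law_pre"
          "v \<in> borel_measurable borel \<Longrightarrow> cusum.kill (\<lambda>x. ennreal (post (S i) x / pre x)) v = cusum.kill (\<lambda>x. ennreal (lr x)) v" for v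
          using post_measurable kill_lr by measurable
      qed (use A in auto)
      also have "\<dots> \<le> (\<integral>\<^sup>+\<omega>. ?s j 0 * (indicator A \<omega> * indicator (cusum.alive \<nu>) \<omega>) \<partial>Pinf)"
        unfolding cusum.surv_def[symmetric]
        by (intro nn_integral_mono) (auto simp: indicator_def intro: cusum.surv_le)
      also have "\<dots> = ?s j 0 * emeasure ?Q (A \<inter> ?al \<nu>)"
        unfolding base[symmetric]
        by (intro nn_integral_cmult borel_measurable_times_ennreal borel_measurable_indicator
            cusum.sets_F_P[OF A] cusum.sets_F_P[OF cusum.alive_sets])
      finally show ?thesis .
    qed
    have "(\<integral>\<^sup>+\<omega>. indicator A \<omega> * ennreal_of_enat (T \<omega> - enat \<nu>) * indicator (?al \<nu>) \<omega> \<partial>?Q)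
        \<le> (\<integral>\<^sup>+\<omega>. indicator A \<omega> * ennreal_of_enat (T \<omega> - enat \<nu>) \<partial>?Q)"
      by (intro nn_integral_mono) (auto simp: indicator_def)
    also have "\<dots> = (\<Sum>j. \<integral>\<^sup>+\<omega>. indicator A \<omega> * indicator (?al (\<nu> + j)) \<omega> \<partial>?Q)"
      by (rule nn_integral_residual_time[OF F_Q[OF al_F]]) measurable
    also have "\<dots> \<le> (\<Sum>j. ?s j 0 * emeasure ?Q (A \<inter> ?al \<nu>))"
      by (intro suminf_le tail summableI)
    also have "\<dots> = cusum.mean_delay * emeasure ?Q (A \<inter> ?al \<nu>)"
      by (simp add: cusum.mean_delay_def)
    finally show "(\<integral>\<^sup>+\<omega>. indicator A \<omega> * ennreal_of_enat (T \<omega> - enat \<nu>) * indicator (?al \<nu>) \<omega> \<partial>?Q)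
        \<le> cusum.mean_delay * emeasure ?Q (A \<inter> ?al \<nu>)" .
  qed
qed

text \<open>
  The mixture likelihood ratio is the average of the likelihood ratios of all anomaly paths, so a
  delay bound valid along every path also holds for the mixture.
\<close>

lemma lr_prod_eq_sum:
  assumes "k \<le> n"
  shows "(\<Prod>i\<in>{\<nu>+1..k}. ennreal (lr (X i \<omega>)))
    = (\<Sum>S\<in>{\<nu>+1..n} \<rightarrow>\<^sub>E Es. ennreal (1 / real (L choose m)) ^ (n - \<nu>) *
        (\<Prod>i\<in>{\<nu>+1..k}. ennreal (post (S i) (X i \<omega>) / pre (X i \<omega>))))"
proof -
  let ?c = "ennreal (1 / real (L choose m))"
  \<comment> \<open>Times after \<open>k\<close> are padded with weights that sum to 1. All
    \<open>k \<le> n\<close> then share one set of path segments, and the average can be exchanged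
    with a sum over \<open>k\<close>.\<close>
  define a where "a i E = ?c * (if i \<le> k then ennreal (post E (X i \<omega>) / pre (X i \<omega>)) else 1)" for i E
  have one: "(\<Sum>E\<in>Es. ?c * 1) = 1"
    using Es(4) by (simp add: Es(2) ennreal_of_nat_eq_real_of_nat ennreal_mult[symmetric])
  have extend: "(\<Prod>i\<in>{\<nu>+1..n}. if i \<le> k then h i else 1) = (\<Prod>i\<in>{\<nu>+1..k}. h i)" for h :: "nat \<Rightarrow> ennreal"
    using assms by (intro prod.mono_neutral_cong_right) auto
  have "(\<Prod>i\<in>{\<nu>+1..k}. ennreal (lr (X i \<omega>))) = (\<Prod>i\<in>{\<nu>+1..n}. \<Sum>E\<in>Es. a i E)"
    unfolding extend[symmetric] by (intro prod.cong refl) (auto simp: a_def lr_eq_sum simp del: mult_1_right sum_constant simp: one)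
  also have "\<dots> = (\<Sum>S\<in>{\<nu>+1..n} \<rightarrow>\<^sub>E Es. \<Prod>i\<in>{\<nu>+1..n}. a i (S i))"
    by (rule prod_sum_PiE) (auto simp: Es)
  also have "\<dots> = (\<Sum>S\<in>{\<nu>+1..n} \<rightarrow>\<^sub>E Es. ?c ^ (n - \<nu>) *
        (\<Prod>i\<in>{\<nu>+1..k}. ennreal (post (S i) (X i \<omega>) / pre (X i \<omega>))))"
    unfolding a_def prod.distrib extend by simp
  finally show ?thesis .
qed

section \<open>Delay bounds for an arbitrary stopping time\<close>

context
  fixes \<tau> :: "'w \<Rightarrow> enat"
  assumes \<tau>: "\<tau> \<in> obs_stopping_times L M X"
begin

abbreviation (input) "running \<equiv> (\<lambda>k. {\<omega> \<in> space M. enat k < \<tau> \<omega>})"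

lemma running_sets_Pinf: "running k \<in> sets Pinf"
  by (rule cusum.sets_F_P[OF alarm_after_sets[OF \<tau>]])

text \<open>The left side is part of the expected residual time after \<open>\<nu>\<close>, weighted
  by \<open>\<phi>\<close>, which the worst conditional delay controls. It is truncated at
  \<open>n\<close> so that only finitely many values of the path matter when paths are
  averaged.\<close>

lemma path_delay:
  assumes S: "S \<in> anomaly_paths L m" and phi: "\<phi> \<in> borel_measurable (F \<nu>)"
  shows "(\<Sum>k\<in>{\<nu>..<n}. \<integral>\<^sup>+\<omega>. \<phi> \<omega> * indicator (running k) \<omega> *
            (\<Prod>i\<in>{\<nu>+1..k}. ennreal (post (S i) (X i \<omega>) / pre (X i \<omega>))) \<partial>Pinf)
    \<le> WADD L m M X P \<tau> * (\<integral>\<^sup>+\<omega>. \<phi> \<omega> * indicator (running \<nu>) \<omega> \<partial>Pinf)"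
proof -
  let ?Q = "P \<nu> S"
  note obs = obs_P[OF S, of \<nu>]
  have space: "space ?Q = space M" by (rule independent_obs_space[OF obs])
  have run_F: "running k \<in> sets (F k)" for k
    by (rule alarm_after_sets[OF \<tau>])
  have run_Q: "running k \<in> sets ?Q" for k
    using run_F subalgebra_obs_filtration[OF obs, of k] by (auto simp: subalgebra_def)
  have phi_Q [measurable]: "\<phi> \<in> borel_measurable ?Q"
    by (rule measurable_from_subalg[OF subalgebra_obs_filtration[OF obs] phi])
  have "(\<Sum>k\<in>{\<nu>..<n}. \<integral>\<^sup>+\<omega>. \<phi> \<omega> * indicator (running k) \<omega> *
            (\<Prod>i\<in>{\<nu>+1..k}. ennreal (post (S i) (X i \<omega>) / pre (X i \<omega>))) \<partial>Pinf)
      = (\<Sum>k\<in>{\<nu>..<n}. \<integral>\<^sup>+\<omega>. \<phi> \<omega> * indicator (running k) \<omega> * indicator (regular k) \<omega> \<partial>?Q)"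
  proof (intro sum.cong refl likelihood[OF S, symmetric])
    fix k assume k: "k \<in> {\<nu>..<n}"
    have "\<phi> \<in> borel_measurable (F k)"
      using k by (intro cusum.measurable_F_mono[OF phi]) simp
    then show "(\<lambda>\<omega>. \<phi> \<omega> * indicator (running k) \<omega>) \<in> borel_measurable (F k)"
      using run_F[of k] by (intro borel_measurable_times_ennreal borel_measurable_indicator)
  qed simp
  \<comment> \<open>The mass on histories impossible before the change is added back here; it can
    only enlarge the delay.\<close>
  also have "\<dots> \<le> (\<Sum>k\<in>{\<nu>..<n}. \<integral>\<^sup>+\<omega>. \<phi> \<omega> * indicator (running k) \<omega> \<partial>?Q)"
    by (intro sum_mono nn_integral_mono) (auto simp: indicator_def)
  also have "\<dots> = (\<Sum>j<n - \<nu>. \<integral>\<^sup>+\<omega>. \<phi> \<omega> * indicator (running (\<nu> + j)) \<omega> \<partial>?Q)"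
    by (rule sum.reindex_bij_witness[of _ "\<lambda>j. \<nu> + j" "\<lambda>k. k - \<nu>"]) auto
  also have "\<dots> \<le> (\<Sum>j. \<integral>\<^sup>+\<omega>. \<phi> \<omega> * indicator (running (\<nu> + j)) \<omega> \<partial>?Q)"
    by (intro sum_le_suminf) auto
  also have "\<dots> = (\<integral>\<^sup>+\<omega>. \<phi> \<omega> * ennreal_of_enat (\<tau> \<omega> - enat \<nu>) \<partial>?Q)"
    unfolding space[symmetric]
    by (rule nn_integral_residual_time[symmetric]) (use run_Q phi_Q in \<open>auto simp: space\<close>)
  also have "\<dots> = (\<integral>\<^sup>+\<omega>. \<phi> \<omega> * ennreal_of_enat (\<tau> \<omega> - enat \<nu>) * indicator (running \<nu>) \<omega> \<partial>?Q)"
  proof (rule nn_integral_cong)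
    fix \<omega> assume "\<omega> \<in> space ?Q"
    moreover have "\<tau> \<omega> - enat \<nu> = 0" if "\<not> enat \<nu> < \<tau> \<omega>"
      using that by (cases "\<tau> \<omega>") (auto simp: zero_enat_def)
    ultimately show "\<phi> \<omega> * ennreal_of_enat (\<tau> \<omega> - enat \<nu>)
        = \<phi> \<omega> * ennreal_of_enat (\<tau> \<omega> - enat \<nu>) * indicator (running \<nu>) \<omega>"
      by (auto simp: indicator_def space)
  qed
  also have "\<dots> \<le> worst_cond_delay ?Q (F \<nu>) \<nu> \<tau> * (\<integral>\<^sup>+\<omega>. \<phi> \<omega> * indicator (running \<nu>) \<omega> \<partial>?Q)"
    unfolding space[symmetric]
    by (rule worst_cond_delay_bounds)
       (use run_Q phi obs in \<open>auto simp: space intro: independent_obs_prob_space subalgebra_obs_filtration\<close>)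
  also have "(\<integral>\<^sup>+\<omega>. \<phi> \<omega> * indicator (running \<nu>) \<omega> \<partial>?Q) = (\<integral>\<^sup>+\<omega>. \<phi> \<omega> * indicator (running \<nu>) \<omega> \<partial>Pinf)"
    by (intro pre_change_integral[OF S] borel_measurable_times_ennreal borel_measurable_indicator phi run_F)
  also have "worst_cond_delay ?Q (F \<nu>) \<nu> \<tau> * \<dots> \<le> WADD L m M X P \<tau> * \<dots>"
    unfolding WADD_def by (intro mult_right_mono SUP_upper2[OF S] SUP_upper2[of \<nu>]) auto
  finally show ?thesis .
qed

lemma mixture_delay:
  assumes phi: "\<phi> \<in> borel_measurable (F \<nu>)"
  shows "(\<Sum>k\<in>{\<nu>..<n}. \<integral>\<^sup>+\<omega>. \<phi> \<omega> * indicator (running k) \<omega> * (\<Prod>i\<in>{\<nu>+1..k}. ennreal (lr (X i \<omega>))) \<partial>Pinf)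
    \<le> WADD L m M X P \<tau> * (\<integral>\<^sup>+\<omega>. \<phi> \<omega> * indicator (running \<nu>) \<omega> \<partial>Pinf)"
proof -
  let ?c = "ennreal (1 / real (L choose m)) ^ (n - \<nu>)" and ?G = "{\<nu>+1..n} \<rightarrow>\<^sub>E Es"
  let ?R = "WADD L m M X P \<tau> * (\<integral>\<^sup>+\<omega>. \<phi> \<omega> * indicator (running \<nu>) \<omega> \<partial>Pinf)"
  let ?I = "\<lambda>S k. \<integral>\<^sup>+\<omega>. \<phi> \<omega> * indicator (running k) \<omega> *
    (\<Prod>i\<in>{\<nu>+1..k}. ennreal (post (S i) (X i \<omega>) / pre (X i \<omega>))) \<partial>Pinf"
  have phi_P: "\<phi> \<in> borel_measurable Pinf"
    by (rule cusum.measurable_F_P[OF phi])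
  have path: "(\<Sum>k\<in>{\<nu>..<n}. ?I S k) \<le> ?R" if S: "S \<in> ?G" for S
  proof -
    obtain E where E: "E \<in> Es" using Es(3) by blast
    \<comment> \<open>\<open>path_delay\<close> speaks of infinite paths, so the segment is
      prolonged by an arbitrary anomaly set; the factors up to \<open>n\<close> are
      unchanged.\<close>
    define S' where "S' i = (if i \<in> {\<nu>+1..n} then S i else E)" for i
    have "S' \<in> anomaly_paths L m"
      using S E by (auto simp: anomaly_paths_def S'_def PiE_iff)
    from path_delay[OF this phi, of n] have "(\<Sum>k\<in>{\<nu>..<n}. ?I S' k) \<le> ?R" .
    moreover have "?I S' k = ?I S k" if "k \<in> {\<nu>..<n}" for k
    proof -
      have "(\<Prod>i\<in>{\<nu>+1..k}. ennreal (post (S' i) (X i \<omega>) / pre (X i \<omega>)))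
          = (\<Prod>i\<in>{\<nu>+1..k}. ennreal (post (S i) (X i \<omega>) / pre (X i \<omega>)))" for \<omega>
        using that by (intro prod.cong) (auto simp: S'_def)
      then show ?thesis by simp
    qed
    ultimately show ?thesis by simp
  qed
  have weights: "(\<Sum>S\<in>?G. ?c) = 1"
  proof -
    have "(\<Sum>S\<in>?G. ?c) = of_nat ((L choose m) ^ (n - \<nu>)) * ?c"
      by (simp add: card_PiE Es)
    also have "\<dots> = (of_nat (L choose m) * ennreal (1 / real (L choose m))) ^ (n - \<nu>)"
      by (simp add: power_mult_distrib)
    also have "of_nat (L choose m) * ennreal (1 / real (L choose m)) = 1"
      using Es(4) by (simp add: ennreal_of_nat_eq_real_of_nat ennreal_mult[symmetric])
    finally show ?thesis by simp
  qed
  have "(\<Sum>k\<in>{\<nu>..<n}. \<integral>\<^sup>+\<omega>. \<phi> \<omega> * indicator (running k) \<omega> * (\<Prod>i\<in>{\<nu>+1..k}. ennreal (lr (X i \<omega>))) \<partial>Pinf)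
      = (\<Sum>k\<in>{\<nu>..<n}. \<Sum>S\<in>?G. ?c * ?I S k)"
  proof (intro sum.cong refl)
    fix k assume k: "k \<in> {\<nu>..<n}"
    have meas: "(\<lambda>\<omega>. \<phi> \<omega> * indicator (running k) \<omega> *
        (\<Prod>i\<in>{\<nu>+1..k}. ennreal (post (S i) (X i \<omega>) / pre (X i \<omega>)))) \<in> borel_measurable Pinf"
      if S: "S \<in> ?G" for S
    proof -
      have [measurable]: "X i \<in> Pinf \<rightarrow>\<^sub>M obs_space L" "post (S i) \<in> borel_measurable (obs_space L)"
        if "i \<in> {\<nu>+1..k}" for i
        using that k S by (auto intro!: independent_obs_measurable[OF obs_Pinf] post_measurable simp: PiE_iff)
      note [measurable] = phi_P running_sets_Pinf[of k]
      show ?thesis by measurable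
    qed
    have "(\<integral>\<^sup>+\<omega>. \<phi> \<omega> * indicator (running k) \<omega> * (\<Prod>i\<in>{\<nu>+1..k}. ennreal (lr (X i \<omega>))) \<partial>Pinf)
        = (\<integral>\<^sup>+\<omega>. (\<Sum>S\<in>?G. ?c * (\<phi> \<omega> * indicator (running k) \<omega> *
            (\<Prod>i\<in>{\<nu>+1..k}. ennreal (post (S i) (X i \<omega>) / pre (X i \<omega>))))) \<partial>Pinf)"
      using k by (subst lr_prod_eq_sum[of k n]) (auto simp: sum_distrib_left ac_simps)
    also have "\<dots> = (\<Sum>S\<in>?G. \<integral>\<^sup>+\<omega>. ?c * (\<phi> \<omega> * indicator (running k) \<omega> *
            (\<Prod>i\<in>{\<nu>+1..k}. ennreal (post (S i) (X i \<omega>) / pre (X i \<omega>)))) \<partial>Pinf)"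
      by (intro nn_integral_sum borel_measurable_times_ennreal[OF borel_measurable_const meas])
    also have "\<dots> = (\<Sum>S\<in>?G. ?c * ?I S k)"
      by (intro sum.cong refl nn_integral_cmult meas)
    finally show "(\<integral>\<^sup>+\<omega>. \<phi> \<omega> * indicator (running k) \<omega> * (\<Prod>i\<in>{\<nu>+1..k}. ennreal (lr (X i \<omega>))) \<partial>Pinf)
        = (\<Sum>S\<in>?G. ?c * ?I S k)" .
  qed
  also have "\<dots> = (\<Sum>S\<in>?G. ?c * (\<Sum>k\<in>{\<nu>..<n}. ?I S k))"
    unfolding sum_distrib_left by (rule sum.swap)
  also have "\<dots> \<le> (\<Sum>S\<in>?G. ?c * ?R)"
    by (intro sum_mono mult_left_mono path) auto
  also have "\<dots> = ?R"
    using weights by (simp only: sum_distrib_right[symmetric] mult_1_left)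
  finally show ?thesis .
qed

text \<open>Summing \<open>mixture_delay\<close> over the changepoints and exchanging the sums over
  \<open>\<nu> \<le> k < n\<close> recovers \<open>max 1 (W k)\<close>. This is the delay hypothesis
  of the abstract comparison, with \<open>WADD\<close> in the place of \<open>d\<close>.\<close>

lemma weighted_delay:
  "(\<Sum>k<n. \<integral>\<^sup>+\<omega>. indicator (running k) \<omega> * ennreal (max 1 (cusum.W k \<omega>)) \<partial>Pinf)
   \<le> WADD L m M X P \<tau> * (\<Sum>k<n. \<integral>\<^sup>+\<omega>. indicator (running k) \<omega> * ennreal (max 0 (1 - cusum.W k \<omega>)) \<partial>Pinf)"
proof -
  let ?\<phi> = "\<lambda>\<nu> \<omega>. ennreal (max 0 (1 - cusum.W \<nu> \<omega>))"
  let ?I = "\<lambda>\<nu> k. \<integral>\<^sup>+\<omega>. ?\<phi> \<nu> \<omega> * indicator (running k) \<omega> * (\<Prod>i\<in>{\<nu>+1..k}. ennreal (lr (X i \<omega>))) \<partial>Pinf"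
  have "(\<integral>\<^sup>+\<omega>. indicator (running k) \<omega> * ennreal (max 1 (cusum.W k \<omega>)) \<partial>Pinf) = (\<Sum>\<nu>\<le>k. ?I \<nu> k)" for k
  proof -
    have [measurable]: "X i \<in> Pinf \<rightarrow>\<^sub>M law_pre" if "i \<in> {\<nu>+1..k}" for i \<nu>
      using that by (intro cusum.measurable_F_P[OF cusum.X_measurable[of i i]]) auto
    have [measurable]: "cusum.W \<nu> \<in> borel_measurable Pinf" for \<nu>
      by (rule cusum.measurable_F_P[OF cusum.W_measurable])
    note [measurable] = running_sets_Pinf[of k]
    have "(\<integral>\<^sup>+\<omega>. indicator (running k) \<omega> * ennreal (max 1 (cusum.W k \<omega>)) \<partial>Pinf)
        = (\<integral>\<^sup>+\<omega>. (\<Sum>\<nu>\<le>k. ?\<phi> \<nu> \<omega> * indicator (running k) \<omega> * (\<Prod>i\<in>{\<nu>+1..k}. ennreal (lr (X i \<omega>)))) \<partial>Pinf)"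
      unfolding cusum.ennreal_max_W_eq_sum sum_distrib_left by (intro nn_integral_cong sum.cong) (auto simp: ac_simps)
    also have "\<dots> = (\<Sum>\<nu>\<le>k. ?I \<nu> k)"
      by (rule nn_integral_sum) measurable
    finally show ?thesis .
  qed
  then have "(\<Sum>k<n. \<integral>\<^sup>+\<omega>. indicator (running k) \<omega> * ennreal (max 1 (cusum.W k \<omega>)) \<partial>Pinf)
      = (\<Sum>k<n. \<Sum>\<nu>\<le>k. ?I \<nu> k)"
    by simp
  also have "\<dots> = (\<Sum>\<nu><n. \<Sum>k\<in>{\<nu>..<n}. ?I \<nu> k)"
    unfolding sum.Sigma[OF finite_lessThan, simplified]
    by (subst (1 2) sum.Sigma) (auto intro!: sum.reindex_bij_witness[of _ prod.swap prod.swap])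
  also have "\<dots> \<le> (\<Sum>\<nu><n. WADD L m M X P \<tau> * (\<integral>\<^sup>+\<omega>. ?\<phi> \<nu> \<omega> * indicator (running \<nu>) \<omega> \<partial>Pinf))"
    by (intro sum_mono mixture_delay) measurable
  also have "\<dots> = WADD L m M X P \<tau> * (\<Sum>k<n. \<integral>\<^sup>+\<omega>. indicator (running k) \<omega> * ?\<phi> k \<omega> \<partial>Pinf)"
    by (simp only: sum_distrib_left mult.commute[of "ennreal _" "indicator _ _"])
  finally show ?thesis .
qed

end

text \<open>\<open>mean_delay\<close> separates the two sides: it bounds the delay of the test from
  above and that of every competitor of at least equal mean duration from below.\<close>

theorem mcusum_optimal:
  assumes finite: "mean_time Pinf T < \<infinity>"
    and \<tau>: "\<tau> \<in> obs_stopping_times L M X" and longer: "mean_time Pinf T \<le> mean_time Pinf \<tau>"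
  shows "WADD L m M X P T \<le> WADD L m M X P \<tau>"
proof -
  have "cusum.mean_delay \<le> WADD L m M X P \<tau>"
  proof (rule cusum.mean_delay_le)
    show "{\<omega> \<in> space M. enat k < \<tau> \<omega>} \<in> sets (F k)" for k
      by (rule alarm_after_sets[OF \<tau>])
    show "{\<omega> \<in> space M. enat (Suc k) < \<tau> \<omega>} \<subseteq> {\<omega> \<in> space M. enat k < \<tau> \<omega>}" for k
      by (auto elim: order_less_trans[rotated])
    show "{\<omega> \<in> space M. enat 0 < \<tau> \<omega>} = space Pinf"
      using \<tau> by (auto simp: space_Pinf obs_stopping_times_def enat_0 one_eSuc ileI1 zero_less_iff_neq_zero)
    show "(\<Sum>k. emeasure Pinf (cusum.alive k)) < \<infinity>"
      using finite by (simp add: mean_time_test)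
    show "(\<Sum>k. emeasure Pinf (cusum.alive k)) \<le> (\<Sum>k. emeasure Pinf {\<omega> \<in> space M. enat k < \<tau> \<omega>})"
      using longer by (simp only: mean_time_test mean_time_eq[OF \<tau>])
  qed (rule weighted_delay[OF \<tau>])
  with WADD_test_le show ?thesis by (rule order_trans)
qed

end

theorem theorem2:
  fixes L m :: nat
    and g f :: "real \<Rightarrow> real"
    and gs fs :: "nat \<Rightarrow> real \<Rightarrow> real"
    and M :: "'w measure"
    and X :: "nat \<Rightarrow> 'w \<Rightarrow> nat \<Rightarrow> real"
    and P :: "nat \<Rightarrow> (nat \<Rightarrow> nat set) \<Rightarrow> 'w measure"
    and Pinf :: "'w measure"
    and \<gamma> b :: real
  assumes "1 \<le> L" and "1 \<le> m" and "m \<le> L"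
    and "pdf_on_reals g" and "pdf_on_reals f"
    and different: "density lborel (\<lambda>x. ennreal (g x)) \<noteq> density lborel (\<lambda>x. ennreal (f x))"
    and homogeneous: "\<forall>l\<in>{1..L}. gs l = g \<and> fs l = f"
    and model: "moving_anomaly_model L m gs fs M X P Pinf"
    and "1 < \<gamma>" and "0 < b"
    and threshold: "mean_time Pinf (mcusum_test L m gs fs X (uniform_weights L m) b) = ennreal \<gamma>"
  shows "mcusum_test L m gs fs X (uniform_weights L m) b \<in> admissible_tests L M X Pinf \<gamma> \<and>
         WADD L m M X P (mcusum_test L m gs fs X (uniform_weights L m) b) =
           (INF \<tau>\<in>admissible_tests L M X Pinf \<gamma>. WADD L m M X P \<tau>)"
proof -
  interpret homogeneous_anomaly L m g f gs fs M X P Pinf b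
    using assms by unfold_locales
  have admissible: "T \<in> admissible_tests L M X Pinf \<gamma>"
    using test_stopping_time threshold by (simp add: admissible_tests_def)
  moreover have "WADD L m M X P T \<le> WADD L m M X P \<tau>" if "\<tau> \<in> admissible_tests L M X Pinf \<gamma>" for \<tau>
    using that threshold by (intro mcusum_optimal) (simp_all add: admissible_tests_def)
  then have "WADD L m M X P T = (INF \<tau>\<in>admissible_tests L M X Pinf \<gamma>. WADD L m M X P \<tau>)"
    using admissible by (intro antisym INF_greatest INF_lower)
  ultimately show ?thesis by simp
qed

end
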